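(* Let $\mathscr D$ be a dyadic lattice on $\mathbb R$, let $N\in\mathbb N_0$, $1<p<\infty$, let $\mu$ be a balanced measure on $\mathbb R$, and let $T$ be a Haar shift with coefficients bounded by $1$ and total complexity at most $N$. Let $\omega$ be a weight and set $\sigma=\omega^{1-p'}$. Then $$\|T\|_{L^p_\omega\to L^p_\omega}\le C\,[\omega]_{A_p^N(\mu)}^{1/p}\Bigl([\sigma]_{A_\infty^{\mathscr D}(\mu)}^{1/p}+[\omega]_{A_\infty^{\mathscr D}(\mu)}^{1/p'}\Bigr),$$ and, in particular, $$\|T\|_{L^p_\omega\to L^p_\omega}\le C\,[\omega]_{A_p^N(\mu)}^{\max\{1,1/(p-1)\}},$$ where $C$ depends only on $p$, $N$ and $\mu$.
   Context: A dyadic lattice $\mathscr D$ on $\mathbb R$ is a collection of half-open intervals such that both halves $I_-,I_+$ of every $I\in\mathscr D$ are in $\mathscr D$; any two members have a common dyadic ancestor in $\mathscr D$; every compact set is contained in a member of $\mathscr D$. $I^{(r)}$ is the $r$-th dyadic ancestor, $I^{(0)}=I$; $\operatorname{dist}_{\mathscr D}(I,J):=\min\{r+t:r,t\in\mathbb N_0,\ I^{(r)}=J^{(t)}\}$. $\mu$ is a locally finite Borel measure on $\mathbb R$. Intervals of zero $\mu$-measure are omitted from averages, sums and suprema. $\langle f\rangle_I^\mu:=\mu(I)^{-1}\int_If\,\mathrm d\mu$. Put $m_\mu(I):=\mu(I_-)\mu(I_+)/\mu(I)$. The measure $\mu$ is balanced if it is atomless and there is $\beta\ge1$ with $\beta^{-1}m_\mu(I^{(1)})\le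 m_\mu(I)\le\beta\,m_\mu(I^{(1)})$ for all $I\in\mathscr D$. A weight is a locally $\mu$-integrable function positive $\mu$-a.e.; $L^p_\omega:=L^p(\mathbb R,\omega\,\mathrm d\mu)$; $v(I)=\int_Iv\,\mathrm d\mu$; $1/p+1/p'=1$. Haar functions: $h_I:=\sqrt{m_\mu(I)}\bigl(\frac{\mathbf 1_{I_-}}{\mu(I_-)}-\frac{\mathbf 1_{I_+}}{\mu(I_+)}\bigr)$ (and $h_I:=0$ if a child of $I$ has measure $0$). A Haar shift of complexity $(s,t)\in\mathbb N_0^2$ is an operator $Tf=\sum_{I\in\mathscr D}\ \sum_{J\in\mathscr D:\,J\subseteq I,\,J^{(s)}=I}\ \sum_{K\in\mathscr D:\,K\subseteq I,\,K^{(t)}=I}\alpha^I_{J,K}\Bigl(\int f h_J\,\mathrm d\mu\Bigr)h_K$; its coefficients are bounded by $1$ if $|\alpha^I_{J,K}|\le1$ for all $I,J,K$, and its total complexity is $s+t$. The series converges in $L^2(\mu)$ for $f\in L^2(\mu)$; the norm $\|T\|_{L^p_\omega\to L^p_\omega}$ is understood as the least $C$ with $\|Tf\|_{L^p_\omega}\le C\|f\|_{L^p_\omega}$ for all bounded compactly supported $f\in L^p_\omega$ (then extended by density). Characteristics: $[\omega]_{A_p^N(\mu)}:=\max\Bigl\{\sup_{I\in\mathscr D}\langle\omega\rangle_I^\mu(\langle\sigma\rangle_I^\mu)^{p-1},\ \sup_{I,J\in\mathscr D,\ I\ne J,\ \operatorname{dist}_{\mathscr D}(I,J)\le N+2}\frac{m_\mu(I)^{p/2}m_\mu(J)^{p/2}}{\mu(J)\mu(I)^{p-1}}\langle\omega\rangle_I^\mu(\langle\sigma\rangle_J^\mu)^{p-1}\Bigr\}$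 (equal to $\infty$, making the bounds void, if $\sigma$ is not locally $\mu$-integrable); $[v]_{A_\infty^{\mathscr D}(\mu)}:=\sup_{Q\in\mathscr D}\frac1{v(Q)}\int_QM_{\mathscr D}(v\mathbf 1_Q)\,\mathrm d\mu$, $M_{\mathscr D}f(x):=\sup_{Q\in\mathscr D}\langle|f|\rangle_Q^\mu\mathbf 1_Q(x)$. *)

theory Defs
  imports "HOL-Analysis.Analysis"
begin

section \<open>Dyadic lattices\<close>

text \<open>Dyadic intervals are sets \<open>{a..<b}\<close> with \<open>a < b\<close>, whose endpoints are recovered
  as infimum and supremum.\<close>

definition left_half :: "real set \<Rightarrow> real set" where
  "left_half I = {Inf I ..< (Inf I + Sup I) / 2}"

definition right_half :: "real set \<Rightarrow> real set" where
  "right_half I = {(Inf I + Sup I) / 2 ..< Sup I}"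

definition dyadic_child :: "real set \<Rightarrow> real set \<Rightarrow> bool" where
  "dyadic_child I J \<longleftrightarrow> I = left_half J \<or> I = right_half J"

definition dyadic_lattice :: "real set set \<Rightarrow> bool" where
  "dyadic_lattice D \<longleftrightarrow>
     (\<forall>I\<in>D. \<exists>a b. a < b \<and> I = {a..<b}) \<and>
     (\<forall>I\<in>D. left_half I \<in> D \<and> right_half I \<in> D) \<and>
     (\<forall>I\<in>D. \<forall>J\<in>D. \<exists>K\<in>D. dyadic_child\<^sup>*\<^sup>* I K \<and> dyadic_child\<^sup>*\<^sup>* J K) \<and>
     (\<forall>K. compact K \<longrightarrow> (\<exists>I\<in>D. K \<subseteq> I))"

text \<open>In a dyadic lattice the parent exists: some member is strictly larger than \<open>I\<close> by
  compactness, so \<open>I\<close> has a proper ancestor in \<open>D\<close>, and the intermediate intervals lie in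
  \<open>D\<close> as well. It is unique because two distinct intervals of equal length with a common
  ancestor are disjoint.\<close>

definition dyadic_parent :: "real set set \<Rightarrow> real set \<Rightarrow> real set" where
  "dyadic_parent D I = (THE J. J \<in> D \<and> dyadic_child I J)"

definition dyadic_ancestor :: "real set set \<Rightarrow> nat \<Rightarrow> real set \<Rightarrow> real set" where
  "dyadic_ancestor D r I = (dyadic_parent D ^^ r) I"

definition dyadic_dist :: "real set set \<Rightarrow> real set \<Rightarrow> real set \<Rightarrow> nat" where
  "dyadic_dist D I J =
     (LEAST n. \<exists>r t. n = r + t \<and> dyadic_ancestor D r I = dyadic_ancestor D t J)"

section \<open>Balanced measures\<close>

definition locally_finite_borel :: "real measure \<Rightarrow> bool" where
  "locally_finite_borel \<mu> \<longleftrightarrow>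
     sets \<mu> = sets borel \<and> (\<forall>x. \<exists>U. open U \<and> x \<in> U \<and> emeasure \<mu> U < \<infinity>)"

definition atomless :: "'a measure \<Rightarrow> bool" where
  "atomless M \<longleftrightarrow>
     \<not> (\<exists>A\<in>sets M. emeasure M A > 0 \<and>
          (\<forall>B\<in>sets M. B \<subseteq> A \<longrightarrow> emeasure M B = 0 \<or> emeasure M B = emeasure M A))"

definition m_meas :: "real measure \<Rightarrow> real set \<Rightarrow> real" where
  "m_meas \<mu> I = measure \<mu> (left_half I) * measure \<mu> (right_half I) / measure \<mu> I"

text \<open>An interval \<open>I\<close> of measure zero imposes no condition: by \<open>x / 0 = 0\<close> we have
  \<open>m_meas \<mu> I = 0\<close>, and \<open>m_meas\<close> also vanishes at its parent, one of whose halves is \<open>I\<close>.\<close>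

definition balanced_with :: "real \<Rightarrow> real set set \<Rightarrow> real measure \<Rightarrow> bool" where
  "balanced_with \<beta> D \<mu> \<longleftrightarrow>
     atomless \<mu> \<and> \<beta> \<ge> 1 \<and>
     (\<forall>I\<in>D. m_meas \<mu> (dyadic_parent D I) / \<beta> \<le> m_meas \<mu> I \<and>
             m_meas \<mu> I \<le> \<beta> * m_meas \<mu> (dyadic_parent D I))"

section \<open>Weights and Lebesgue norms\<close>

text \<open>Powers of extended nonnegative reals, used for exponents \<open>a > 0\<close> only.\<close>

definition epowr :: "ennreal \<Rightarrow> real \<Rightarrow> ennreal" where
  "epowr x a = (if x = \<infinity> then \<infinity> else ennreal (enn2real x powr a))"

definition Lp_norm :: "'a measure \<Rightarrow> real \<Rightarrow> ('a \<Rightarrow> complex) \<Rightarrow> ennreal" where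
  "Lp_norm M p f = epowr (\<integral>\<^sup>+x. ennreal (norm (f x) powr p) \<partial>M) (1 / p)"

definition in_Lp :: "'a measure \<Rightarrow> real \<Rightarrow> ('a \<Rightarrow> complex) \<Rightarrow> bool" where
  "in_Lp M p f \<longleftrightarrow> f \<in> borel_measurable M \<and> Lp_norm M p f < \<infinity>"

definition is_weight :: "real measure \<Rightarrow> (real \<Rightarrow> real) \<Rightarrow> bool" where
  "is_weight \<mu> \<omega> \<longleftrightarrow>
     (\<forall>K. compact K \<longrightarrow> set_integrable \<mu> K \<omega>) \<and> (AE x in \<mu>. \<omega> x > 0)"

definition weighted :: "real measure \<Rightarrow> (real \<Rightarrow> real) \<Rightarrow> real measure" where
  "weighted \<mu> \<omega> = density \<mu> (\<lambda>x. ennreal (\<omega> x))"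

definition conj_exp :: "real \<Rightarrow> real" where
  "conj_exp p = p / (p - 1)"

definition dual_weight :: "real \<Rightarrow> (real \<Rightarrow> real) \<Rightarrow> real \<Rightarrow> real" where
  "dual_weight p \<omega> = (\<lambda>x. \<omega> x powr (1 - conj_exp p))"

section \<open>Haar shifts\<close>

definition haar :: "real measure \<Rightarrow> real set \<Rightarrow> real \<Rightarrow> real" where
  "haar \<mu> I x =
     (if measure \<mu> (left_half I) = 0 \<or> measure \<mu> (right_half I) = 0 then 0
      else sqrt (m_meas \<mu> I) *
        (indicator (left_half I) x / measure \<mu> (left_half I)
          - indicator (right_half I) x / measure \<mu> (right_half I)))"

definition dyadic_descendants :: "real set set \<Rightarrow> nat \<Rightarrow> real set \<Rightarrow> real set set" where
  "dyadic_descendants D s I = {J \<in> D. J \<subseteq> I \<and> dyadic_ancestor D s J = I}"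

definition haar_block ::
  "real measure \<Rightarrow> real set set \<Rightarrow> nat \<Rightarrow> nat \<Rightarrow> (real set \<Rightarrow> real set \<Rightarrow> real set \<Rightarrow> complex) \<Rightarrow>
    (real \<Rightarrow> complex) \<Rightarrow> real set \<Rightarrow> real \<Rightarrow> complex" where
  "haar_block \<mu> D s t \<alpha> f I x =
     (\<Sum>J\<in>dyadic_descendants D s I. \<Sum>K\<in>dyadic_descendants D t I.
        \<alpha> I J K * (\<integral>y. f y * of_real (haar \<mu> J y) \<partial>\<mu>) * of_real (haar \<mu> K x))"

text \<open>\<open>T\<close> is given on \<open>L\<^sup>2(\<mu>)\<close> by the series over \<open>I \<in> D\<close>, which converges
  unconditionally in \<open>L\<^sup>2(\<mu>)\<close>; this determines \<open>T f\<close> up to \<open>\<mu>\<close>-null sets. The values of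
  \<open>T\<close> outside \<open>L\<^sup>2(\<mu>)\<close> play no role.\<close>

definition haar_shift ::
  "real measure \<Rightarrow> real set set \<Rightarrow> nat \<Rightarrow> nat \<Rightarrow> (real set \<Rightarrow> real set \<Rightarrow> real set \<Rightarrow> complex) \<Rightarrow>
    ((real \<Rightarrow> complex) \<Rightarrow> real \<Rightarrow> complex) \<Rightarrow> bool" where
  "haar_shift \<mu> D s t \<alpha> T \<longleftrightarrow>
     (\<forall>f. in_Lp \<mu> 2 f \<longrightarrow> in_Lp \<mu> 2 (T f) \<and>
        ((\<lambda>F. Lp_norm \<mu> 2 (\<lambda>x. T f x - (\<Sum>I\<in>F. haar_block \<mu> D s t \<alpha> f I x))) \<longlongrightarrow> 0)
          (finite_subsets_at_top D))"

definition coeffs_bounded_by_1 ::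
  "real set set \<Rightarrow> nat \<Rightarrow> nat \<Rightarrow> (real set \<Rightarrow> real set \<Rightarrow> real set \<Rightarrow> complex) \<Rightarrow> bool" where
  "coeffs_bounded_by_1 D s t \<alpha> \<longleftrightarrow>
     (\<forall>I\<in>D. \<forall>J\<in>dyadic_descendants D s I. \<forall>K\<in>dyadic_descendants D t I. norm (\<alpha> I J K) \<le> 1)"

text \<open>The infimum is a minimum, and equals \<open>\<infinity>\<close> if there is no finite bound.\<close>

definition weighted_op_norm ::
  "real measure \<Rightarrow> real \<Rightarrow> (real \<Rightarrow> real) \<Rightarrow> ((real \<Rightarrow> complex) \<Rightarrow> real \<Rightarrow> complex) \<Rightarrow> ennreal" where
  "weighted_op_norm \<mu> p \<omega> T =
     Inf {c. \<forall>f. in_Lp (weighted \<mu> \<omega>) p f \<longrightarrow> bounded (range f) \<longrightarrow>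
                 (\<exists>K. compact K \<and> (\<forall>x. x \<notin> K \<longrightarrow> f x = 0)) \<longrightarrow>
                 Lp_norm (weighted \<mu> \<omega>) p (T f) \<le> c * Lp_norm (weighted \<mu> \<omega>) p f}"

section \<open>Weight characteristics\<close>

definition positive_intervals :: "real set set \<Rightarrow> real measure \<Rightarrow> real set set" where
  "positive_intervals D \<mu> = {I \<in> D. emeasure \<mu> I > 0}"

definition avg :: "real measure \<Rightarrow> real set \<Rightarrow> (real \<Rightarrow> real) \<Rightarrow> ennreal" where
  "avg \<mu> I f = (\<integral>\<^sup>+x\<in>I. ennreal (f x) \<partial>\<mu>) / emeasure \<mu> I"

text \<open>If the dual weight is not locally integrable, it has average \<open>\<infinity>\<close> over some
  \<open>I \<in> D\<close>, while the average of \<open>\<omega>\<close> over \<open>I\<close> is positive; hence the value is \<open>\<infinity>\<close>.\<close>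

definition Ap_char ::
  "real measure \<Rightarrow> real set set \<Rightarrow> nat \<Rightarrow> real \<Rightarrow> (real \<Rightarrow> real) \<Rightarrow> ennreal" where
  "Ap_char \<mu> D N p \<omega> =
     max (SUP I\<in>positive_intervals D \<mu>.
            avg \<mu> I \<omega> * epowr (avg \<mu> I (dual_weight p \<omega>)) (p - 1))
         (SUP (I, J)\<in>{(I, J). I \<in> positive_intervals D \<mu> \<and> J \<in> positive_intervals D \<mu> \<and>
                              I \<noteq> J \<and> dyadic_dist D I J \<le> N + 2}.
            ennreal (m_meas \<mu> I powr (p / 2) * m_meas \<mu> J powr (p / 2) /
                     (measure \<mu> J * measure \<mu> I powr (p - 1))) *
            avg \<mu> I \<omega> * epowr (avg \<mu> J (dual_weight p \<omega>)) (p - 1))"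

definition dyadic_maximal ::
  "real measure \<Rightarrow> real set set \<Rightarrow> (real \<Rightarrow> real) \<Rightarrow> real \<Rightarrow> ennreal" where
  "dyadic_maximal \<mu> D f x =
     (SUP Q\<in>positive_intervals D \<mu>. avg \<mu> Q (\<lambda>y. \<bar>f y\<bar>) * indicator Q x)"

definition Ainf_char :: "real measure \<Rightarrow> real set set \<Rightarrow> (real \<Rightarrow> real) \<Rightarrow> ennreal" where
  "Ainf_char \<mu> D v =
     (SUP Q\<in>positive_intervals D \<mu>.
        (\<integral>\<^sup>+x\<in>Q. dyadic_maximal \<mu> D (\<lambda>y. v y * indicator Q y) x \<partial>\<mu>) /
        (\<integral>\<^sup>+x\<in>Q. ennreal (v x) \<partial>\<mu>))"

end

theory Submission
  imports Defs "HOL-Library.Sublist"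
begin

text \<open>
A Haar shift is dominated by positive bilinear forms over packed families of intervals, and such forms
satisfy bounds with two weights. Everything happens on finite trees, except for a limit at the end.

\<^emph>\<open>Reduction to a tree.\<close> The series of the shift converges in \<open>L\<^sup>2\<close>, hence along a subsequence almost
everywhere, and by Fatou's lemma it is enough to bound its finite partial sums uniformly
(\<open>weighted_op_norm_le\<close>). The intervals of a partial sum lie below a common interval and are nodes of a
binary tree; the function, the weights and the test function enter only by their integrals over nodes.
In a balanced lattice \<open>m\<close> vanishes either everywhere, and then all Haar functions vanish, or nowhere.
Testing the image \<open>h\<close> of \<open>f\<close> against \<open>cnj h |h|\<^sup>p\<^sup>-\<^sup>2 \<omega>\<close> turns the norm bound into a bound for a bilinear
form (\<open>shift_on_tree\<close>).

\<^emph>\<open>Sparse domination.\<close> Select an interval when the average of \<open>|f|\<close> or of \<open>|g|\<close> exceeds four times the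
average over the last selected interval. The selected intervals are packed: those below any interval
have total measure at most four times its measure (\<open>stopping_carleson\<close>). Between selections the Haar
coefficients have square sum at most a constant times \<open>\<langle>|f|\<rangle>\<^sub>S\<^sup>2 \<mu>(S)\<close> (\<open>square_function\<close>), so that
Cauchy--Schwarz leads to \<open>\<Sum>\<^sub>S \<langle>|f|\<rangle>\<^sub>S \<langle>|g|\<rangle>\<^sub>S \<mu>(S)\<close>. It remains to treat coefficients near selected
intervals. As \<open>\<mu>\<close> need not be doubling, the averages there are not controlled by those over the
parents. But \<open>m\<close> is at most the measure of either half, and by balance it is almost constant over
boundedly many generations. If only one of the functions has a selected interval nearby, the factor
\<open>m\<close> turns its average into mass, and the masses add up (\<open>mass_leaving_stopping_tree\<close>). If both have,
one is left with \<open>m(w) \<langle>|f|\<rangle>\<^sub>I \<langle>|g|\<rangle>\<^sub>J\<close> for selected \<open>I\<close>, \<open>J\<close> near \<open>w\<close>. Going down from \<open>w\<close>, one either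
keeps a proportion of \<open>\<mu>(w)\<close> or arrives at measures comparable to \<open>m(w)\<close> (\<open>small_or_large\<close>). In the first
case \<open>w\<close> may be added to the family; so only pairs with measures comparable to \<open>m(w)\<close> interact
(\<open>haar_form_le\<close>). They have distance at most \<open>N + 2\<close>, because a coefficient looks at the children of its
interval.

\<^emph>\<open>The weights.\<close> For an interacting pair the mixed condition becomes \<open>\<langle>\<omega>\<rangle>\<^sub>J \<langle>\<sigma>\<rangle>\<^sub>I\<^sup>p\<^sup>-\<^sup>1 \<le> C A\<close>, as if the two
intervals were one. Write \<open>f = \<phi> \<sigma>\<close>, \<open>g = \<psi> \<omega>\<close> and compare with the principal intervals of \<open>\<phi>\<close> with
respect to \<open>\<sigma>\<close> and of \<open>\<psi>\<close> with respect to \<open>\<omega>\<close>. If the principal interval for \<open>J\<close> is closer to \<open>J\<close> than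
the common ancestor of the pair, Hoelder's inequality and the Carleson embedding suffice
(\<open>near_bound\<close>). Otherwise the principal intervals are nested, and a testing estimate on the smaller one
(\<open>testing\<close>) applies (\<open>far_bound\<close>). If the smaller one belongs to \<open>\<psi>\<close>, only the packing of \<open>\<sigma>\<close> enters,
otherwise only that of \<open>\<omega>\<close>. This gives \<open>A\<^sup>1\<^sup>/\<^sup>p (L\<^sup>1\<^sup>/\<^sup>p + L'\<^sup>1\<^sup>/\<^sup>q)\<close> with the constants \<open>L\<close>, \<open>L'\<close> with
which families packed for \<open>\<mu>\<close> are packed for \<open>\<sigma>\<close> and \<open>\<omega>\<close> (\<open>tree_bound\<close>).

\<^emph>\<open>The constants.\<close> By comparison with the maximal function, \<open>L\<close> and \<open>L'\<close> are at most multiples of the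
\<open>A\<^sub>\<infinity>\<close> characteristics (\<open>Ainf_packing\<close>); this is the first bound. They are also at most multiples of
\<open>A\<^sup>q\<^sup>-\<^sup>1\<close> and \<open>A\<close> (\<open>Ap_packing\<close>); this is the second.

Almost all estimates on the tree are instances of one induction, the Bellman function principle
\<open>bellman\<close>: a potential is guessed that loses at each node at least the summand to be estimated.
\<close>

section \<open>Sums over finite binary trees\<close>

text \<open>A node lists its left-right turns with the last turn first: the children of \<open>w\<close> are
  \<open>False # w\<close> and \<open>True # w\<close>, the ancestors of a node are its suffixes, and \<open>u @ w\<close> lies
  \<open>length u\<close> generations below \<open>w\<close>.\<close>

type_synonym node = "bool list"

definition tree_additive :: "(node \<Rightarrow> 'a::comm_monoid_add) \<Rightarrow> bool" where
  "tree_additive a \<longleftrightarrow> (\<forall>w. a w = a (False # w) + a (True # w))"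

lemma additiveD: "tree_additive a \<Longrightarrow> a (False # w) + a (True # w) = a w"
  unfolding tree_additive_def by (rule sym) blast

definition below :: "nat \<Rightarrow> node \<Rightarrow> node set" where
  "below n w = {v. length v \<le> n \<and> suffix w v}"

lemma finite_lists_le: "finite {v::node. length v \<le> n}"
  using finite_lists_length_le[of "UNIV::bool set" n] by simp

lemma finite_lists_eq: "finite {v::node. length v = n}"
  by (rule finite_subset[OF _ finite_lists_le[of n]]) auto

lemma card_lists_eq: "card {v::node. length v = n} = 2 ^ n"
  using card_lists_length_eq[of "UNIV::bool set" n] by (simp add: card_UNIV_bool)

lemma finite_below [simp]: "finite (below n w)"
  by (rule finite_subset[OF _ finite_lists_le[of n]]) (auto simp: below_def)

lemma below_Nil: "below n [] = {v. length v \<le> n}"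
  by (simp add: below_def)

text \<open>The recursion on which every sum over the descendants of a node rests.\<close>

lemma suffix_split:
  "suffix w v \<longleftrightarrow> v = w \<or> suffix (False # w) v \<or> suffix (True # w) v"
proof
  assume "suffix w v"
  then obtain u where v: "v = u @ w" by (auto simp: suffix_def)
  show "v = w \<or> suffix (False # w) v \<or> suffix (True # w) v"
  proof (cases u rule: rev_cases)
    case Nil then show ?thesis using v by simp
  next
    case (snoc u' b) then show ?thesis using v by (cases b) (auto simp: suffix_def)
  qed
next
  assume "v = w \<or> suffix (False # w) v \<or> suffix (True # w) v"
  then show "suffix w v" by (auto simp: suffix_def)
qed

lemma suffix_children_disjoint: "\<not> (suffix (False # w) v \<and> suffix (True # w) v)"
  by (auto simp: suffix_def)

lemma below_split:
  "length w \<le> n \<Longrightarrow> below n w = insert w (below n (False # w) \<union> below n (True # w))"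
  using suffix_split[of w] by (auto simp: below_def)

lemma below_empty: "n < length w \<Longrightarrow> below n w = {}"
  by (auto simp: below_def dest: suffix_length_le)

lemma below_suffix: "v \<in> below n w \<Longrightarrow> suffix w v"
  by (simp add: below_def)

definition tsum :: "nat \<Rightarrow> (node \<Rightarrow> 'a::comm_monoid_add) \<Rightarrow> node \<Rightarrow> 'a" where
  "tsum n \<phi> w = (\<Sum>v\<in>below n w. \<phi> v)"

lemma tsum_rec:
  assumes "length w \<le> n"
  shows "tsum n \<phi> w = \<phi> w + tsum n \<phi> (False # w) + tsum n \<phi> (True # w)"
proof -
  have d: "below n (False # w) \<inter> below n (True # w) = {}"
    using suffix_children_disjoint[of w] by (auto simp: below_def)
  have w: "w \<notin> below n (False # w) \<union> below n (True # w)"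
    by (auto simp: below_def dest: suffix_length_le)
  show ?thesis
    unfolding tsum_def below_split[OF assms] using w
    by (simp add: sum.union_disjoint[OF _ _ d] add.assoc)
qed

lemma tsum_empty: "n < length w \<Longrightarrow> tsum n \<phi> w = 0"
  by (simp add: tsum_def below_empty)

lemma tree_induct [case_names leaf node]:
  assumes leaf: "\<And>w. n < length w \<Longrightarrow> P w"
    and node: "\<And>w. length w \<le> n \<Longrightarrow> P (False # w) \<Longrightarrow> P (True # w) \<Longrightarrow> P w"
  shows "P w"
proof (induction "Suc n - length w" arbitrary: w)
  case 0 then show ?case using leaf by simp
next
  case (Suc k)
  then have "k = Suc n - length (False # w)" "k = Suc n - length (True # w)" "length w \<le> n"
    by auto
  then show ?case using Suc.hyps(1)[of "False # w"] Suc.hyps(1)[of "True # w"] node[of w] by blast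
qed

text \<open>The Bellman function principle: a potential that pays for the summand at each node out of
  its loss from parent to children bounds the whole sum.\<close>

lemma bellman:
  fixes \<phi> B :: "node \<Rightarrow> real"
  assumes leaf: "\<And>v. suffix w v \<Longrightarrow> n < length v \<Longrightarrow> 0 \<le> B v"
    and step: "\<And>v. suffix w v \<Longrightarrow> length v \<le> n \<Longrightarrow> \<phi> v + B (False # v) + B (True # v) \<le> B v"
  shows "tsum n \<phi> w \<le> B w"
proof -
  have "suffix w v \<Longrightarrow> tsum n \<phi> v \<le> B v" for v
  proof (induction v rule: tree_induct[of n])
    case (leaf v) then show ?case using assms(1) by (simp add: tsum_empty)
  next
    case (node v)
    then have "suffix w (False # v)" "suffix w (True # v)" by (auto simp: suffix_def)
    with node step[of v] show ?case by (simp add: tsum_rec)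
  qed
  then show ?thesis by simp
qed

lemma additive_suffix_mono:
  fixes a :: "node \<Rightarrow> real"
  assumes "tree_additive a" "\<And>w. 0 \<le> a w" "suffix w v"
  shows "a v \<le> a w"
proof -
  obtain u where v: "v = u @ w" using assms(3) by (auto simp: suffix_def)
  have "a (u @ w) \<le> a w"
  proof (induction u)
    case (Cons b u)
    have "a (b # u @ w) \<le> a (u @ w)"
      using additiveD[OF assms(1), of "u @ w"] assms(2)[of "False # u @ w"]
        assms(2)[of "True # u @ w"] by (cases b) auto
    with Cons show ?case by simp
  qed simp
  then show ?thesis using v by simp
qed

lemma lists_Suc_snoc:
  "{u::node. length u = Suc k} = (\<lambda>u. u @ [False]) ` {u. length u = k} \<union> (\<lambda>u. u @ [True]) ` {u. length u = k}"
  (is "?L = ?R")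
proof
  show "?L \<subseteq> ?R"
  proof
    fix u :: node assume u: "u \<in> ?L"
    then obtain v b where "u = v @ [b]" by (cases u rule: rev_cases) auto
    with u show "u \<in> ?R" by (cases b) auto
  qed
qed auto

lemma sum_level_Suc:
  "(\<Sum>u | length u = Suc k. \<phi> (u @ w)) =
    (\<Sum>u | length u = k. \<phi> (u @ False # w)) + (\<Sum>u::node | length u = k. \<phi> (u @ True # w))"
  for \<phi> :: "node \<Rightarrow> 'a::comm_monoid_add"
  unfolding lists_Suc_snoc
  by (subst sum.union_disjoint)
    (auto simp: finite_lists_eq sum.reindex inj_on_def)

lemma sum_level_additive:
  assumes "tree_additive a" shows "(\<Sum>u | length u = k. a (u @ w)) = a w"
proof (induction k arbitrary: w)
  case (Suc k) then show ?case by (simp add: sum_level_Suc additiveD[OF assms])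
qed simp

section \<open>Stopping times\<close>

text \<open>\<open>prin stop w\<close> is the last node on the path from the root to \<open>w\<close> at which the stopping rule
  fired; the rule may compare a node with the node where it last fired.\<close>

primrec prin :: "(node \<Rightarrow> node \<Rightarrow> bool) \<Rightarrow> node \<Rightarrow> node" where
  "prin stop [] = []"
| "prin stop (b # w) = (if stop (b # w) (prin stop w) then b # w else prin stop w)"

lemma prin_suffix: "suffix (prin stop w) w"
  by (induction w) (auto intro: suffix_ConsI)

lemma prin_length: "length (prin stop w) \<le> length w"
  using prin_suffix suffix_length_le by blast

lemma prin_idem [simp]: "prin stop (prin stop w) = prin stop w"
  by (induction w) auto

lemma prin_between:
  assumes "suffix v w" "suffix (prin stop w) v"
  shows "prin stop v = prin stop w"
  using assms
proof (induction w)
  case (Cons b w)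
  show ?case
  proof (cases "v = b # w")
    case False
    then have v: "suffix v w" using Cons.prems(1) by (auto simp: suffix_Cons)
    have "prin stop (b # w) \<noteq> b # w"
      using suffix_length_le[OF v] suffix_length_le[OF Cons.prems(2)] by (auto simp del: prin.simps)
    then have e: "prin stop (b # w) = prin stop w" by (simp split: if_splits)
    show ?thesis using Cons.IH[OF v] Cons.prems(2) unfolding e by simp
  qed simp
qed simp

lemma prin_between_length:
  assumes "suffix v w" "length (prin stop w) \<le> length v"
  shows "prin stop v = prin stop w"
proof (rule prin_between[OF assms(1)])
  show "suffix (prin stop w) v"
    by (rule suffix_length_suffix[OF prin_suffix assms(1) assms(2)])
qed

lemma prin_not_stop: "prin stop w \<noteq> w \<Longrightarrow> \<not> stop w (prin stop w)"
  by (cases w) (auto split: if_splits)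

lemma prin_child:
  "prin stop (b # w) = b # w \<longleftrightarrow> stop (b # w) (prin stop w)"
  using prin_length[of stop w] by (auto split: if_splits)

text \<open>Sums over the stopping nodes. The potential \<open>P v s\<close> may depend on the node \<open>s\<close> where the
  rule last fired; the value at a stopping node is paid by the change of \<open>s\<close>.\<close>

lemma sum_stopping_nodes:
  fixes P :: "node \<Rightarrow> node \<Rightarrow> real"
  assumes leaf: "\<And>v. 0 \<le> P v (prin stop v)"
    and val: "\<And>v. 0 \<le> val v"
    and add: "\<And>v s. P (False # v) s + P (True # v) s \<le> P v s"
    and stop: "\<And>b v. stop (b # v) (prin stop v) \<Longrightarrow>
      val (b # v) + P (b # v) (b # v) \<le> P (b # v) (prin stop v)"
  shows "tsum n (\<lambda>v. if prin stop v = v then val v else 0) w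
    \<le> (if prin stop w = w then val w + P w w else P w (prin stop w))"
proof -
  define B where "B v = (if prin stop v = v then val v + P v v else P v (prin stop v))" for v
  have child: "B (b # v) \<le> P (b # v) (prin stop v)" for b v
    using stop[of b v] prin_length[of stop v] by (auto simp: B_def)
  have "tsum n (\<lambda>v. if prin stop v = v then val v else 0) w \<le> B w"
  proof (rule bellman)
    fix v show "0 \<le> B v"
      using leaf[of v] val[of v] by (auto simp: B_def)
  next
    fix v
    have "B (False # v) + B (True # v) \<le> P v (prin stop v)"
      using child[of False v] child[of True v] add[of v "prin stop v"] by linarith
    then show "(if prin stop v = v then val v else 0) + B (False # v) + B (True # v) \<le> B v"
      by (auto simp: B_def)
  qed
  then show ?thesis by (simp add: B_def)
qed

text \<open>Nodes that share their last stopping node \<open>s\<close> form a tree below \<open>s\<close> that ends where the rule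
  fires again. Sums are estimated on each of these trees with the averages over \<open>s\<close> frozen.\<close>

lemma sum_group_prin:
  fixes \<phi> :: "node \<Rightarrow> real"
  assumes "\<And>s. length s \<le> n \<Longrightarrow> prin stop s = s \<Longrightarrow>
    tsum n (\<lambda>w. if prin stop w = s then \<phi> w else 0) s \<le> b s"
  shows "tsum n \<phi> [] \<le> tsum n (\<lambda>s. if prin stop s = s then b s else 0) []"
proof -
  let ?S = "{s \<in> below n []. prin stop s = s}"
  have im: "prin stop ` below n [] \<subseteq> ?S"
    using prin_length by (fastforce simp: below_Nil intro: order_trans)
  have "tsum n \<phi> [] = (\<Sum>s\<in>?S. \<Sum>w\<in>{w\<in>below n []. prin stop w = s}. \<phi> w)"
    unfolding tsum_def by (rule sum.group[symmetric]) (use im in auto)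
  also have "\<dots> \<le> (\<Sum>s\<in>?S. b s)"
  proof (rule sum_mono)
    fix s assume s: "s \<in> ?S"
    have "{w\<in>below n []. prin stop w = s} = {w\<in>below n s. prin stop w = s}"
      using prin_suffix by (auto simp: below_def)
    then have "(\<Sum>w\<in>{w\<in>below n []. prin stop w = s}. \<phi> w) =
        tsum n (\<lambda>w. if prin stop w = s then \<phi> w else 0) s"
      by (simp add: tsum_def sum.inter_filter)
    with s assms[of s] show "(\<Sum>w\<in>{w\<in>below n []. prin stop w = s}. \<phi> w) \<le> b s"
      by (simp add: below_Nil)
  qed
  also have "\<dots> = tsum n (\<lambda>s. if prin stop s = s then b s else 0) []"
    by (simp add: tsum_def sum.inter_filter)
  finally show ?thesis .
qed

section \<open>Balanced measures on a tree\<close>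

text \<open>The tree form of \<open>m_meas\<close>.\<close>

definition m_node :: "(node \<Rightarrow> real) \<Rightarrow> node \<Rightarrow> real" where
  "m_node \<mu> w = \<mu> (False # w) * \<mu> (True # w) / \<mu> w"

locale positive_tree =
  fixes \<mu> :: "node \<Rightarrow> real"
  assumes mu_add: "tree_additive \<mu>" and mu_pos: "0 < \<mu> w"
begin

lemma mu_nonneg [simp]: "0 \<le> \<mu> w" using mu_pos[of w] by simp
lemma mu_nz [simp]: "\<mu> w \<noteq> 0" using mu_pos[of w] by simp
lemma mu_split: "\<mu> (False # w) + \<mu> (True # w) = \<mu> w" by (rule additiveD[OF mu_add])
lemma mu_mono: "suffix w v \<Longrightarrow> \<mu> v \<le> \<mu> w" by (rule additive_suffix_mono[OF mu_add]) auto
lemma mu_child_le: "\<mu> (b # w) \<le> \<mu> w" by (rule mu_mono) (simp add: suffix_ConsI)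

lemma m_node_pos: "0 < m_node \<mu> w" by (simp add: m_node_def mu_pos)
lemma m_node_nonneg [simp]: "0 \<le> m_node \<mu> w" using m_node_pos[of w] by simp

lemma m_node_le_child: "m_node \<mu> w \<le> \<mu> (b # w)"
  using mu_child_le[of False w] mu_child_le[of True w] mu_pos[of w] mu_pos[of "False # w"] mu_pos[of "True # w"]
  by (cases b) (auto simp: m_node_def field_simps mult_left_mono)

text \<open>The other half then has at least half of the measure of \<open>w\<close>, so that \<open>m\<close> is comparable to the
  smaller half.\<close>

lemma small_child: "2 * \<mu> (b # w) \<le> \<mu> w \<Longrightarrow> \<mu> (b # w) \<le> 2 * m_node \<mu> w"
proof -
  assume h: "2 * \<mu> (b # w) \<le> \<mu> w"
  have "\<mu> w \<le> 2 * \<mu> ((\<not> b) # w)" using h mu_split[of w] by (cases b) auto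
  then have "\<mu> (b # w) * \<mu> w \<le> \<mu> (b # w) * (2 * \<mu> ((\<not> b) # w))"
    by (intro mult_left_mono) auto
  also have "\<dots> = 2 * m_node \<mu> w * \<mu> w" by (cases b) (auto simp: m_node_def)
  finally show ?thesis using mu_pos[of w] by simp
qed

end

locale balanced_tree = positive_tree +
  fixes \<beta> :: real
  assumes beta: "1 \<le> \<beta>"
    and bal1: "m_node \<mu> (b # w) \<le> \<beta> * m_node \<mu> w" and bal2: "m_node \<mu> w \<le> \<beta> * m_node \<mu> (b # w)"
begin

lemma beta_pow: "1 \<le> \<beta> ^ k" using beta by simp

lemma m_node_descendant:
  "m_node \<mu> (u @ w) \<le> \<beta> ^ length u * m_node \<mu> w" "m_node \<mu> w \<le> \<beta> ^ length u * m_node \<mu> (u @ w)"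
proof (induction u)
  case (Cons b u)
  { case 1
    have "m_node \<mu> (b # u @ w) \<le> \<beta> * m_node \<mu> (u @ w)" by (rule bal1)
    also have "\<dots> \<le> \<beta> * (\<beta> ^ length u * m_node \<mu> w)" using Cons beta by (intro mult_left_mono) auto
    finally show ?case by (simp add: mult.assoc) }
  { case 2
    have "m_node \<mu> w \<le> \<beta> ^ length u * m_node \<mu> (u @ w)" by (rule Cons)
    also have "\<dots> \<le> \<beta> ^ length u * (\<beta> * m_node \<mu> (b # u @ w))"
      using bal2 beta by (intro mult_left_mono) auto
    finally show ?case by (simp add: mult_ac) }
qed auto

lemma m_node_le_descendant: "u \<noteq> [] \<Longrightarrow> m_node \<mu> w \<le> \<beta> ^ length u * \<mu> (u @ w)"
proof (cases u)
  case (Cons b v)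
  have "m_node \<mu> w \<le> \<beta> ^ length v * m_node \<mu> (v @ w)" by (rule m_node_descendant)
  also have "\<dots> \<le> \<beta> ^ length u * \<mu> (u @ w)"
    using beta m_node_le_child[of "v @ w" b] Cons by (intro mult_mono power_increasing) auto
  finally show ?thesis .
qed simp

text \<open>On the way down from \<open>w\<close>, as long as one follows the larger half, one keeps a fixed
  proportion of the measure; the first smaller half has measure comparable to \<open>m\<close>.\<close>

lemma small_or_large:
  "\<mu> (u @ w) \<le> 2 * \<beta> ^ length u * m_node \<mu> w \<or> \<mu> w \<le> 2 ^ length u * \<mu> (u @ w)"
proof (induction u)
  case (Cons b u)
  let ?v = "u @ w"
  consider "\<mu> ?v \<le> 2 * \<beta> ^ length u * m_node \<mu> w" | "\<mu> w \<le> 2 ^ length u * \<mu> ?v" "\<mu> ?v \<le> 2 * \<mu> (b # ?v)"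
    | "2 * \<mu> (b # ?v) \<le> \<mu> ?v" using Cons by linarith
  then show ?case
  proof cases
    case 1
    have "\<mu> (b # ?v) \<le> \<mu> ?v" by (rule mu_child_le)
    also note 1
    also have "2 * \<beta> ^ length u * m_node \<mu> w \<le> 2 * \<beta> ^ length (b # u) * m_node \<mu> w"
      using beta by (intro mult_right_mono mult_left_mono power_increasing) auto
    finally show ?thesis by simp
  next
    case 2
    have "2 ^ length u * \<mu> ?v \<le> 2 ^ length u * (2 * \<mu> (b # ?v))" using 2 by (intro mult_left_mono) auto
    from order_trans[OF 2(1) this] show ?thesis by (simp add: mult_ac)
  next
    case 3
    have "\<mu> (b # ?v) \<le> 2 * m_node \<mu> ?v" by (rule small_child[OF 3])
    also have "\<dots> \<le> 2 * (\<beta> ^ length u * m_node \<mu> w)" using m_node_descendant(1)[of u w] by simp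
    also have "\<dots> \<le> 2 * \<beta> ^ length (b # u) * m_node \<mu> w"
    proof -
      have "\<beta> ^ length u \<le> \<beta> ^ length (b # u)" using beta by (intro power_increasing) auto
      then have "\<beta> ^ length u * m_node \<mu> w \<le> \<beta> ^ length (b # u) * m_node \<mu> w" by (rule mult_right_mono) simp
      then show ?thesis by linarith
    qed
    finally show ?thesis by simp
  qed
qed (use mu_pos[of w] in simp)

end

section \<open>Stopping at large averages\<close>

text \<open>The averages over \<open>w\<close> and \<open>s\<close> are compared without division, so that the rule does not fire
  where \<open>F\<close> vanishes. Both functions use one rule: the trees between stopping nodes must be common
  to them for Cauchy--Schwarz.\<close>

definition avg_stop ::
  "(node \<Rightarrow> real) \<Rightarrow> (node \<Rightarrow> real) \<Rightarrow> (node \<Rightarrow> real) \<Rightarrow> node \<Rightarrow> node \<Rightarrow> bool" where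
  "avg_stop \<mu> F G w s \<longleftrightarrow> 4 * F s * \<mu> w < F w * \<mu> s \<or> 4 * G s * \<mu> w < G w * \<mu> s"

lemma avg_stop_commute: "avg_stop \<mu> F G = avg_stop \<mu> G F"
  by (auto simp: avg_stop_def fun_eq_iff)

locale two_functions = positive_tree +
  fixes F G :: "node \<Rightarrow> real"
  assumes F_add: "tree_additive F" and F_nonneg [simp]: "0 \<le> F w"
    and G_add: "tree_additive G" and G_nonneg [simp]: "0 \<le> G w"
begin

abbreviation prn :: "node \<Rightarrow> node" where "prn \<equiv> prin (avg_stop \<mu> F G)"

text \<open>Relative to the stopping node \<open>s\<close>, \<open>share w s\<close> is the mean of the fractions of the masses of
  \<open>F\<close> and \<open>G\<close> that \<open>w\<close> carries, scaled by the measure of \<open>s\<close>. It is additive in \<open>w\<close>; where the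
  rule fires, one of the fractions is at least four times the fraction of the measure.\<close>

definition share :: "node \<Rightarrow> node \<Rightarrow> real" where
  "share w s = (F w * \<mu> s / F s + G w * \<mu> s / G s) / 2"

lemma F_mono: "suffix w v \<Longrightarrow> F v \<le> F w" by (rule additive_suffix_mono[OF F_add]) auto
lemma G_mono: "suffix w v \<Longrightarrow> G v \<le> G w" by (rule additive_suffix_mono[OF G_add]) auto

lemma prn_F: "F w * \<mu> (prn w) \<le> 4 * F (prn w) * \<mu> w"
proof (cases "prn w = w")
  case False
  from prin_not_stop[OF this] show ?thesis by (simp add: avg_stop_def not_less)
qed (simp add: mult_right_mono)

lemma prn_G: "G w * \<mu> (prn w) \<le> 4 * G (prn w) * \<mu> w"
proof (cases "prn w = w")
  case False
  from prin_not_stop[OF this] show ?thesis by (simp add: avg_stop_def not_less)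
qed (simp add: mult_right_mono)

lemma share_nonneg: "0 \<le> share w s"
  by (simp add: share_def)

lemma share_add: "share (False # w) s + share (True # w) s = share w s"
  unfolding share_def additiveD[OF F_add, of w, symmetric] additiveD[OF G_add, of w, symmetric]
  by (simp add: add_divide_distrib algebra_simps)

lemma share_self: "share w w \<le> \<mu> w"
  by (simp add: share_def field_simps)

lemma share_stop:
  assumes "suffix s w" "avg_stop \<mu> F G w s" shows "2 * \<mu> w \<le> share w s"
proof -
  have *: "4 * \<mu> w \<le> H w * \<mu> s / H s" if H: "4 * H s * \<mu> w < H w * \<mu> s" "H w \<le> H s" "0 \<le> H s" for H
  proof -
    have "H s \<noteq> 0"
    proof
      assume "H s = 0" then have "H w * \<mu> s > 0" "H w \<le> 0" using H by auto
      then show False using mu_pos[of s] by (simp add: zero_less_mult_iff)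
    qed
    then show ?thesis using H by (simp add: field_simps)
  qed
  have nn: "0 \<le> F w * \<mu> s / F s" "0 \<le> G w * \<mu> s / G s" by auto
  have half: "2 * a \<le> (x + y) / 2" "2 * a \<le> (y + x) / 2" if "4 * a \<le> x" "0 \<le> y" for a x y :: real
    using that by auto
  from assms(2) consider "4 * F s * \<mu> w < F w * \<mu> s" | "4 * G s * \<mu> w < G w * \<mu> s"
    by (auto simp: avg_stop_def)
  then show ?thesis
  proof cases
    case 1
    from *[of F, OF 1 F_mono[OF assms(1)] F_nonneg] show ?thesis
      unfolding share_def by (rule half(1)[OF _ nn(2)])
  next
    case 2
    from *[of G, OF 2 G_mono[OF assms(1)] G_nonneg] show ?thesis
      unfolding share_def by (rule half(2)[OF _ nn(1)])
  qed
qed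

text \<open>The potential \<open>share\<close> pays twice the measure of each node where the rule fires: once for the
  node itself and once for all that happens below it.\<close>

lemma stopping_carleson: "tsum n (\<lambda>v. if prn v = v then \<mu> v else 0) w \<le> 4 * \<mu> w"
proof -
  have "tsum n (\<lambda>v. if prn v = v then \<mu> v else 0) w
      \<le> (if prn w = w then \<mu> w + share w w else share w (prn w))"
  proof (rule sum_stopping_nodes)
    fix b v assume s: "avg_stop \<mu> F G (b # v) (prn v)"
    have "suffix (prn v) (b # v)" using prin_suffix by (rule suffix_ConsI)
    from share_stop[OF this s] share_self[of "b # v"]
    show "\<mu> (b # v) + share (b # v) (b # v) \<le> share (b # v) (prn v)" by simp
  qed (auto simp: share_nonneg share_add)
  also have "\<dots> \<le> 4 * \<mu> w"
  proof -
    have *: "H w * \<mu> s / H s \<le> 4 * \<mu> w" if "H w * \<mu> s \<le> 4 * H s * \<mu> w" "0 \<le> H s" for H s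
      using that by (cases "H s = 0") (auto simp: field_simps)
    have "share w (prn w) \<le> 4 * \<mu> w"
      using *[OF prn_F] *[OF prn_G] by (simp add: share_def)
    then show ?thesis using share_self[of w] mu_nonneg[of w] by (auto simp del: mu_nonneg)
  qed
  finally show ?thesis .
qed

end

section \<open>Haar coefficients\<close>

definition haar_coeff :: "(node \<Rightarrow> real) \<Rightarrow> (node \<Rightarrow> complex) \<Rightarrow> node \<Rightarrow> real" where
  "haar_coeff \<mu> f w = sqrt (m_node \<mu> w) *
     cmod (f (False # w) / of_real (\<mu> (False # w)) - f (True # w) / of_real (\<mu> (True # w)))"

text \<open>A Haar coefficient measures the gain of energy when an average is refined to the averages over the
  two halves.\<close>

lemma parallel_axis:
  fixes a b :: complex and m n :: real
  assumes "0 < m" "0 < n"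
  shows "m * n / (m + n) * (cmod (a / of_real m - b / of_real n))\<^sup>2
    = (cmod a)\<^sup>2 / m + (cmod b)\<^sup>2 / n - (cmod (a + b))\<^sup>2 / (m + n)"
proof -
  have *: "m * n / (m + n) * (x / m - y / n)\<^sup>2 = x\<^sup>2 / m + y\<^sup>2 / n - (x + y)\<^sup>2 / (m + n)" for x y :: real
  proof -
    have "m + n \<noteq> 0" "m \<noteq> 0" "n \<noteq> 0" using assms by auto
    then show ?thesis by (simp add: power2_eq_square divide_simps) (simp add: algebra_simps)
  qed
  have "(cmod (a / of_real m - b / of_real n))\<^sup>2 = (Re a / m - Re b / n)\<^sup>2 + (Im a / m - Im b / n)\<^sup>2"
    by (simp add: cmod_power2)
  then show ?thesis
    using *[of "Re a" "Re b"] *[of "Im a" "Im b"]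
    by (simp add: cmod_power2 distrib_left add_divide_distrib)
qed

text \<open>When the recursion abandons a half of mass \<open>z\<close>, at most \<open>2 * k * z\<close> of energy is lost, provided
  that the average over the whole is at most \<open>k\<close>. Only the mass of the abandoned half enters, not
  its possibly huge average.\<close>

lemma lost_energy:
  fixes x y z k m n :: real
  assumes "0 < m" "0 < n" "0 \<le> x" "0 \<le> y" "0 \<le> z" "x \<le> y + z" "x \<le> k * (m + n)" "0 \<le> k"
  shows "x\<^sup>2 / (m + n) \<le> 2 * k * z + y\<^sup>2 / n"
proof (cases "x \<le> z")
  case True
  have "x\<^sup>2 / (m + n) \<le> x * z / (m + n)" using True assms
    by (intro divide_right_mono) (auto simp: power2_eq_square mult_left_mono)
  also have "\<dots> = x / (m + n) * z" by simp
  also have "\<dots> \<le> k * z" using assms by (intro mult_right_mono) (auto simp: field_simps)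
  also have "\<dots> \<le> 2 * k * z + y\<^sup>2 / n" using assms by simp
  finally show ?thesis .
next
  case False
  have "x\<^sup>2 / (m + n) - 2 * k * z \<le> x\<^sup>2 / (m + n) - 2 * (x / (m + n)) * z"
    using assms by (intro diff_left_mono mult_right_mono mult_left_mono) (auto simp: field_simps)
  also have "\<dots> \<le> (x - z)\<^sup>2 / (m + n)"
    using assms by (simp add: power2_diff diff_divide_distrib add_divide_distrib)
  also have "\<dots> \<le> y\<^sup>2 / (m + n)"
    using assms False by (intro divide_right_mono power_mono) auto
  also have "\<dots> \<le> y\<^sup>2 / n" using assms by (intro divide_left_mono) auto
  finally show ?thesis by simp
qed

locale two_functions_haar = two_functions +
  fixes f :: "node \<Rightarrow> complex"
  assumes f_add: "tree_additive f" and f_le: "cmod (f w) \<le> F w"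
begin

abbreviation hc :: "node \<Rightarrow> real" where "hc \<equiv> haar_coeff \<mu> f"

text \<open>If a child of \<open>w\<close> is a stopping node, its average is not controlled by the last stopping node.
  The coefficient at \<open>w\<close> is then split: the part from stopping children is kept apart, and
  \<open>good_coeff\<close> contains a bound for what a child that does not stop may contribute.\<close>

definition stops_below :: "node \<Rightarrow> bool" where
  "stops_below w \<longleftrightarrow> (\<exists>b. prn (b # w) = b # w)"

definition good_coeff :: "node \<Rightarrow> real" where
  "good_coeff w = (if stops_below w then sqrt (m_node \<mu> w) * (4 * F (prn w) / \<mu> (prn w)) else hc w)"

lemma hc_nonneg: "0 \<le> hc w" by (simp add: haar_coeff_def)

lemma good_coeff_nonneg: "0 \<le> good_coeff w"
  by (simp add: good_coeff_def hc_nonneg)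

lemma hc_le: "hc w \<le> sqrt (m_node \<mu> w) * (F (False # w) / \<mu> (False # w) + F (True # w) / \<mu> (True # w))"
proof -
  have "cmod (f v / of_real (\<mu> v)) \<le> F v / \<mu> v" for v
    using f_le[of v] by (simp add: norm_divide divide_right_mono)
  then show ?thesis unfolding haar_coeff_def
    by (intro mult_left_mono order_trans[OF norm_triangle_ineq4] add_mono) auto
qed

lemma nonstop_avg:
  assumes "prn (b # w) \<noteq> b # w"
  shows "F (b # w) / \<mu> (b # w) \<le> 4 * F (prn w) / \<mu> (prn w)"
proof -
  have "prn (b # w) = prn w" using assms by (auto split: if_splits)
  with prn_F[of "b # w"] show ?thesis using mu_pos[of "prn w"] mu_pos[of "b # w"]
    by (simp add: field_simps)
qed

lemma hc_le_good_coeff: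
  "hc w \<le> good_coeff w + sqrt (m_node \<mu> w) *
    ((if prn (False # w) = False # w then F (False # w) / \<mu> (False # w) else 0) +
     (if prn (True # w) = True # w then F (True # w) / \<mu> (True # w) else 0))"
proof (cases "stops_below w")
  case True
  let ?k = "4 * F (prn w) / \<mu> (prn w)"
  have k: "0 \<le> ?k" by simp
  have "F (False # w) / \<mu> (False # w) + F (True # w) / \<mu> (True # w) \<le> ?k +
    ((if prn (False # w) = False # w then F (False # w) / \<mu> (False # w) else 0) +
     (if prn (True # w) = True # w then F (True # w) / \<mu> (True # w) else 0))"
  proof -
    have "\<exists>b. prn (b # w) = b # w" using True by (simp add: stops_below_def)
    then have "prn (False # w) = False # w \<or> prn (True # w) = True # w" by (metis (full_types))
    moreover have "0 \<le> F (False # w) / \<mu> (False # w)" "0 \<le> F (True # w) / \<mu> (True # w)" by auto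
    ultimately show ?thesis using nonstop_avg[of False w] nonstop_avg[of True w] k
      by (cases "prn (False # w) = False # w"; cases "prn (True # w) = True # w")
        (simp_all del: prin.simps)
  qed
  then have "sqrt (m_node \<mu> w) * (F (False # w) / \<mu> (False # w) + F (True # w) / \<mu> (True # w))
    \<le> sqrt (m_node \<mu> w) * (?k +
    ((if prn (False # w) = False # w then F (False # w) / \<mu> (False # w) else 0) +
     (if prn (True # w) = True # w then F (True # w) / \<mu> (True # w) else 0)))"
    by (rule mult_left_mono) simp
  then show ?thesis using True order_trans[OF hc_le] by (simp add: good_coeff_def distrib_left)
next
  case False
  then show ?thesis by (simp add: good_coeff_def)
qed

lemma good_coeff_le: "good_coeff w \<le> 8 * sqrt (m_node \<mu> w) * (F (prn w) / \<mu> (prn w))"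
proof (cases "stops_below w")
  case True
  have "4 * (sqrt (m_node \<mu> w) * (F (prn w) / \<mu> (prn w))) \<le> 8 * (sqrt (m_node \<mu> w) * (F (prn w) / \<mu> (prn w)))"
    by (rule mult_right_mono) auto
  with True show ?thesis by (simp add: good_coeff_def mult_ac)
next
  case False
  then have "F (b # w) / \<mu> (b # w) \<le> 4 * F (prn w) / \<mu> (prn w)" for b
    using nonstop_avg by (simp add: stops_below_def del: prin.simps)
  from add_mono[OF this[of False] this[of True]]
  have "sqrt (m_node \<mu> w) * (F (False # w) / \<mu> (False # w) + F (True # w) / \<mu> (True # w))
      \<le> sqrt (m_node \<mu> w) * (8 * (F (prn w) / \<mu> (prn w)))"
    by (intro mult_left_mono) auto
  with False show ?thesis using order_trans[OF hc_le, of w] by (simp add: good_coeff_def mult_ac)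
qed

lemma energy_split:
  "(hc w)\<^sup>2 = (cmod (f (False # w)))\<^sup>2 / \<mu> (False # w) + (cmod (f (True # w)))\<^sup>2 / \<mu> (True # w)
    - (cmod (f w))\<^sup>2 / \<mu> w"
proof -
  have "(hc w)\<^sup>2 = \<mu> (False # w) * \<mu> (True # w) / (\<mu> (False # w) + \<mu> (True # w)) *
    (cmod (f (False # w) / of_real (\<mu> (False # w)) - f (True # w) / of_real (\<mu> (True # w))))\<^sup>2"
    using m_node_pos[of w] by (simp add: haar_coeff_def power_mult_distrib m_node_def mu_split)
  also have "\<dots> = (cmod (f (False # w)))\<^sup>2 / \<mu> (False # w) + (cmod (f (True # w)))\<^sup>2 / \<mu> (True # w)
    - (cmod (f (False # w) + f (True # w)))\<^sup>2 / (\<mu> (False # w) + \<mu> (True # w))"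
    by (rule parallel_axis) (auto simp: mu_pos)
  finally show ?thesis by (simp add: mu_split additiveD[OF f_add])
qed

text \<open>Below a stopping node \<open>s\<close> all averages are at most \<open>K = 4 F(s) / \<mu>(s)\<close> until the rule fires
  again, and the energy of the coefficients telescopes. The potential \<open>E\<close> is twice the \<open>L\<^sup>1\<close>
  bound \<open>K F\<close> for the energy minus the energy spent so far: it is nonnegative, additive up to the
  square of the coefficient, and by \<open>lost_energy\<close> it does not increase when a half is abandoned.
  The term \<open>K\<^sup>2 share\<close> pays for the nodes with a stopping child, where \<open>m\<close> is at most the
  measure of that child.\<close>

lemma square_function:
  assumes s: "prn s = s"
  shows "tsum n (\<lambda>w. if prn w = s then (good_coeff w)\<^sup>2 else 0) s \<le> 24 * (F s)\<^sup>2 / \<mu> s"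
proof -
  define K where "K = 4 * F s / \<mu> s"
  have K: "0 \<le> K" by (simp add: K_def)
  define q where "q w = (cmod (f w))\<^sup>2 / \<mu> w" for w
  define E where "E w = 2 * K * F w - q w" for w
  \<comment> \<open>The recursion stops where the rule fires: nodes with another last stopping node contribute nothing.\<close>
  define B where "B w = (if prn w = s then E w + K\<^sup>2 * share w s else 0)" for w
  have Fle: "F w \<le> K * \<mu> w" if "prn w = s" for w
    using prn_F[of w] that mu_pos[of s] by (simp add: K_def field_simps)
  have q_le: "q w \<le> K * F w" if "prn w = s" for w
  proof -
    have "q w \<le> F w * F w / \<mu> w" unfolding q_def power2_eq_square
      using f_le[of w] by (intro divide_right_mono mult_mono) auto
    also have "\<dots> \<le> F w * (K * \<mu> w) / \<mu> w"
      using Fle[OF that] by (intro divide_right_mono mult_left_mono) auto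
    finally show ?thesis by (simp add: mult.commute)
  qed
  have E_nonneg: "0 \<le> E w" if "prn w = s" for w
    using q_le[OF that] mult_nonneg_nonneg[OF K F_nonneg[of w]] by (simp add: E_def)
  have E_drop: "E (b # w) \<le> E w" if w: "prn w = s" for b w
  proof -
    let ?c = "(\<not> b) # w"
    have Fs: "F (b # w) + F ?c = F w" using additiveD[OF F_add, of w] by (cases b) auto
    have fs: "f ?c + f (b # w) = f w" using additiveD[OF f_add, of w] by (cases b) (auto simp: add.commute)
    have ms: "\<mu> ?c + \<mu> (b # w) = \<mu> w" using mu_split[of w] by (cases b) auto
    have "(cmod (f w))\<^sup>2 / (\<mu> ?c + \<mu> (b # w)) \<le> 2 * K * F ?c + (cmod (f (b # w)))\<^sup>2 / \<mu> (b # w)"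
    proof (rule lost_energy)
      show "cmod (f w) \<le> cmod (f (b # w)) + F ?c"
        using norm_triangle_ineq[of "f ?c" "f (b # w)"] f_le[of ?c] unfolding fs by simp
      show "cmod (f w) \<le> K * (\<mu> ?c + \<mu> (b # w))"
        using Fle[OF w] f_le[of w] unfolding ms by simp
    qed (auto simp: mu_pos K)
    then show ?thesis unfolding E_def q_def ms Fs[symmetric] by (simp add: algebra_simps)
  qed
  have "tsum n (\<lambda>w. if prn w = s then (good_coeff w)\<^sup>2 else 0) s \<le> B s"
  proof (rule bellman)
    fix v show "0 \<le> B v" using E_nonneg[of v] share_nonneg[of v s] by (simp add: B_def)
  next
    fix v assume v: "suffix s v"
    show "(if prn v = s then (good_coeff v)\<^sup>2 else 0) + B (False # v) + B (True # v) \<le> B v"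
    proof (cases "prn v = s")
      case False
      have "prn (b # v) \<noteq> s" for b
        using prin_between[of v "b # v" "avg_stop \<mu> F G"] v False by (metis suffix_ConsI suffix_order.refl)
      then show ?thesis using False by (simp add: B_def del: prin.simps)
    next
      case True
      have nonstop: "prn (b # v) = s" if "prn (b # v) \<noteq> b # v" for b
        using that True by (auto split: if_splits)
      have stop: "prn (b # v) \<noteq> s" if "prn (b # v) = b # v" for b
        using that suffix_length_le[OF v] by (metis Suc_n_not_le_n length_Cons)
      have Bv: "B v = E v + K\<^sup>2 * share v s" using True by (simp add: B_def)
      show ?thesis
      proof (cases "stops_below v")
        case False
        then have c: "prn (b # v) = s" for b using nonstop by (auto simp: stops_below_def)
        have "(good_coeff v)\<^sup>2 = q (False # v) + q (True # v) - q v"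
          using False energy_split[of v] by (simp add: good_coeff_def q_def)
        then show ?thesis unfolding Bv using True c
          by (simp add: B_def E_def share_add[of v s, symmetric] additiveD[OF F_add, of v, symmetric]
              algebra_simps del: prin.simps)
      next
        case sb: True
        have gc: "(good_coeff v)\<^sup>2 = m_node \<mu> v * K\<^sup>2"
          using sb m_node_pos[of v] True by (simp add: good_coeff_def K_def power_mult_distrib power_divide)
        \<comment> \<open>The child \<open>b # v\<close> stops; its share of the potential pays for the coefficient at \<open>v\<close>, whatever the other child does.\<close>
        obtain b where b: "prn (b # v) = b # v" using sb by (auto simp: stops_below_def)
        let ?c = "(\<not> b) # v"
        have Bb: "B (b # v) = 0" using stop[OF b] by (simp add: B_def del: prin.simps)
        have Bc: "B ?c \<le> E v + K\<^sup>2 * share ?c s"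
        proof (cases "prn ?c = s")
          case c: True then show ?thesis using E_drop[OF True, of "\<not> b"] by (simp add: B_def del: prin.simps)
        next
          case False then show ?thesis using E_nonneg[OF True] share_nonneg[of ?c s]
            by (simp add: B_def del: prin.simps)
        qed
        have "avg_stop \<mu> F G (b # v) s" using b True prin_child[of "avg_stop \<mu> F G" b v] by simp
        then have "2 * \<mu> (b # v) \<le> share (b # v) s" using v by (intro share_stop suffix_ConsI)
        then have "m_node \<mu> v \<le> share (b # v) s" using m_node_le_child[of v b] mu_pos[of "b # v"] by linarith
        then have "K\<^sup>2 * m_node \<mu> v \<le> K\<^sup>2 * share (b # v) s" by (intro mult_left_mono) auto
        moreover have "share (b # v) s + share ?c s = share v s"
          using share_add[of v s] by (cases b) auto
        then have "K\<^sup>2 * share (b # v) s + K\<^sup>2 * share ?c s = K\<^sup>2 * share v s"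
          by (simp add: distrib_left[symmetric])
        ultimately have "m_node \<mu> v * K\<^sup>2 + (B (b # v) + B ?c) \<le> E v + K\<^sup>2 * share v s"
          using Bb Bc by (simp add: mult.commute)
        moreover have "B (b # v) + B ?c = B (False # v) + B (True # v)" by (cases b) auto
        ultimately show ?thesis unfolding Bv gc using True by simp
      qed
    qed
  qed
  also have "B s \<le> 2 * K * F s + K\<^sup>2 * \<mu> s"
  proof -
    have "0 \<le> q s" by (simp add: q_def)
    then show ?thesis using s mult_left_mono[OF share_self[of s], of "K\<^sup>2"]
      by (simp add: B_def E_def)
  qed
  also have "\<dots> = 24 * (F s)\<^sup>2 / \<mu> s"
    by (simp add: K_def power2_eq_square field_simps)
  finally show ?thesis .
qed

end

lemma sum_shift_le:
  fixes \<phi> :: "node \<Rightarrow> real"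
  assumes "\<And>v. 0 \<le> \<phi> v"
  shows "(\<Sum>w\<in>below n s. \<Sum>u | length u = k. \<phi> (u @ w)) \<le> (\<Sum>v\<in>below (n + k) s. \<phi> v)"
proof -
  let ?U = "{u::node. length u = k}"
  have "(\<Sum>w\<in>below n s. \<Sum>u\<in>?U. \<phi> (u @ w)) = (\<Sum>(w, u)\<in>below n s \<times> ?U. \<phi> (u @ w))"
    by (rule sum.cartesian_product)
  also have "\<dots> = sum \<phi> ((\<lambda>(w, u). u @ w) ` (below n s \<times> ?U))"
    by (subst sum.reindex) (auto simp: inj_on_def case_prod_beta o_def)
  also have "\<dots> \<le> (\<Sum>v\<in>below (n + k) s. \<phi> v)"
    by (rule sum_mono2) (use assms in \<open>auto simp: below_def suffix_def intro: finite_subset[OF _ finite_lists_le]\<close>)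
  finally show ?thesis .
qed

locale haar_sums = balanced_tree + two_functions_haar
begin

text \<open>A coefficient \<open>k\<close> generations below \<open>w\<close> looks at averages \<open>k + 1\<close> generations below. Therefore
  \<open>stop_sum k w\<close> collects the averages over the stopping nodes in the generations \<open>1\<close> to \<open>k + 1\<close>, and
  \<open>level_sum k w\<close> the coefficients that no stopping node separates from \<open>w\<close>.\<close>

definition stop_sum :: "nat \<Rightarrow> node \<Rightarrow> real" where
  "stop_sum k w = (\<Sum>j\<in>{1..Suc k}. \<Sum>u | length u = j.
     if prn (u @ w) = u @ w then F (u @ w) / \<mu> (u @ w) else 0)"

definition level_sum :: "nat \<Rightarrow> node \<Rightarrow> real" where
  "level_sum k w = (\<Sum>u | length u = k. if prn (u @ w) = prn w then good_coeff (u @ w) else 0)"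

lemma stop_sum_nonneg: "0 \<le> stop_sum k w"
  unfolding stop_sum_def by (intro sum_nonneg) auto

lemma level_sum_nonneg: "0 \<le> level_sum k w"
  unfolding level_sum_def by (intro sum_nonneg) (auto simp: good_coeff_nonneg)

lemma stop_sum_subset:
  assumes "U \<subseteq> {u. length u = j}" "1 \<le> j" "j \<le> Suc k"
  shows "(\<Sum>u\<in>U. if prn (u @ w) = u @ w then F (u @ w) / \<mu> (u @ w) else 0) \<le> stop_sum k w"
proof -
  have "(\<Sum>u\<in>U. if prn (u @ w) = u @ w then F (u @ w) / \<mu> (u @ w) else 0)
      \<le> (\<Sum>u | length u = j. if prn (u @ w) = u @ w then F (u @ w) / \<mu> (u @ w) else 0)"
    by (rule sum_mono2) (use assms in \<open>auto simp: finite_lists_eq\<close>)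
  also have "\<dots> \<le> stop_sum k w" unfolding stop_sum_def
    by (rule member_le_sum) (use assms in \<open>auto intro!: sum_nonneg\<close>)
  finally show ?thesis .
qed

lemma sqrt_m_node_descendant:
  assumes "length u = k" shows "sqrt (m_node \<mu> (u @ w)) \<le> \<beta> ^ k * sqrt (m_node \<mu> w)"
proof -
  have "m_node \<mu> (u @ w) \<le> \<beta> ^ k * m_node \<mu> w" using m_node_descendant(1)[of u w] assms by simp
  also have "\<dots> \<le> (\<beta> ^ k)\<^sup>2 * m_node \<mu> w"
    using beta_pow[of k] by (intro mult_right_mono) (auto intro!: self_le_power)
  finally have "sqrt (m_node \<mu> (u @ w)) \<le> sqrt ((\<beta> ^ k)\<^sup>2 * m_node \<mu> w)" by simp
  then show ?thesis using beta by (simp add: real_sqrt_mult)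
qed

text \<open>If the last stopping node above \<open>u @ w\<close> is not that of \<open>w\<close>, it lies strictly below \<open>w\<close> and
  its average occurs in \<open>stop_sum\<close>.\<close>

lemma haar_coeff_level:
  assumes u: "length u = k"
  shows "hc (u @ w) \<le> (if prn (u @ w) = prn w then good_coeff (u @ w) else 0)
    + 9 * \<beta> ^ k * sqrt (m_node \<mu> w) * stop_sum k w"
proof -
  let ?v = "u @ w"
  have sm: "sqrt (m_node \<mu> ?v) \<le> \<beta> ^ k * sqrt (m_node \<mu> w)" by (rule sqrt_m_node_descendant[OF u])
  have "(if prn (False # ?v) = False # ?v then F (False # ?v) / \<mu> (False # ?v) else 0) +
     (if prn (True # ?v) = True # ?v then F (True # ?v) / \<mu> (True # ?v) else 0) \<le> stop_sum k w"
    using stop_sum_subset[of "{False # u, True # u}" "Suc k" k w] u by (simp del: prin.simps cong: if_cong)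
  then have "sqrt (m_node \<mu> ?v) * ((if prn (False # ?v) = False # ?v then F (False # ?v) / \<mu> (False # ?v) else 0) +
     (if prn (True # ?v) = True # ?v then F (True # ?v) / \<mu> (True # ?v) else 0)) \<le> sqrt (m_node \<mu> ?v) * stop_sum k w"
    by (rule mult_left_mono) simp
  then have 1: "hc ?v \<le> good_coeff ?v + sqrt (m_node \<mu> ?v) * stop_sum k w"
    using hc_le_good_coeff[of ?v] by linarith
  have 2: "good_coeff ?v \<le> 8 * sqrt (m_node \<mu> ?v) * stop_sum k w" if ne: "prn ?v \<noteq> prn w"
  proof -
    have lw: "length w < length (prn ?v)"
    proof (rule ccontr)
      assume "\<not> ?thesis"
      then have "prn w = prn ?v" by (intro prin_between_length) (auto simp: suffix_def)
      with ne show False by simp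
    qed
    have "suffix w (prn ?v)"
      by (rule suffix_length_suffix[OF _ prin_suffix]) (use lw in \<open>auto simp: suffix_def\<close>)
    then obtain u' where u': "prn ?v = u' @ w" by (auto simp: suffix_def)
    have len: "1 \<le> length u'" "length u' \<le> Suc k"
      using lw prin_length[of "avg_stop \<mu> F G" ?v] u u' by (auto simp: Suc_le_eq)
    have "prn (u' @ w) = u' @ w" using prin_idem[of "avg_stop \<mu> F G" ?v] unfolding u' .
    then have "F (u' @ w) / \<mu> (u' @ w) \<le> stop_sum k w"
      using stop_sum_subset[of "{u'}" "length u'" k w] len by simp
    then have "8 * sqrt (m_node \<mu> ?v) * (F (prn ?v) / \<mu> (prn ?v)) \<le> 8 * sqrt (m_node \<mu> ?v) * stop_sum k w"
      unfolding u' by (intro mult_left_mono) auto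
    with good_coeff_le[of ?v] show ?thesis by linarith
  qed
  have 3: "sqrt (m_node \<mu> ?v) * stop_sum k w \<le> \<beta> ^ k * sqrt (m_node \<mu> w) * stop_sum k w"
    by (rule mult_right_mono[OF sm stop_sum_nonneg])
  have "0 \<le> sqrt (m_node \<mu> ?v) * stop_sum k w" using stop_sum_nonneg by simp
  moreover have "9 * \<beta> ^ k * sqrt (m_node \<mu> w) * stop_sum k w = 9 * (\<beta> ^ k * sqrt (m_node \<mu> w) * stop_sum k w)"
    "8 * sqrt (m_node \<mu> ?v) * stop_sum k w = 8 * (sqrt (m_node \<mu> ?v) * stop_sum k w)" by simp_all
  ultimately show ?thesis
  proof (cases "prn ?v = prn w")
    case True
    show ?thesis unfolding if_P[OF True]
      using 1 3 \<open>0 \<le> sqrt (m_node \<mu> ?v) * stop_sum k w\<close> \<open>9 * \<beta> ^ k * _ * _ = _\<close> by linarith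
  next
    case False
    show ?thesis unfolding if_not_P[OF False]
      using 1 2[OF False] 3 \<open>9 * \<beta> ^ k * _ * _ = _\<close> \<open>8 * _ * _ = _\<close> by linarith
  qed
qed

lemma haar_coeff_level_sum:
  "(\<Sum>u | length u = k. hc (u @ w)) \<le> level_sum k w + 9 * 2 ^ k * \<beta> ^ k * sqrt (m_node \<mu> w) * stop_sum k w"
proof -
  have "(\<Sum>u | length u = k. hc (u @ w)) \<le> (\<Sum>u | length u = k.
    (if prn (u @ w) = prn w then good_coeff (u @ w) else 0) + 9 * \<beta> ^ k * sqrt (m_node \<mu> w) * stop_sum k w)"
    by (rule sum_mono) (use haar_coeff_level in auto)
  also have "\<dots> = level_sum k w + 9 * 2 ^ k * \<beta> ^ k * sqrt (m_node \<mu> w) * stop_sum k w"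
    by (simp add: sum.distrib level_sum_def card_lists_eq)
  finally show ?thesis .
qed

lemma level_sum_square:
  assumes s: "prn s = s"
  shows "(\<Sum>w\<in>below n s. if prn w = s then (level_sum k w)\<^sup>2 else 0) \<le> 2 ^ k * (24 * (F s)\<^sup>2 / \<mu> s)"
proof -
  let ?g = "\<lambda>v. if prn v = s then (good_coeff v)\<^sup>2 else 0"
  have "(if prn w = s then (level_sum k w)\<^sup>2 else 0) \<le> 2 ^ k * (\<Sum>u | length u = k. ?g (u @ w))" for w
  proof (cases "prn w = s")
    case True
    have "(level_sum k w)\<^sup>2 \<le> (\<Sum>u | length u = k. (if prn (u @ w) = prn w then good_coeff (u @ w) else 0)\<^sup>2) * card {u::node. length u = k}"
      unfolding level_sum_def by (rule sum_squared_le_sum_of_squares)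
    also have "\<dots> = 2 ^ k * (\<Sum>u | length u = k. ?g (u @ w))"
      using True by (simp add: card_lists_eq mult.commute if_distrib[of "\<lambda>x. x\<^sup>2"] cong: if_cong)
    finally show ?thesis using True by simp
  next
    case False
    have "0 \<le> 2 ^ k * (\<Sum>u | length u = k. ?g (u @ w))" by (intro mult_nonneg_nonneg sum_nonneg) auto
    with False show ?thesis by simp
  qed
  then have "(\<Sum>w\<in>below n s. if prn w = s then (level_sum k w)\<^sup>2 else 0)
      \<le> (\<Sum>w\<in>below n s. 2 ^ k * (\<Sum>u | length u = k. ?g (u @ w)))" by (rule sum_mono)
  also have "\<dots> \<le> 2 ^ k * (\<Sum>v\<in>below (n + k) s. ?g v)"
    unfolding sum_distrib_left[symmetric]
    by (rule mult_left_mono[OF sum_shift_le]) auto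
  also have "\<dots> \<le> 2 ^ k * (24 * (F s)\<^sup>2 / \<mu> s)"
    using square_function[OF s, of "n + k"] by (intro mult_left_mono) (auto simp: tsum_def)
  finally show ?thesis .
qed

lemma level_sum_le:
  "level_sum k w \<le> 8 * 2 ^ k * \<beta> ^ k * sqrt (m_node \<mu> w) * (F (prn w) / \<mu> (prn w))"
proof -
  have "level_sum k w \<le> (\<Sum>u::node | length u = k. 8 * \<beta> ^ k * sqrt (m_node \<mu> w) * (F (prn w) / \<mu> (prn w)))"
    unfolding level_sum_def
  proof (rule sum_mono)
    fix u :: node assume "u \<in> {u. length u = k}"
    then have u: "length u = k" by simp
    have "good_coeff (u @ w) \<le> 8 * (\<beta> ^ k * sqrt (m_node \<mu> w)) * (F (prn w) / \<mu> (prn w))" if "prn (u @ w) = prn w"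
      using good_coeff_le[of "u @ w"] that beta
      by (intro order_trans[OF good_coeff_le] mult_mono) (auto intro!: sqrt_m_node_descendant u)
    moreover have "0 \<le> 8 * (\<beta> ^ k * sqrt (m_node \<mu> w)) * (F (prn w) / \<mu> (prn w))" using beta by simp
    ultimately show "(if prn (u @ w) = prn w then good_coeff (u @ w) else 0)
      \<le> 8 * \<beta> ^ k * sqrt (m_node \<mu> w) * (F (prn w) / \<mu> (prn w))" by (simp add: mult.assoc)
  qed
  also have "\<dots> = 8 * 2 ^ k * \<beta> ^ k * sqrt (m_node \<mu> w) * (F (prn w) / \<mu> (prn w))"
    by (simp add: card_lists_eq)
  finally show ?thesis .
qed

text \<open>Let \<open>t i v\<close> be the mass, \<open>i\<close> generations below \<open>v\<close>, of the nodes that still have the last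
  stopping node \<open>s\<close>. The mass that leaves within \<open>j\<close> generations is \<open>t 0 v - t j v\<close>, and this
  telescopes along generations.\<close>

lemma mass_leaving_stopping_tree:
  "(\<Sum>w\<in>below n s. if prn w = s then
      (\<Sum>u | length u = j. if prn (u @ w) \<noteq> s then F (u @ w) else 0) else 0) \<le> real j * F s"
proof -
  define t where "t i v = (\<Sum>u | length u = i. if prn (u @ v) = s then F (u @ v) else 0)" for i v
  define B where "B v = (\<Sum>i<j. t i v)" for v
  have t_nonneg: "0 \<le> t i v" for i v unfolding t_def by (intro sum_nonneg) auto
  have t_le: "t i v \<le> F v" for i v
    unfolding t_def sum_level_additive[OF F_add, where k = i and w = v, symmetric] by (intro sum_mono) auto
  have "tsum n (\<lambda>w. if prn w = s then
      (\<Sum>u | length u = j. if prn (u @ w) \<noteq> s then F (u @ w) else 0) else 0) s \<le> B s"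
  proof (rule bellman)
    fix v show "0 \<le> B v" unfolding B_def by (intro sum_nonneg t_nonneg)
  next
    fix v assume v: "suffix s v"
    have "t (Suc i) v = t i (False # v) + t i (True # v)" for i
      unfolding t_def by (rule sum_level_Suc)
    then have "B (False # v) + B (True # v) = (\<Sum>i<j. t (Suc i) v)"
      by (simp add: B_def sum.distrib)
    moreover have "B v - (\<Sum>i<j. t (Suc i) v) = t 0 v - t j v"
      unfolding B_def sum_subtractf[symmetric] by (rule sum_lessThan_telescope')
    ultimately have d: "B v = B (False # v) + B (True # v) + t 0 v - t j v" by linarith
    show "(if prn v = s then (\<Sum>u | length u = j. if prn (u @ v) \<noteq> s then F (u @ v) else 0) else 0)
      + B (False # v) + B (True # v) \<le> B v"
    proof (cases "prn v = s")
      case True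
      have "(\<Sum>u | length u = j. if prn (u @ v) \<noteq> s then F (u @ v) else 0) + t j v
        = (\<Sum>u | length u = j. F (u @ v))"
        unfolding t_def sum.distrib[symmetric] by (intro sum.cong) auto
      also have "\<dots> = t 0 v" using True by (simp add: sum_level_additive[OF F_add] t_def)
      finally show ?thesis using d True by simp
    next
      case False
      have "prn (u @ v) \<noteq> s" for u
        using prin_between[of v "u @ v" "avg_stop \<mu> F G"] v False by (auto simp: suffix_def)
      then have "t j v = 0" by (simp add: t_def)
      then show ?thesis using d False t_nonneg[of 0 v] by simp
    qed
  qed
  also have "B s \<le> real j * F s"
    unfolding B_def using sum_bounded_above[of "{..<j}" "\<lambda>i. t i s" "F s"] t_le by simp
  finally show ?thesis by (simp add: tsum_def)
qed

lemma stopping_mass_sum: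
  assumes \<psi>: "\<And>s. 0 \<le> \<psi> s"
  shows "(\<Sum>w\<in>below n []. \<psi> (prn w) * (\<Sum>j\<in>{1..Suc k}. \<Sum>u | length u = j. if prn (u @ w) = u @ w then F (u @ w) else 0))
    \<le> real ((Suc k)\<^sup>2) * (\<Sum>s\<in>below n []. if prn s = s then \<psi> s * F s else 0)"
proof -
  let ?I = "\<lambda>w j. \<Sum>u | length u = j. if prn (u @ w) = u @ w then F (u @ w) else 0"
  have "tsum n (\<lambda>w. \<psi> (prn w) * (\<Sum>j\<in>{1..Suc k}. ?I w j)) []
      \<le> tsum n (\<lambda>s. if prn s = s then real ((Suc k)\<^sup>2) * (\<psi> s * F s) else 0) []"
  proof (rule sum_group_prin)
    fix s assume s: "prn s = s"
    have "tsum n (\<lambda>w. if prn w = s then \<psi> (prn w) * (\<Sum>j\<in>{1..Suc k}. ?I w j) else 0) s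
      \<le> (\<Sum>w\<in>below n s. \<psi> s * (\<Sum>j\<in>{1..Suc k}. if prn w = s then
        (\<Sum>u | length u = j. if prn (u @ w) \<noteq> s then F (u @ w) else 0) else 0))"
      unfolding tsum_def
    proof (rule sum_mono)
      fix w assume w: "w \<in> below n s"
      have I: "?I w j \<le> (\<Sum>u | length u = j. if prn (u @ w) \<noteq> s then F (u @ w) else 0)" if "1 \<le> j" for j
      proof (rule sum_mono)
        fix u :: node assume u: "u \<in> {u. length u = j}"
        have "u @ w \<noteq> s" using u that suffix_length_le[OF below_suffix[OF w]] by auto
        then show "(if prn (u @ w) = u @ w then F (u @ w) else 0) \<le> (if prn (u @ w) \<noteq> s then F (u @ w) else 0)"
          by auto
      qed
      then show "(if prn w = s then \<psi> (prn w) * (\<Sum>j\<in>{1..Suc k}. ?I w j) else 0) \<le>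
        \<psi> s * (\<Sum>j\<in>{1..Suc k}. if prn w = s then
        (\<Sum>u | length u = j. if prn (u @ w) \<noteq> s then F (u @ w) else 0) else 0)"
      proof (cases "prn w = s")
        case True
        show ?thesis unfolding if_P[OF True] unfolding True
          by (intro mult_left_mono \<psi> sum_mono[OF I[unfolded True]]) auto
      qed simp
    qed
    also have "\<dots> = \<psi> s * (\<Sum>j\<in>{1..Suc k}. \<Sum>w\<in>below n s. if prn w = s then
        (\<Sum>u | length u = j. if prn (u @ w) \<noteq> s then F (u @ w) else 0) else 0)"
      unfolding sum_distrib_left[symmetric] by (subst sum.swap) simp
    also have "\<dots> \<le> \<psi> s * (\<Sum>j\<in>{1..Suc k}. real (Suc k) * F s)"
    proof (intro mult_left_mono sum_mono \<psi>)
      fix j assume "j \<in> {1..Suc k}"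
      then have "real j * F s \<le> real (Suc k) * F s" by (intro mult_right_mono) auto
      with mass_leaving_stopping_tree[of s j n]
      show "(\<Sum>w\<in>below n s. if prn w = s then
        (\<Sum>u | length u = j. if prn (u @ w) \<noteq> s then F (u @ w) else 0) else 0) \<le> real (Suc k) * F s"
        by linarith
    qed
    also have "\<dots> = real ((Suc k)\<^sup>2) * (\<psi> s * F s)" by (simp add: power2_eq_square algebra_simps)
    finally show "tsum n (\<lambda>w. if prn w = s then \<psi> (prn w) * (\<Sum>j\<in>{1..Suc k}. ?I w j) else 0) s
      \<le> real ((Suc k)\<^sup>2) * (\<psi> s * F s)" .
  qed
  moreover have "(\<Sum>s\<in>below n []. if prn s = s then real ((Suc k)\<^sup>2) * (\<psi> s * F s) else 0)
    = real ((Suc k)\<^sup>2) * (\<Sum>s\<in>below n []. if prn s = s then \<psi> s * F s else 0)"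
    by (subst sum_distrib_left) (intro sum.cong, auto)
  ultimately show ?thesis unfolding tsum_def by (simp only:)
qed

text \<open>The factor \<open>m\<close> turns averages over nearby nodes into masses, as it is at most a constant times
  the measure of every proper descendant that is a bounded number of generations below.\<close>

lemma m_node_stop_sum_le:
  "m_node \<mu> w * stop_sum k w \<le> \<beta> ^ Suc k *
    (\<Sum>j\<in>{1..Suc k}. \<Sum>u | length u = j. if prn (u @ w) = u @ w then F (u @ w) else 0)"
  unfolding stop_sum_def sum_distrib_left
proof (intro sum_mono)
  fix j and u :: node assume j: "j \<in> {1..Suc k}" and u: "u \<in> {u. length u = j}"
  have "m_node \<mu> w \<le> \<beta> ^ length u * \<mu> (u @ w)" using u j by (intro m_node_le_descendant) auto
  also have "\<dots> \<le> \<beta> ^ Suc k * \<mu> (u @ w)"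
    using u j beta by (intro mult_right_mono power_increasing) auto
  finally have "m_node \<mu> w * (F (u @ w) / \<mu> (u @ w)) \<le> \<beta> ^ Suc k * \<mu> (u @ w) * (F (u @ w) / \<mu> (u @ w))"
    by (rule mult_right_mono) simp
  then show "m_node \<mu> w * (if prn (u @ w) = u @ w then F (u @ w) / \<mu> (u @ w) else 0)
    \<le> \<beta> ^ Suc k * (if prn (u @ w) = u @ w then F (u @ w) else 0)" by simp
qed

text \<open>If only \<open>F\<close> has a stopping node nearby, the other factor is bounded by the average of \<open>G\<close> over
  the last stopping node above, and what remains is the mass of \<open>F\<close> that leaves the tree below that
  node.\<close>

lemma cross_terms:
  assumes b: "\<And>w. b w \<le> c * sqrt (m_node \<mu> w) * (G (prn w) / \<mu> (prn w))" and c: "0 \<le> c"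
  shows "(\<Sum>w\<in>below n []. b w * (sqrt (m_node \<mu> w) * stop_sum k w))
    \<le> c * \<beta> ^ Suc k * real ((Suc k)\<^sup>2) * (\<Sum>s\<in>below n []. if prn s = s then F s * G s / \<mu> s else 0)"
proof -
  let ?M = "\<lambda>w. \<Sum>j\<in>{1..Suc k}. \<Sum>u | length u = j. if prn (u @ w) = u @ w then F (u @ w) else 0"
  have "(\<Sum>w\<in>below n []. b w * (sqrt (m_node \<mu> w) * stop_sum k w))
    \<le> (\<Sum>w\<in>below n []. (c * \<beta> ^ Suc k) * ((G (prn w) / \<mu> (prn w)) * ?M w))"
  proof (rule sum_mono)
    fix w
    have "b w * (sqrt (m_node \<mu> w) * stop_sum k w)
      \<le> (c * sqrt (m_node \<mu> w) * (G (prn w) / \<mu> (prn w))) * (sqrt (m_node \<mu> w) * stop_sum k w)"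
      using stop_sum_nonneg by (intro mult_right_mono b) auto
    also have "\<dots> = (c * (G (prn w) / \<mu> (prn w))) * ((sqrt (m_node \<mu> w))\<^sup>2 * stop_sum k w)"
      by (simp add: power2_eq_square)
    also have "\<dots> = (c * (G (prn w) / \<mu> (prn w))) * (m_node \<mu> w * stop_sum k w)"
      by simp
    also have "\<dots> \<le> (c * (G (prn w) / \<mu> (prn w))) * (\<beta> ^ Suc k * ?M w)"
      using c by (intro mult_left_mono m_node_stop_sum_le) auto
    finally show "b w * (sqrt (m_node \<mu> w) * stop_sum k w)
      \<le> (c * \<beta> ^ Suc k) * ((G (prn w) / \<mu> (prn w)) * ?M w)" by (simp only: mult_ac)
  qed
  also have "\<dots> = (c * \<beta> ^ Suc k) * (\<Sum>w\<in>below n []. (G (prn w) / \<mu> (prn w)) * ?M w)"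
    by (simp only: sum_distrib_left)
  also have "\<dots> \<le> (c * \<beta> ^ Suc k) * (real ((Suc k)\<^sup>2) * (\<Sum>s\<in>below n []. if prn s = s then (G s / \<mu> s) * F s else 0))"
    using c beta by (intro mult_left_mono stopping_mass_sum) auto
  also have "(\<Sum>s\<in>below n []. if prn s = s then (G s / \<mu> s) * F s else 0)
    = (\<Sum>s\<in>below n []. if prn s = s then F s * G s / \<mu> s else 0)"
    by (intro sum.cong) (auto simp: mult.commute)
  finally show ?thesis by (simp only: mult.assoc)
qed

end

section \<open>Sparse domination\<close>

locale haar_form = haar_sums +
  fixes g :: "node \<Rightarrow> complex"
  assumes g_add: "tree_additive g" and g_le: "cmod (g w) \<le> G w"
begin

sublocale swap: haar_sums \<mu> \<beta> G F g
  rewrites "avg_stop \<mu> G F = avg_stop \<mu> F G"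
proof -
  show "haar_sums \<mu> \<beta> G F g"
    by unfold_locales (auto simp: F_add G_add g_add g_le)
qed (rule avg_stop_commute)

definition diag :: "nat \<Rightarrow> real" where
  "diag n = (\<Sum>s\<in>below n []. if prn s = s then F s * G s / \<mu> s else 0)"

text \<open>If neither coefficient is separated from \<open>w\<close> by a stopping node, Cauchy--Schwarz on the tree
  below each stopping node gives the product of the two averages times the measure.\<close>

lemma diag_terms:
  "(\<Sum>w\<in>below n []. level_sum k w * swap.level_sum l w) \<le> 24 * 2 ^ k * 2 ^ l * diag n"
proof -
  have "tsum n (\<lambda>w. level_sum k w * swap.level_sum l w) []
    \<le> tsum n (\<lambda>s. if prn s = s then 24 * 2 ^ k * 2 ^ l * (F s * G s / \<mu> s) else 0) []"
  proof (rule sum_group_prin)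
    fix s assume s: "prn s = s"
    let ?a = "\<lambda>w. if prn w = s then level_sum k w else 0"
    let ?b = "\<lambda>w. if prn w = s then swap.level_sum l w else 0"
    have sq: "(\<Sum>w\<in>below n s. (?a w)\<^sup>2) = (\<Sum>w\<in>below n s. if prn w = s then (level_sum k w)\<^sup>2 else 0)"
      "(\<Sum>w\<in>below n s. (?b w)\<^sup>2) = (\<Sum>w\<in>below n s. if prn w = s then (swap.level_sum l w)\<^sup>2 else 0)"
      by (auto intro!: sum.cong)
    have "tsum n (\<lambda>w. if prn w = s then level_sum k w * swap.level_sum l w else 0) s
      = (\<Sum>w\<in>below n s. \<bar>?a w\<bar> * \<bar>?b w\<bar>)"
      unfolding tsum_def using level_sum_nonneg swap.level_sum_nonneg by (intro sum.cong) auto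
    also have "\<dots> \<le> L2_set ?a (below n s) * L2_set ?b (below n s)" by (rule L2_set_mult_ineq)
    also have "\<dots> \<le> sqrt (2 ^ k * (24 * (F s)\<^sup>2 / \<mu> s)) * sqrt (2 ^ l * (24 * (G s)\<^sup>2 / \<mu> s))"
      unfolding L2_set_def sq
      using level_sum_square[OF s, where n = n and k = k] swap.level_sum_square[OF s, where n = n and k = l]
      by (intro mult_mono real_sqrt_le_mono) (auto intro!: sum_nonneg)
    also have "\<dots> = sqrt (2 ^ k * 2 ^ l) * (24 * (F s * G s / \<mu> s))"
    proof -
      have "sqrt (2 ^ k * (24 * (F s)\<^sup>2 / \<mu> s)) * sqrt (2 ^ l * (24 * (G s)\<^sup>2 / \<mu> s))
        = sqrt ((2 ^ k * 2 ^ l) * (24 * (F s * G s / \<mu> s))\<^sup>2)"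
        unfolding real_sqrt_mult[symmetric]
        by (rule arg_cong[where f = sqrt]) (simp add: power2_eq_square field_simps)
      then show ?thesis by (simp add: real_sqrt_mult)
    qed
    also have "\<dots> \<le> (2 ^ k * 2 ^ l) * (24 * (F s * G s / \<mu> s))"
    proof (rule mult_right_mono)
      have "1 \<le> 2 ^ k * (2::real) ^ l" by (simp add: power_add[symmetric])
      then show "sqrt (2 ^ k * 2 ^ l) \<le> 2 ^ k * (2::real) ^ l"
        by (intro real_le_lsqrt) (auto intro!: self_le_power)
    qed simp
    finally show "tsum n (\<lambda>w. if prn w = s then level_sum k w * swap.level_sum l w else 0) s
      \<le> 24 * 2 ^ k * 2 ^ l * (F s * G s / \<mu> s)" by (simp add: mult_ac)
  qed
  then show ?thesis unfolding tsum_def diag_def sum_distrib_left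
    by (simp add: if_distrib[of "\<lambda>x. 24 * 2 ^ k * 2 ^ l * x"] cong: if_cong)
qed

definition ulist :: "nat \<Rightarrow> node set" where "ulist k = {u. 1 \<le> length u \<and> length u \<le> Suc k}"

lemma finite_ulist [simp]: "finite (ulist k)"
  unfolding ulist_def by (rule finite_subset[OF _ finite_lists_le[of "Suc k"]]) auto

lemma sum_ulist: "(\<Sum>j\<in>{1..Suc k}. \<Sum>u | length u = j. \<phi> u) = (\<Sum>u\<in>ulist k. \<phi> u)"
  for \<phi> :: "node \<Rightarrow> real"
proof -
  have "(\<Sum>u\<in>ulist k. \<phi> u) = (\<Sum>j\<in>{1..Suc k}. \<Sum>u\<in>{u\<in>ulist k. length u = j}. \<phi> u)"
    by (rule sum.group[symmetric]) (simp, simp, force simp: ulist_def)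
  also have "\<dots> = (\<Sum>j\<in>{1..Suc k}. \<Sum>u | length u = j. \<phi> u)"
    by (intro sum.cong refl) (auto simp: ulist_def)
  finally show ?thesis ..
qed

lemma card_ulist: "real (card (ulist k)) \<le> 2 * 2 ^ Suc k"
proof -
  have "real (card (ulist k)) = (\<Sum>j\<in>{1..Suc k}. \<Sum>u::node | length u = j. 1)"
    unfolding sum_ulist by simp
  also have "\<dots> = (\<Sum>j\<in>{1..Suc k}. 2 ^ j)" by (simp add: card_lists_eq)
  also have "\<dots> \<le> (\<Sum>j\<in>{..Suc k}. 2 ^ j)" by (intro sum_mono2) auto
  also have "\<dots> \<le> 2 * 2 ^ Suc k" by (induction k) auto
  finally show ?thesis .
qed

text \<open>\<open>near_stop d w\<close>: a stopping node within \<open>d\<close> generations carries a fixed proportion of the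
  measure of \<open>w\<close>. Enlarging the stopping nodes in this way preserves the packing condition.\<close>

definition near_stop :: "nat \<Rightarrow> node \<Rightarrow> bool" where
  "near_stop d w \<longleftrightarrow> (\<exists>u. length u \<le> d \<and> prn (u @ w) = u @ w \<and> \<mu> w \<le> 2 ^ d * \<mu> (u @ w))"

lemma near_stop_self: "prn w = w \<Longrightarrow> near_stop d w"
proof -
  assume "prn w = w"
  moreover have "1 * \<mu> w \<le> 2 ^ d * \<mu> w" by (rule mult_right_mono) auto
  ultimately show ?thesis unfolding near_stop_def by (intro exI[of _ "[]"]) auto
qed

lemma near_stop_carleson:
  "tsum n (\<lambda>w. if near_stop d w then \<mu> w else 0) z \<le> 4 * 2 ^ d * real (Suc d) * \<mu> z"
proof -
  let ?\<phi> = "\<lambda>v. if prn v = v then \<mu> v else 0"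
  have "(if near_stop d w then \<mu> w else 0) \<le> 2 ^ d * (\<Sum>j\<le>d. \<Sum>u | length u = j. ?\<phi> (u @ w))" for w
  proof (cases "near_stop d w")
    case True
    then obtain u where u: "length u \<le> d" "prn (u @ w) = u @ w" "\<mu> w \<le> 2 ^ d * \<mu> (u @ w)"
      by (auto simp: near_stop_def)
    have "\<mu> (u @ w) \<le> (\<Sum>v | length v = length u. ?\<phi> (v @ w))"
      using member_le_sum[of u "{v. length v = length u}" "\<lambda>v. ?\<phi> (v @ w)"] u
      by (simp add: finite_lists_eq)
    also have "\<dots> \<le> (\<Sum>j\<le>d. \<Sum>u | length u = j. ?\<phi> (u @ w))"
      by (rule member_le_sum) (use u in \<open>auto intro!: sum_nonneg\<close>)
    finally have "2 ^ d * \<mu> (u @ w) \<le> 2 ^ d * (\<Sum>j\<le>d. \<Sum>u | length u = j. ?\<phi> (u @ w))"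
      by (intro mult_left_mono) auto
    from order_trans[OF u(3) this] show ?thesis unfolding if_P[OF True] .
  next
    case False
    have "0 \<le> 2 ^ d * (\<Sum>j\<le>d. \<Sum>u | length u = j. ?\<phi> (u @ w))"
      by (intro mult_nonneg_nonneg sum_nonneg) auto
    then show ?thesis using False by simp
  qed
  then have "tsum n (\<lambda>w. if near_stop d w then \<mu> w else 0) z
    \<le> (\<Sum>w\<in>below n z. 2 ^ d * (\<Sum>j\<le>d. \<Sum>u | length u = j. ?\<phi> (u @ w)))"
    unfolding tsum_def by (rule sum_mono)
  also have "\<dots> = 2 ^ d * (\<Sum>j\<le>d. \<Sum>w\<in>below n z. \<Sum>u | length u = j. ?\<phi> (u @ w))"
    unfolding sum_distrib_left[symmetric] by (subst sum.swap) simp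
  also have "\<dots> \<le> 2 ^ d * (\<Sum>j\<le>d. 4 * \<mu> z)"
  proof (intro mult_left_mono sum_mono)
    fix j
    have "(\<Sum>w\<in>below n z. \<Sum>u | length u = j. ?\<phi> (u @ w)) \<le> (\<Sum>v\<in>below (n + j) z. ?\<phi> v)"
      by (rule sum_shift_le) auto
    also have "\<dots> \<le> 4 * \<mu> z" using stopping_carleson[of "n + j" z] by (simp add: tsum_def)
    finally show "(\<Sum>w\<in>below n z. \<Sum>u | length u = j. ?\<phi> (u @ w)) \<le> 4 * \<mu> z" .
  qed auto
  finally show ?thesis by (simp add: algebra_simps)
qed

definition off_diag :: "nat \<Rightarrow> nat \<Rightarrow> nat \<Rightarrow> real" where
  "off_diag n k l = (\<Sum>w\<in>below n []. m_node \<mu> w * (stop_sum k w * swap.stop_sum l w))"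

text \<open>The pairs of stopping nodes near a common ancestor \<open>w\<close> whose measures are comparable to
  \<open>m(w)\<close>: the only interactions that are not diagonal.\<close>

definition small_pairs :: "nat \<Rightarrow> nat \<Rightarrow> nat \<Rightarrow> nat \<Rightarrow> (node \<times> node \<times> node) set" where
  "small_pairs n k l d = {(w, u, v). w \<in> below n [] \<and> u \<in> ulist k \<and> v \<in> ulist l \<and>
     prn (u @ w) = u @ w \<and> prn (v @ w) = v @ w \<and>
     \<mu> (u @ w) \<le> 2 * \<beta> ^ d * m_node \<mu> w \<and> \<mu> (v @ w) \<le> 2 * \<beta> ^ d * m_node \<mu> w}"

text \<open>If one of the two stopping nodes carries a fixed proportion of the measure of \<open>w\<close>, then the product
  of averages is dominated by that over \<open>w\<close>, and \<open>w\<close> belongs to the enlarged family. Otherwise both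
  measures are comparable to \<open>m(w)\<close>.\<close>

lemma off_diag_term:
  assumes u: "u \<in> ulist k" "prn (u @ w) = u @ w" and v: "v \<in> ulist l" "prn (v @ w) = v @ w"
    and d: "Suc k \<le> d" "Suc l \<le> d" and w: "w \<in> below n []"
  shows "m_node \<mu> w * (F (u @ w) / \<mu> (u @ w) * (G (v @ w) / \<mu> (v @ w))) \<le>
    2 ^ d * \<beta> ^ d * (if near_stop d w then F w * G w / \<mu> w else 0)
    + \<beta> ^ d * (if (w, u, v) \<in> small_pairs n k l d then F (u @ w) * G (v @ w) / \<mu> (v @ w) else 0)"
proof -
  have lu: "length u \<le> d" "u \<noteq> []" and lv: "length v \<le> d" "v \<noteq> []"
    using u(1) v(1) d by (auto simp: ulist_def)
  have bu: "\<beta> ^ length u \<le> \<beta> ^ d" and bv: "\<beta> ^ length v \<le> \<beta> ^ d"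
    using lu lv beta by (auto intro: power_increasing)
  have mu: "m_node \<mu> w \<le> \<beta> ^ d * \<mu> (u @ w)"
    using m_node_le_descendant[OF lu(2), of w] mult_right_mono[OF bu, of "\<mu> (u @ w)"] by simp
  have mv: "m_node \<mu> w \<le> \<beta> ^ d * \<mu> (v @ w)"
    using m_node_le_descendant[OF lv(2), of w] mult_right_mono[OF bv, of "\<mu> (v @ w)"] by simp
  have Fu: "F (u @ w) \<le> F w" by (rule F_mono) (simp add: suffix_def)
  have Gv: "G (v @ w) \<le> G w" by (rule G_mono) (simp add: suffix_def)
  have bd: "0 \<le> \<beta> ^ d" using beta by simp
  have nn: "0 \<le> 2 ^ d * \<beta> ^ d * (if near_stop d w then F w * G w / \<mu> w else 0)"
    "0 \<le> \<beta> ^ d * (if (w, u, v) \<in> small_pairs n k l d then F (u @ w) * G (v @ w) / \<mu> (v @ w) else 0)"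
    using bd by auto
  have large: ?thesis if "x \<in> {u, v}" "\<mu> w \<le> 2 ^ length x * \<mu> (x @ w)" for x
  proof -
    have x: "length x \<le> d" "prn (x @ w) = x @ w" using that lu lv u v by auto
    have "\<mu> w \<le> 2 ^ length x * \<mu> (x @ w)" by (rule that)
    also have "\<dots> \<le> 2 ^ d * \<mu> (x @ w)" using x by (intro mult_right_mono power_increasing) auto
    finally have mx: "\<mu> w \<le> 2 ^ d * \<mu> (x @ w)" .
    then have ns: "near_stop d w" using x unfolding near_stop_def by blast
    have "m_node \<mu> w \<le> \<beta> ^ d * (2 ^ d * (\<mu> (u @ w) * \<mu> (v @ w)) / \<mu> w)"
    proof (cases "x = u")
      case True
      have "m_node \<mu> w * \<mu> w \<le> (\<beta> ^ d * \<mu> (v @ w)) * (2 ^ d * \<mu> (u @ w))"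
        using mv mx True bd by (intro mult_mono) auto
      then show ?thesis using mu_pos[of w] by (simp add: field_simps)
    next
      case False
      then have "x = v" using that by simp
      have "m_node \<mu> w * \<mu> w \<le> (\<beta> ^ d * \<mu> (u @ w)) * (2 ^ d * \<mu> (v @ w))"
        using mu mx \<open>x = v\<close> bd by (intro mult_mono) auto
      then show ?thesis using mu_pos[of w] by (simp add: field_simps)
    qed
    then have "m_node \<mu> w * (F (u @ w) / \<mu> (u @ w) * (G (v @ w) / \<mu> (v @ w))) \<le>
      \<beta> ^ d * (2 ^ d * (\<mu> (u @ w) * \<mu> (v @ w)) / \<mu> w) * (F (u @ w) / \<mu> (u @ w) * (G (v @ w) / \<mu> (v @ w)))"
      by (rule mult_right_mono) simp
    also have "\<dots> = \<beta> ^ d * 2 ^ d * (F (u @ w) * G (v @ w) / \<mu> w)"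
      by (simp add: field_simps)
    also have "\<dots> \<le> \<beta> ^ d * 2 ^ d * (F w * G w / \<mu> w)"
      using Fu Gv bd by (intro mult_left_mono divide_right_mono mult_mono) auto
    finally show ?thesis using ns nn(2) by (simp add: mult_ac)
  qed
  show ?thesis
  proof (cases "\<mu> w \<le> 2 ^ length u * \<mu> (u @ w) \<or> \<mu> w \<le> 2 ^ length v * \<mu> (v @ w)")
    case True then show ?thesis using large[of u] large[of v] by auto
  next
    case False
    then have su: "\<mu> (u @ w) \<le> 2 * \<beta> ^ length u * m_node \<mu> w" and sv: "\<mu> (v @ w) \<le> 2 * \<beta> ^ length v * m_node \<mu> w"
      using small_or_large[of u w] small_or_large[of v w] by auto
    have "2 * \<beta> ^ length u * m_node \<mu> w \<le> 2 * \<beta> ^ d * m_node \<mu> w" "2 * \<beta> ^ length v * m_node \<mu> w \<le> 2 * \<beta> ^ d * m_node \<mu> w"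
      using bu bv by (auto intro!: mult_right_mono)
    then have sp: "(w, u, v) \<in> small_pairs n k l d"
      using u v w su sv by (auto simp: small_pairs_def)
    have "m_node \<mu> w * (F (u @ w) / \<mu> (u @ w) * (G (v @ w) / \<mu> (v @ w))) \<le>
      (\<beta> ^ d * \<mu> (u @ w)) * (F (u @ w) / \<mu> (u @ w) * (G (v @ w) / \<mu> (v @ w)))"
      by (rule mult_right_mono[OF mu]) simp
    then show ?thesis using sp nn(1) by simp
  qed
qed

lemma off_diag_le:
  assumes d: "Suc k \<le> d" "Suc l \<le> d"
  shows "off_diag n k l \<le> 4 * 2 ^ d * 2 ^ d * (2 ^ d * \<beta> ^ d) *
      (\<Sum>w\<in>below n []. if near_stop d w then F w * G w / \<mu> w else 0)
    + \<beta> ^ d * (\<Sum>(w, u, v)\<in>small_pairs n k l d. F (u @ w) * G (v @ w) / \<mu> (v @ w))"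
proof -
  let ?D = "\<lambda>w. if near_stop d w then F w * G w / \<mu> w else 0"
  let ?R = "\<lambda>w u v. if (w, u, v) \<in> small_pairs n k l d then F (u @ w) * G (v @ w) / \<mu> (v @ w) else 0"
  let ?W = "below n [] \<times> ulist k \<times> ulist l"
  have b: "0 \<le> \<beta> ^ d" using beta by simp
  have "off_diag n k l = (\<Sum>w\<in>below n []. \<Sum>u\<in>ulist k. \<Sum>v\<in>ulist l. m_node \<mu> w *
    ((if prn (u @ w) = u @ w then F (u @ w) / \<mu> (u @ w) else 0) *
     (if prn (v @ w) = v @ w then G (v @ w) / \<mu> (v @ w) else 0)))"
    unfolding off_diag_def stop_sum_def swap.stop_sum_def sum_ulist
    unfolding sum_product unfolding sum_distrib_left ..
  also have "\<dots> \<le> (\<Sum>w\<in>below n []. \<Sum>u\<in>ulist k. \<Sum>v\<in>ulist l. 2 ^ d * \<beta> ^ d * ?D w + \<beta> ^ d * ?R w u v)"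
  proof (intro sum_mono)
    fix w u v assume *: "w \<in> below n []" "u \<in> ulist k" "v \<in> ulist l"
    show "m_node \<mu> w * ((if prn (u @ w) = u @ w then F (u @ w) / \<mu> (u @ w) else 0) *
     (if prn (v @ w) = v @ w then G (v @ w) / \<mu> (v @ w) else 0)) \<le> 2 ^ d * \<beta> ^ d * ?D w + \<beta> ^ d * ?R w u v"
    proof (cases "prn (u @ w) = u @ w \<and> prn (v @ w) = v @ w")
      case True
      then have e: "prn (u @ w) = u @ w" "prn (v @ w) = v @ w" by auto
      show ?thesis unfolding if_P[OF e(1)] if_P[OF e(2)]
        by (rule off_diag_term[OF *(2) e(1) *(3) e(2) d *(1)])
    next
      case False
      have "0 \<le> 2 ^ d * \<beta> ^ d * ?D w + \<beta> ^ d * ?R w u v"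
        using b by (intro add_nonneg_nonneg mult_nonneg_nonneg) auto
      then show ?thesis using False by auto
    qed
  qed
  also have "\<dots> = real (card (ulist k)) * real (card (ulist l)) * (2 ^ d * \<beta> ^ d) * (\<Sum>w\<in>below n []. ?D w)
    + \<beta> ^ d * (\<Sum>w\<in>below n []. \<Sum>u\<in>ulist k. \<Sum>v\<in>ulist l. ?R w u v)"
    by (simp add: sum.distrib sum_distrib_left mult_ac)
  also have "(\<Sum>w\<in>below n []. \<Sum>u\<in>ulist k. \<Sum>v\<in>ulist l. ?R w u v) = (\<Sum>(w, u, v)\<in>?W. ?R w u v)"
    by (simp add: sum.cartesian_product)
  also have "\<dots> = (\<Sum>(w, u, v)\<in>small_pairs n k l d. F (u @ w) * G (v @ w) / \<mu> (v @ w))"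
    by (intro sum.mono_neutral_cong_right) (auto simp: small_pairs_def split: if_splits)
  also have "real (card (ulist k)) * real (card (ulist l)) * (2 ^ d * \<beta> ^ d) * (\<Sum>w\<in>below n []. ?D w)
    \<le> (2 * 2 ^ d) * (2 * 2 ^ d) * (2 ^ d * \<beta> ^ d) * (\<Sum>w\<in>below n []. ?D w)"
  proof (intro mult_right_mono mult_mono)
    have "2 * 2 ^ Suc k \<le> 2 * (2::real) ^ d" "2 * 2 ^ Suc l \<le> 2 * (2::real) ^ d"
      using d by (auto intro!: power_increasing simp del: power_Suc)
    then show "real (card (ulist k)) \<le> 2 * 2 ^ d" "real (card (ulist l)) \<le> 2 * 2 ^ d"
      using card_ulist[of k] card_ulist[of l] by linarith+
  qed (use b in \<open>auto intro!: sum_nonneg\<close>)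
  finally show ?thesis by (simp add: mult_ac)
qed

text \<open>A convenient bound for all the constants that appear in the next proof; it depends only on \<open>\<beta>\<close>
  and the number of generations.\<close>

definition sparse_const :: "nat \<Rightarrow> real" where
  "sparse_const d = (24 + 144 * (real d)\<^sup>2 + 324) * (2 ^ d * \<beta> ^ d) ^ 5"

text \<open>By \<open>haar_coeff_level\<close> each factor has a part controlled by the last stopping node and a part from
  nearby stopping nodes. The product consists of the terms of \<open>diag_terms\<close>, twice those of
  \<open>cross_terms\<close>, and those of \<open>off_diag_term\<close>.\<close>

lemma haar_form_le:
  assumes d: "Suc k \<le> d" "Suc l \<le> d"
  shows "(\<Sum>w\<in>below n []. (\<Sum>u | length u = k. hc (u @ w)) * (\<Sum>v | length v = l. swap.hc (v @ w)))
    \<le> sparse_const d * ((\<Sum>w\<in>below n []. if near_stop d w then F w * G w / \<mu> w else 0)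
      + (\<Sum>(w, u, v)\<in>small_pairs n k l d. F (u @ w) * G (v @ w) / \<mu> (v @ w)))"
proof -
  define Q where "Q = 2 ^ d * \<beta> ^ d"
  let ?X = "\<Sum>w\<in>below n []. if near_stop d w then F w * G w / \<mu> w else 0"
  let ?Y = "\<Sum>(w, u, v)\<in>small_pairs n k l d. F (u @ w) * G (v @ w) / \<mu> (v @ w)"
  have X: "0 \<le> ?X" by (intro sum_nonneg) auto
  have Y: "0 \<le> ?Y" by (intro sum_nonneg) auto
  have two: "2 ^ i \<le> (2::real) ^ d" and bet: "\<beta> ^ i \<le> \<beta> ^ d" if "i \<le> d" for i
    using that beta by (auto intro: power_increasing)
  have "1 \<le> (2::real) ^ d" "1 \<le> \<beta> ^ d" using beta_pow by auto
  then have Q1: "1 \<le> Q" "2 ^ d \<le> Q" "\<beta> ^ d \<le> Q"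
    unfolding Q_def using mult_mono[of 1 "2 ^ d" 1 "\<beta> ^ d"] mult_left_mono[of 1 "\<beta> ^ d" "2 ^ d"]
      mult_right_mono[of 1 "2 ^ d" "\<beta> ^ d"] by auto
  have Qi: "2 ^ i * \<beta> ^ i \<le> Q" if "i \<le> d" for i
    unfolding Q_def using two[OF that] bet[OF that] beta by (intro mult_mono) auto
  have Qp: "Q ^ i \<le> Q ^ 5" if "i \<le> 5" for i using Q1 that by (intro power_increasing) auto
  let ?c1 = "9 * 2 ^ k * \<beta> ^ k" and ?c2 = "9 * 2 ^ l * \<beta> ^ l"
  have c: "0 \<le> ?c1" "?c1 \<le> 9 * Q" "0 \<le> ?c2" "?c2 \<le> 9 * Q"
    using Qi[of k] Qi[of l] d beta by auto
  let ?a = "level_sum k" and ?b = "swap.level_sum l"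
  let ?s = "\<lambda>w. sqrt (m_node \<mu> w) * stop_sum k w" and ?t = "\<lambda>w. sqrt (m_node \<mu> w) * swap.stop_sum l w"
  have le: "(\<Sum>w\<in>below n []. (\<Sum>u | length u = k. hc (u @ w)) * (\<Sum>v | length v = l. swap.hc (v @ w)))
    \<le> (\<Sum>w\<in>below n []. (?a w + ?c1 * ?s w) * (?b w + ?c2 * ?t w))"
  proof (intro sum_mono mult_mono)
    fix w
    show "(\<Sum>u | length u = k. hc (u @ w)) \<le> ?a w + ?c1 * ?s w"
      using haar_coeff_level_sum[where k = k and w = w] by (simp add: mult.assoc)
    show "(\<Sum>v | length v = l. swap.hc (v @ w)) \<le> ?b w + ?c2 * ?t w"
      using swap.haar_coeff_level_sum[where k = l and w = w] by (simp add: mult.assoc)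
    show "0 \<le> ?a w + ?c1 * ?s w" using level_sum_nonneg stop_sum_nonneg beta by simp
    show "0 \<le> (\<Sum>v | length v = l. swap.hc (v @ w))" by (intro sum_nonneg swap.hc_nonneg)
  qed
  have alg: "(a + c1 * s) * (b + c2 * t) = a * b + c1 * (b * s) + c2 * (a * t) + c1 * c2 * (s * t)"
    for a b c1 c2 s t :: real by (simp add: algebra_simps)
  note le
  also have "(\<Sum>w\<in>below n []. (?a w + ?c1 * ?s w) * (?b w + ?c2 * ?t w))
    = (\<Sum>w\<in>below n []. ?a w * ?b w) + ?c1 * (\<Sum>w\<in>below n []. ?b w * ?s w)
    + ?c2 * (\<Sum>w\<in>below n []. ?a w * ?t w) + ?c1 * ?c2 * off_diag n k l"
  proof -
    have "(?a w + ?c1 * ?s w) * (?b w + ?c2 * ?t w) = ?a w * ?b w + ?c1 * (?b w * ?s w)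
      + ?c2 * (?a w * ?t w) + ?c1 * ?c2 * (m_node \<mu> w * (stop_sum k w * swap.stop_sum l w))" for w
    proof -
      have "?s w * ?t w = (sqrt (m_node \<mu> w))\<^sup>2 * (stop_sum k w * swap.stop_sum l w)"
        unfolding power2_eq_square by (simp only: mult_ac)
      then have "?s w * ?t w = m_node \<mu> w * (stop_sum k w * swap.stop_sum l w)" by simp
      then show ?thesis unfolding alg by simp
    qed
    then show ?thesis by (simp only: sum.distrib sum_distrib_left off_diag_def)
  qed
  also have "\<dots> \<le> 24 * Q ^ 5 * ?X + 72 * (real d)\<^sup>2 * Q ^ 5 * ?X + 72 * (real d)\<^sup>2 * Q ^ 5 * ?X
    + (324 * Q ^ 5 * ?X + 324 * Q ^ 5 * ?Y)"
  proof (intro add_mono)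
    have D: "diag n \<le> ?X" unfolding diag_def by (rule sum_mono) (use near_stop_self in auto)
    have D0: "0 \<le> diag n" unfolding diag_def by (intro sum_nonneg) auto
    have pw: "2 ^ k * 2 ^ l \<le> Q * Q" using order_trans[OF two[of k] Q1(2)] order_trans[OF two[of l] Q1(2)] Q1 d
      by (intro mult_mono) auto
    have "(\<Sum>w\<in>below n []. ?a w * ?b w) \<le> 24 * (2 ^ k * 2 ^ l) * diag n"
      using diag_terms[of k l n] by (simp add: mult_ac)
    also have "\<dots> \<le> 24 * Q ^ 5 * ?X"
      using pw D D0 Qp[of 2] Q1 by (intro mult_mono mult_left_mono) (auto simp: power2_eq_square)
    finally show "(\<Sum>w\<in>below n []. ?a w * ?b w) \<le> 24 * Q ^ 5 * ?X" .
    have cross: "c * z \<le> 72 * (real d)\<^sup>2 * Q ^ 5 * ?X"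
      if "z \<le> 8 * 2 ^ j * \<beta> ^ j * \<beta> ^ Suc i * real ((Suc i)\<^sup>2) * (\<Sum>s\<in>below n []. if prn s = s then F s * G s / \<mu> s else 0)" "0 \<le> c" "c \<le> 9 * Q" "Suc i \<le> d" "Suc j \<le> d"
      for c z i j
    proof -
      have "c * z \<le> c * (8 * (2 ^ j * \<beta> ^ j) * \<beta> ^ Suc i * real ((Suc i)\<^sup>2) * diag n)"
        using that by (intro mult_left_mono) (auto simp: mult_ac diag_def)
      also have "\<dots> \<le> (9 * Q) * (8 * Q * Q * (real d)\<^sup>2 * ?X)"
      proof (intro mult_mono that)
        show "\<beta> ^ Suc i \<le> Q" using bet[of "Suc i"] that Q1 by linarith
        show "2 ^ j * \<beta> ^ j \<le> Q" using Qi that by simp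
        show "real ((Suc i)\<^sup>2) \<le> (real d)\<^sup>2" using that by (simp only: of_nat_power) (intro power_mono, auto)
      qed (use Q1 D D0 beta in auto)
      also have "\<dots> = 72 * (real d)\<^sup>2 * Q ^ 3 * ?X" by (simp add: power3_eq_cube)
      also have "\<dots> \<le> 72 * (real d)\<^sup>2 * Q ^ 5 * ?X"
        using Qp[of 3] X by (intro mult_right_mono mult_left_mono) auto
      finally show ?thesis .
    qed
    show "?c1 * (\<Sum>w\<in>below n []. ?b w * ?s w) \<le> 72 * (real d)\<^sup>2 * Q ^ 5 * ?X"
      using cross_terms[where n = n and k = k, OF swap.level_sum_le[of l]] c d beta
      unfolding diag_def by (intro cross[of _ l k]) auto
    show "?c2 * (\<Sum>w\<in>below n []. ?a w * ?t w) \<le> 72 * (real d)\<^sup>2 * Q ^ 5 * ?X"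
      using swap.cross_terms[where n = n and k = l, OF level_sum_le[of k]] c d beta
      unfolding mult.commute[of "G s" "F s" for s] by (intro cross[of _ k l]) auto
    have off0: "0 \<le> off_diag n k l"
      unfolding off_diag_def by (intro sum_nonneg mult_nonneg_nonneg stop_sum_nonneg swap.stop_sum_nonneg) auto
    have "?c1 * ?c2 * off_diag n k l \<le> (9 * Q) * (9 * Q) * off_diag n k l"
      using Q1 by (intro mult_right_mono[OF mult_mono[OF c(2) c(4)]] c off0) auto
    also have "\<dots> \<le> (9 * Q) * (9 * Q) * (4 * 2 ^ d * 2 ^ d * Q * ?X + \<beta> ^ d * ?Y)"
      using off_diag_le[OF d, of n] Q1 by (intro mult_left_mono) (auto simp: Q_def)
    also have "\<dots> \<le> (9 * Q) * (9 * Q) * (4 * Q * Q * Q * ?X + Q * ?Y)"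
      using Q1 X Y by (intro mult_left_mono add_mono mult_right_mono mult_mono) auto
    also have "\<dots> = 324 * Q ^ 5 * ?X + 81 * Q ^ 3 * ?Y"
      by (simp add: algebra_simps power3_eq_cube eval_nat_numeral)
    also have "\<dots> \<le> 324 * Q ^ 5 * ?X + 324 * Q ^ 5 * ?Y"
      using Qp[of 3] Q1 Y by (intro add_left_mono mult_right_mono mult_mono) auto
    finally show "?c1 * ?c2 * off_diag n k l \<le> 324 * Q ^ 5 * ?X + 324 * Q ^ 5 * ?Y" .
  qed
  also have "\<dots> \<le> sparse_const d * (?X + ?Y)"
  proof -
    have "0 \<le> (24 + 144 * (real d)\<^sup>2) * Q ^ 5 * ?Y" using Q1 Y by simp
    moreover have "sparse_const d * (?X + ?Y) = 24 * Q ^ 5 * ?X + 72 * (real d)\<^sup>2 * Q ^ 5 * ?X + 72 * (real d)\<^sup>2 * Q ^ 5 * ?X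
    + (324 * Q ^ 5 * ?X + 324 * Q ^ 5 * ?Y) + (24 + 144 * (real d)\<^sup>2) * Q ^ 5 * ?Y"
      unfolding sparse_const_def Q_def[symmetric] by (simp only: distrib_left distrib_right)
    ultimately show ?thesis by linarith
  qed
  finally show ?thesis .
qed

end

section \<open>Power inequalities\<close>

lemma weighted_amgm:
  fixes a b :: real
  assumes "0 \<le> s" "0 \<le> t" "s + t = 1" "0 \<le> a" "0 \<le> b"
  shows "a powr s * b powr t \<le> s * a + t * b"
proof (cases "a = 0 \<or> b = 0")
  case True then show ?thesis using assms by auto
next
  case False then show ?thesis using assms by (intro Youngs_inequality_0) auto
qed

lemma Holder_sum:
  fixes a b :: "'i \<Rightarrow> real"
  assumes "0 < s" "0 < t" "s + t = 1" and a: "\<And>i. i \<in> I \<Longrightarrow> 0 \<le> a i" and b: "\<And>i. i \<in> I \<Longrightarrow> 0 \<le> b i"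
  shows "(\<Sum>i\<in>I. a i powr s * b i powr t) \<le> (\<Sum>i\<in>I. a i) powr s * (\<Sum>i\<in>I. b i) powr t"
proof (cases "finite I \<and> 0 < (\<Sum>i\<in>I. a i) \<and> 0 < (\<Sum>i\<in>I. b i)")
  case False
  have "(\<Sum>i\<in>I. a i powr s * b i powr t) = 0"
  proof (cases "finite I")
    case True
    then have "(\<Sum>i\<in>I. a i) = 0 \<or> (\<Sum>i\<in>I. b i) = 0"
      using False sum_nonneg[of I a] sum_nonneg[of I b] a b by fastforce
    then have "(\<forall>i\<in>I. a i = 0) \<or> (\<forall>i\<in>I. b i = 0)"
      using sum_nonneg_eq_0_iff[OF True, of a] sum_nonneg_eq_0_iff[OF True, of b] a b by blast
    then show ?thesis by (auto intro!: sum.neutral)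
  qed simp
  then show ?thesis by simp
next
  case True
  define A B where "A = (\<Sum>i\<in>I. a i)" and "B = (\<Sum>i\<in>I. b i)"
  have AB: "0 < A" "0 < B" using True by (auto simp: A_def B_def)
  have "(\<Sum>i\<in>I. (a i / A) powr s * (b i / B) powr t) \<le> (\<Sum>i\<in>I. s * (a i / A) + t * (b i / B))"
    using assms AB by (intro sum_mono weighted_amgm) auto
  also have "\<dots> = 1" using AB assms(3)
    by (simp add: sum.distrib sum_distrib_left[symmetric] sum_divide_distrib[symmetric] A_def[symmetric] B_def[symmetric])
  finally have "(\<Sum>i\<in>I. (a i / A) powr s * (b i / B) powr t) \<le> 1" .
  moreover have "(\<Sum>i\<in>I. (a i / A) powr s * (b i / B) powr t) = (\<Sum>i\<in>I. a i powr s * b i powr t) / (A powr s * B powr t)"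
    by (simp add: powr_divide sum_divide_distrib)
  ultimately show ?thesis using AB by (simp add: A_def[symmetric] B_def[symmetric] field_simps)
qed

lemma Holder_two:
  fixes a b c d :: real
  assumes "0 < s" "0 < t" "s + t = 1" "0 \<le> a" "0 \<le> b" "0 \<le> c" "0 \<le> d"
  shows "a powr s * c powr t + b powr s * d powr t \<le> (a + b) powr s * (c + d) powr t"
  using Holder_sum[of s t "UNIV :: bool set" "\<lambda>i. if i then a else b" "\<lambda>i. if i then c else d"] assms
  by (simp add: UNIV_bool add.commute)

text \<open>The tangent of \<open>x\<^sup>p\<close> at \<open>y\<close>.\<close>

lemma powr_tangent:
  fixes x y p :: real
  assumes "1 \<le> p" "0 \<le> x" "0 \<le> y"
  shows "p * y powr (p - 1) * x \<le> x powr p + (p - 1) * y powr p"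
proof -
  have "(x powr p) powr (1 / p) * (y powr p) powr ((p - 1) / p) \<le> 1 / p * x powr p + (p - 1) / p * y powr p"
    using assms by (intro weighted_amgm) (auto simp: field_simps)
  moreover have "(x powr p) powr (1 / p) = x" using assms by (simp add: powr_powr)
  moreover have "(y powr p) powr ((p - 1) / p) = y powr (p - 1)" using assms by (simp add: powr_powr)
  ultimately have "x * y powr (p - 1) \<le> 1 / p * x powr p + (p - 1) / p * y powr p" by simp
  then have "p * (x * y powr (p - 1)) \<le> p * (1 / p * x powr p + (p - 1) / p * y powr p)"
    using assms by (intro mult_left_mono) auto
  then show ?thesis using assms by (simp add: distrib_left mult_ac)
qed

lemma powr_p_split: "0 \<le> (y::real) \<Longrightarrow> y powr (p - 1) * y = y powr p"
  using powr_mult_base[of y "p - 1"] by (simp add: mult.commute)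

text \<open>The increment of \<open>x\<^sup>p\<close> is at most \<open>p\<close> times the increment of \<open>x\<close> times the derivative at the
  right end point.\<close>

lemma powr_increment:
  fixes x h p :: real
  assumes "1 \<le> p" "0 \<le> x" "0 \<le> h"
  shows "(x + h) powr p \<le> x powr p + p * h * (x + h) powr (p - 1)"
proof -
  have "p * (x + h) powr (p - 1) * x \<le> x powr p + (p - 1) * (x + h) powr p"
    using assms by (intro powr_tangent) auto
  moreover have "(x + h) powr p = (x + h) powr (p - 1) * (x + h)"
    using assms by (simp add: powr_p_split)
  then have "p * (x + h) powr p = p * (x + h) powr (p - 1) * x + p * h * (x + h) powr (p - 1)"
    by (simp add: algebra_simps)
  ultimately show ?thesis by (simp add: left_diff_distrib)
qed

lemma powr_add_le:
  fixes x y q :: real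
  assumes "0 < q" "q \<le> 1" "0 \<le> x" "0 \<le> y"
  shows "(x + y) powr q \<le> x powr q + y powr q"
proof (cases "x + y = 0")
  case True then show ?thesis using assms by simp
next
  case False
  define s where "s = x + y"
  have s: "0 < s" using False assms by (simp add: s_def)
  have "x / s \<le> (x / s) powr q" "y / s \<le> (y / s) powr q"
    using powr_mono'[of q 1 "x / s"] powr_mono'[of q 1 "y / s"] assms s by (auto simp: s_def)
  moreover have "x / s + y / s = 1" using s by (simp add: s_def add_divide_distrib[symmetric])
  ultimately have "1 \<le> (x powr q + y powr q) / s powr q" by (simp add: powr_divide add_divide_distrib)
  then show ?thesis using s by (simp add: s_def[symmetric])
qed

lemma principal_step:
  fixes p k y a s :: real
  assumes "1 < p" "k powr (p - 1) = 2 * p" "1 \<le> k" "0 \<le> y" "k * y < a" "0 \<le> s"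
  shows "2 * p * y powr (p - 1) * (a * s) \<le> a powr p * s"
proof -
  have a: "0 \<le> a" using assms mult_nonneg_nonneg[of k y] by linarith
  have "(k * y) powr (p - 1) \<le> a powr (p - 1)" using assms by (intro powr_mono2) auto
  then have "2 * p * y powr (p - 1) \<le> a powr (p - 1)" by (simp add: powr_mult assms(2))
  then have "2 * p * y powr (p - 1) * (a * s) \<le> a powr (p - 1) * (a * s)"
    by (rule mult_right_mono) (use a assms in auto)
  also have "\<dots> = a powr p * s" using powr_p_split[OF a, of p] by (simp only: mult.assoc[symmetric])
  finally show ?thesis .
qed

text \<open>The function \<open>x\<^sup>p / a\<^sup>p\<^sup>-\<^sup>1\<close> is convex and homogeneous of degree one.\<close>

lemma powr_quotient_subadditive:
  fixes x y a b p :: real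
  assumes "1 < p" "0 \<le> x" "0 \<le> y" "0 < a" "0 < b"
  shows "(x + y) powr p / (a + b) powr (p - 1) \<le> x powr p / a powr (p - 1) + y powr p / b powr (p - 1)"
proof -
  have *: "(x powr p / a powr (p - 1)) powr (1 / p) * a powr ((p - 1) / p) = x" if "0 \<le> x" "0 < a" for x a :: real
    using that assms(1) by (simp add: powr_divide powr_powr)
  let ?s = "x powr p / a powr (p - 1) + y powr p / b powr (p - 1)"
  have one: "1 / p + (p - 1) / p = 1" using assms(1) by (simp add: add_divide_distrib[symmetric])
  have "x + y \<le> ?s powr (1 / p) * (a + b) powr ((p - 1) / p)"
    using Holder_two[OF _ _ one, of "x powr p / a powr (p - 1)" "y powr p / b powr (p - 1)" a b] assms
    unfolding *[OF assms(2,4)] *[OF assms(3,5)] by simp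
  then have "(x + y) powr p \<le> (?s powr (1 / p) * (a + b) powr ((p - 1) / p)) powr p"
    using assms by (intro powr_mono2) auto
  also have "\<dots> = ?s * (a + b) powr (p - 1)" using assms by (simp add: powr_mult powr_powr)
  finally show ?thesis using assms by (simp add: divide_le_eq)
qed

section \<open>Principal intervals for a weighted average\<close>

text \<open>Here \<open>F\<close> and \<open>X\<close> stand for the integrals of \<open>\<phi> \<sigma>\<close> and \<open>\<phi>\<^sup>p \<sigma>\<close> for some
  \<open>\<phi> \<ge> 0\<close>. Hoelder's inequality enters only through its tangents: these are linear in
  \<open>F\<close>, \<open>X\<close> and \<open>\<sigma>\<close> and can be integrated, and they are exactly what potentials need.\<close>

locale weighted_avg =
  fixes p :: real and \<sigma> F X :: "node \<Rightarrow> real"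
  assumes p: "1 < p"
    and sg_add: "tree_additive \<sigma>" and sg_pos: "0 < \<sigma> w"
    and Fs_add: "tree_additive F" and Fs_nonneg [simp]: "0 \<le> F w"
    and X_add: "tree_additive X"
    and tangent: "0 \<le> y \<Longrightarrow> p * y powr (p - 1) * F w \<le> X w + (p - 1) * y powr p * \<sigma> w"
begin

text \<open>The principal nodes are the stopping nodes for the averages of \<open>\<phi>\<close>. The jump factor \<open>K\<close> is
  chosen such that the tangent at the smaller average lies below half of the power at the larger.\<close>

definition K :: real where "K = (2 * p) powr (1 / (p - 1))"

abbreviation average :: "node \<Rightarrow> real" where "average w \<equiv> F w / \<sigma> w"

abbreviation principal :: "node \<Rightarrow> node" where "principal \<equiv> prin (\<lambda>w s. K * average s < average w)"

lemma sg_nonneg [simp]: "0 \<le> \<sigma> w" using sg_pos[of w] by simp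
lemma sg_nz [simp]: "\<sigma> w \<noteq> 0" using sg_pos[of w] by simp
lemma X_nonneg [simp]: "0 \<le> X w" using tangent[of 0 w] p by simp
lemma sg_mono: "suffix w v \<Longrightarrow> \<sigma> v \<le> \<sigma> w" by (rule additive_suffix_mono[OF sg_add]) auto

lemma K_powr: "K powr (p - 1) = 2 * p" using p by (simp add: K_def powr_powr)
lemma K_ge: "1 \<le> K" unfolding K_def using p by (intro ge_one_powr_ge_zero) auto

lemma average_le_principal: "average w \<le> K * average (principal w)"
proof (cases "principal w = w")
  case True
  then show ?thesis using mult_right_mono[OF K_ge, of "average w"] by simp
next
  case False
  from prin_not_stop[OF this] show ?thesis by (simp add: not_less)
qed

text \<open>The potential is twice the gap between \<open>X\<close> and the tangent at the average over the last
  principal node. At the next principal node the tangent point moves, and the gap shrinks by at least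
  half of \<open>\<phi>\<^sup>p \<sigma>\<close>.\<close>

lemma principal_sum: "tsum n (\<lambda>v. if principal v = v then average v powr p * \<sigma> v else 0) [] \<le> 2 * X []"
proof -
  define P where "P w s = 2 * (X w - p * average s powr (p - 1) * F w + (p - 1) * average s powr p * \<sigma> w)" for w s
  have self: "P w w = 2 * X w - 2 * (average w powr p * \<sigma> w)" for w
  proof -
    have "average w powr (p - 1) * F w = average w powr p * \<sigma> w"
      using powr_p_split[of "average w" p] by (metis Fs_nonneg divide_nonneg_nonneg mult.assoc nonzero_eq_divide_eq sg_nonneg sg_nz)
    then have "P w w = 2 * (X w - p * (average w powr p * \<sigma> w) + (p - 1) * (average w powr p * \<sigma> w))"
      by (simp only: P_def mult.assoc)
    then show ?thesis by (simp only: left_diff_distrib) simp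
  qed
  have "tsum n (\<lambda>v. if principal v = v then average v powr p * \<sigma> v else 0) []
    \<le> (if principal [] = [] then average [] powr p * \<sigma> [] + P [] [] else P [] (principal []))"
  proof (rule sum_stopping_nodes)
    fix v show "0 \<le> P v (principal v)" using tangent[of "average (principal v)" v] by (simp add: P_def)
  next
    fix v s show "P (False # v) s + P (True # v) s \<le> P v s"
      unfolding P_def additiveD[OF X_add, of v, symmetric] additiveD[OF Fs_add, of v, symmetric]
        additiveD[OF sg_add, of v, symmetric] by (simp add: algebra_simps)
  next
    fix b v assume st: "K * average (principal v) < average (b # v)"
    let ?w = "b # v" let ?y = "average (principal v)" let ?a = "average ?w"
    have y: "0 \<le> ?y" "0 \<le> ?a" by auto
    define t1 where "t1 = p * ?y powr (p - 1) * F ?w"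
    define t2 where "t2 = (p - 1) * ?y powr p * \<sigma> ?w"
    define t3 where "t3 = ?a powr p * \<sigma> ?w"
    have "2 * p * ?y powr (p - 1) * (?a * \<sigma> ?w) \<le> ?a powr p * \<sigma> ?w"
      by (rule principal_step[OF p K_powr K_ge y(1) st]) simp
    then have "2 * t1 \<le> t3" by (simp add: t1_def t3_def)
    moreover have "0 \<le> t2" using p by (simp add: t2_def)
    moreover have "P ?w (principal v) = 2 * X ?w - 2 * t1 + 2 * t2"
      by (simp only: P_def t1_def[symmetric] t2_def[symmetric] distrib_left right_diff_distrib)
    moreover have "P ?w ?w = 2 * X ?w - 2 * t3" unfolding self t3_def ..
    ultimately show "?a powr p * \<sigma> ?w + P ?w ?w \<le> P ?w (principal v)" unfolding t3_def[symmetric] by linarith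
  qed auto
  also have "\<dots> \<le> 2 * X []" by (simp add: self)
  finally show ?thesis .
qed

text \<open>The Carleson embedding theorem, with the averages already replaced by those over the principal
  intervals.\<close>

lemma carleson_embedding:
  assumes "\<And>z. tsum n (\<lambda>v. if S v then \<sigma> v else 0) z \<le> L * \<sigma> z" "0 \<le> L"
  shows "tsum n (\<lambda>v. if S v then average (principal v) powr p * \<sigma> v else 0) [] \<le> 2 * L * X []"
proof -
  have "tsum n (\<lambda>v. if S v then average (principal v) powr p * \<sigma> v else 0) []
    \<le> tsum n (\<lambda>s. if principal s = s then L * (average s powr p * \<sigma> s) else 0) []"
  proof (rule sum_group_prin)
    fix s assume "principal s = s"
    have "tsum n (\<lambda>v. if principal v = s then if S v then average (principal v) powr p * \<sigma> v else 0 else 0) s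
      \<le> (\<Sum>v\<in>below n s. average s powr p * (if S v then \<sigma> v else 0))"
      unfolding tsum_def by (intro sum_mono) auto
    also have "\<dots> = average s powr p * tsum n (\<lambda>v. if S v then \<sigma> v else 0) s"
      by (simp add: sum_distrib_left tsum_def)
    also have "\<dots> \<le> average s powr p * (L * \<sigma> s)" by (intro mult_left_mono assms) auto
    finally show "tsum n (\<lambda>v. if principal v = s then if S v then average (principal v) powr p * \<sigma> v else 0 else 0) s
      \<le> L * (average s powr p * \<sigma> s)" by (simp add: mult_ac)
  qed
  also have "\<dots> = L * tsum n (\<lambda>v. if principal v = v then average v powr p * \<sigma> v else 0) []"
    unfolding tsum_def by (subst sum_distrib_left) (intro sum.cong, auto)
  also have "\<dots> \<le> L * (2 * X [])" by (intro mult_left_mono principal_sum assms)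
  finally show ?thesis by (simp add: mult_ac)
qed

end

section \<open>A testing estimate\<close>

text \<open>The testing estimate bounds the integral of \<open>\<Sum>\<^sub>v \<tau>(v) 1\<^sub>v\<close> against \<open>\<omega>\<close>, where \<open>v\<close> runs over
  a packed family and \<open>\<tau>\<close> satisfies the \<open>A\<^sub>p\<close> relation with \<open>\<omega>\<close>.\<close>

locale packed_tree = positive_tree +
  fixes \<omega> \<tau> :: "node \<Rightarrow> real" and S :: "node \<Rightarrow> bool" and n :: nat and p A \<Lambda> :: real
  assumes p: "1 < p" and A: "0 \<le> A" and Lam: "1 \<le> \<Lambda>"
    and om_add: "tree_additive \<omega>" and om_pos: "0 < \<omega> w"
    and packing: "tsum n (\<lambda>v. if S v then \<mu> v else 0) z \<le> \<Lambda> * \<mu> z"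
    and tau_nonneg: "0 \<le> \<tau> w" and tau_supp: "\<not> S w \<Longrightarrow> \<tau> w = 0"
    and tau_le: "length w \<le> n \<Longrightarrow> \<tau> w powr (p - 1) * \<omega> w \<le> A * \<mu> w"
begin

lemma om_nonneg [simp]: "0 \<le> \<omega> w" using om_pos[of w] by simp
lemma om_nz [simp]: "\<omega> w \<noteq> 0" using om_pos[of w] by simp

abbreviation Xt :: "node \<Rightarrow> real" where "Xt \<equiv> tsum n (\<lambda>v. \<tau> v * \<omega> v)"
abbreviation Yt :: "node \<Rightarrow> real" where "Yt \<equiv> tsum n (\<lambda>v. \<tau> v * \<mu> v)"

lemma Xt_nonneg [simp]: "0 \<le> Xt w" unfolding tsum_def by (intro sum_nonneg) (simp add: tau_nonneg)
lemma Yt_nonneg [simp]: "0 \<le> Yt w" unfolding tsum_def by (intro sum_nonneg) (simp add: tau_nonneg)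

text \<open>A Kolmogorov type inequality: over a packed family, averages raised to a power below one are
  summable. The potential is the geometric mean of \<open>\<omega>\<close> and \<open>\<mu>\<close> increased by the mass of the
  family.\<close>

lemma kolmogorov:
  assumes th: "0 < \<theta>" "\<theta> \<le> 1"
  shows "tsum n (\<lambda>v. if S v then \<omega> v powr (1 - \<theta>) * \<mu> v powr \<theta> else 0) w
    \<le> (1 + \<Lambda>)\<^sup>2 / \<theta> * (\<omega> w powr (1 - \<theta>) * \<mu> w powr \<theta>)"
proof -
  define e :: "node \<Rightarrow> real" where "e = tsum n (\<lambda>v. if S v then \<mu> v else 0)"
  have e0: "0 \<le> e v" for v unfolding e_def tsum_def by (intro sum_nonneg) auto
  have e1: "e v \<le> \<Lambda> * \<mu> v" for v unfolding e_def by (rule packing)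
  define D :: "node \<Rightarrow> real" where "D v = \<omega> v powr (1 - \<theta>) * (\<mu> v + e v) powr \<theta>" for v
  have "tsum n (\<lambda>v. if S v then \<omega> v powr (1 - \<theta>) * \<mu> v powr \<theta> else 0) w \<le> (1 + \<Lambda>) / \<theta> * D w"
  proof (rule bellman)
    fix v show "0 \<le> (1 + \<Lambda>) / \<theta> * D v" using th Lam by (simp add: D_def)
  next
    fix v :: node assume v: "length v \<le> n"
    define c where "c = (if S v then \<mu> v else 0)"
    define m where "m = \<mu> v + e v"
    have c: "0 \<le> c" "c \<le> \<mu> v" by (auto simp: c_def)
    have m: "0 < m" using mu_pos[of v] e0[of v] by (simp add: m_def)
    have m1: "m \<le> (1 + \<Lambda>) * \<mu> v" using e1[of v] by (simp add: m_def algebra_simps)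
    have ec: "e v = c + e (False # v) + e (True # v)" unfolding e_def by (simp add: tsum_rec[OF v] c_def)
    have mc: "(\<mu> (False # v) + e (False # v)) + (\<mu> (True # v) + e (True # v)) = m - c"
      using mu_split[of v] ec by (simp add: m_def)
    have cm: "c \<le> m" using c e0[of v] by (simp add: m_def)
    have "D (False # v) + D (True # v) \<le> \<omega> v powr (1 - \<theta>) * (m - c) powr \<theta>"
    proof (cases "\<theta> = 1")
      case True
      then show ?thesis using mc cm add_nonneg_nonneg[OF mu_nonneg e0, of "False # v" "False # v"]
          add_nonneg_nonneg[OF mu_nonneg e0, of "True # v" "True # v"]
        by (simp add: D_def)
    next
      case False
      then have "D (False # v) + D (True # v) \<le> (\<omega> (False # v) + \<omega> (True # v)) powr (1 - \<theta>) *
        ((\<mu> (False # v) + e (False # v)) + (\<mu> (True # v) + e (True # v))) powr \<theta>"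
        unfolding D_def using th e0 by (intro Holder_two) auto
      then show ?thesis unfolding mc additiveD[OF om_add] .
    qed
    moreover have "(m - c) powr \<theta> \<le> m powr \<theta> - \<theta> / (1 + \<Lambda>) * (if S v then \<mu> v powr \<theta> else 0)"
    proof (cases "S v")
      case True
      have "((m - c) / m) powr \<theta> * 1 powr (1 - \<theta>) \<le> \<theta> * ((m - c) / m) + (1 - \<theta>) * 1"
        using th m cm by (intro weighted_amgm) auto
      also have "\<theta> * ((m - c) / m) + (1 - \<theta>) * 1 = 1 - \<theta> * (c / m)"
        using m by (simp add: field_simps)
      finally have "(m - c) powr \<theta> / m powr \<theta> \<le> 1 - \<theta> * (c / m)"
        by (simp add: powr_divide)
      then have "(m - c) powr \<theta> \<le> (1 - \<theta> * (c / m)) * m powr \<theta>"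
        using m by (simp add: divide_le_eq)
      moreover have "\<mu> v powr \<theta> / (1 + \<Lambda>) \<le> (c / m) * m powr \<theta>"
      proof -
        have "\<mu> v powr \<theta> \<le> m powr \<theta>" using th e0[of v] by (intro powr_mono2) (auto simp: m_def)
        moreover have "1 / (1 + \<Lambda>) \<le> c / m" using True m m1 Lam by (simp add: c_def field_simps)
        ultimately have "1 / (1 + \<Lambda>) * \<mu> v powr \<theta> \<le> c / m * m powr \<theta>"
          using c m by (intro mult_mono) auto
        then show ?thesis by simp
      qed
      then have "\<theta> * (\<mu> v powr \<theta> / (1 + \<Lambda>)) \<le> \<theta> * ((c / m) * m powr \<theta>)" using th by (intro mult_left_mono) auto
      ultimately show ?thesis using True by (simp add: left_diff_distrib)
    next
      case False then show ?thesis by (simp add: c_def)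
    qed
    then have "\<omega> v powr (1 - \<theta>) * (m - c) powr \<theta>
      \<le> \<omega> v powr (1 - \<theta>) * (m powr \<theta> - \<theta> / (1 + \<Lambda>) * (if S v then \<mu> v powr \<theta> else 0))"
      by (rule mult_left_mono) simp
    moreover have "\<omega> v powr (1 - \<theta>) * (m powr \<theta> - \<theta> / (1 + \<Lambda>) * (if S v then \<mu> v powr \<theta> else 0))
      = D v - \<theta> / (1 + \<Lambda>) * (if S v then \<omega> v powr (1 - \<theta>) * \<mu> v powr \<theta> else 0)"
      by (simp add: D_def m_def right_diff_distrib)
    ultimately have "\<theta> / (1 + \<Lambda>) * (if S v then \<omega> v powr (1 - \<theta>) * \<mu> v powr \<theta> else 0)
        + (D (False # v) + D (True # v)) \<le> D v" by linarith
    then have "(1 + \<Lambda>) / \<theta> * (\<theta> / (1 + \<Lambda>) * (if S v then \<omega> v powr (1 - \<theta>) * \<mu> v powr \<theta> else 0)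
        + (D (False # v) + D (True # v))) \<le> (1 + \<Lambda>) / \<theta> * D v"
      using th Lam by (intro mult_left_mono) auto
    then show "(if S v then \<omega> v powr (1 - \<theta>) * \<mu> v powr \<theta> else 0)
      + (1 + \<Lambda>) / \<theta> * D (False # v) + (1 + \<Lambda>) / \<theta> * D (True # v) \<le> (1 + \<Lambda>) / \<theta> * D v"
      using th Lam by (simp add: distrib_left add.assoc)
  qed
  also have "\<dots> \<le> (1 + \<Lambda>) / \<theta> * (\<omega> w powr (1 - \<theta>) * ((1 + \<Lambda>) * \<mu> w powr \<theta>))"
  proof -
    have "(\<mu> w + e w) powr \<theta> \<le> ((1 + \<Lambda>) * \<mu> w) powr \<theta>"
      using th e0[of w] e1[of w] by (intro powr_mono2) (auto simp: algebra_simps)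
    also have "\<dots> = (1 + \<Lambda>) powr \<theta> * \<mu> w powr \<theta>" by (rule powr_mult)
    also have "\<dots> \<le> (1 + \<Lambda>) * \<mu> w powr \<theta>"
      using th Lam powr_mono[of \<theta> 1 "1 + \<Lambda>"] by (intro mult_right_mono) auto
    finally show ?thesis unfolding D_def using th Lam by (intro mult_left_mono) auto
  qed
  finally show ?thesis by (simp add: power2_eq_square mult_ac)
qed

definition testing_const :: real where
  "testing_const = p * (((1 + \<Lambda>)\<^sup>2 * (p - 1)) powr (p - 1) + \<Lambda>)"

text \<open>For \<open>p \<ge> 2\<close> the relation bounds \<open>\<tau> \<omega>\<close> by a geometric mean of \<open>\<omega>\<close> and \<open>\<mu>\<close>, and the
  Kolmogorov inequality sums it below any node. Then \<open>X\<^sup>p / \<omega>\<^sup>p\<^sup>-\<^sup>1\<close> is built up from the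
  bottom by subadditivity and \<open>powr_increment\<close>.\<close>

lemma testing_large_p:
  assumes p2: "2 \<le> p"
  shows "Xt w powr p \<le> p * ((1 + \<Lambda>)\<^sup>2 * (p - 1)) powr (p - 1) * A * \<omega> w powr (p - 1) * Yt w"
proof -
  define \<theta> where "\<theta> = 1 / (p - 1)"
  have th: "0 < \<theta>" "\<theta> \<le> 1" using p2 by (auto simp: \<theta>_def)
  define C where "C = (1 + \<Lambda>)\<^sup>2 * (p - 1)"
  have C: "0 \<le> C" using p by (simp add: C_def)
  have tau_om: "\<tau> v * \<omega> v \<le> A powr \<theta> * (if S v then \<omega> v powr (1 - \<theta>) * \<mu> v powr \<theta> else 0)"
    if "length v \<le> n" for v
  proof (cases "S v")
    case True
    have "\<tau> v powr (p - 1) \<le> A * \<mu> v / \<omega> v" using tau_le[OF that] om_pos[of v] by (simp add: field_simps)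
    then have "(\<tau> v powr (p - 1)) powr \<theta> \<le> (A * \<mu> v / \<omega> v) powr \<theta>" using th by (intro powr_mono2) auto
    then have "\<tau> v \<le> A powr \<theta> * \<mu> v powr \<theta> / \<omega> v powr \<theta>"
      using p tau_nonneg[of v] by (simp add: \<theta>_def powr_powr powr_mult powr_divide)
    then have "\<tau> v * \<omega> v \<le> A powr \<theta> * \<mu> v powr \<theta> / \<omega> v powr \<theta> * \<omega> v" by (rule mult_right_mono) simp
    also have "\<omega> v / \<omega> v powr \<theta> = \<omega> v powr (1 - \<theta>)" using om_pos[of v] by (simp add: powr_diff)
    then have "A powr \<theta> * \<mu> v powr \<theta> / \<omega> v powr \<theta> * \<omega> v = A powr \<theta> * (\<omega> v powr (1 - \<theta>) * \<mu> v powr \<theta>)"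
      by (simp add: field_simps)
    finally show ?thesis using True by simp
  qed (simp add: tau_supp)
  have X1: "Xt v \<le> A powr \<theta> * (C * (\<omega> v powr (1 - \<theta>) * \<mu> v powr \<theta>))" for v
  proof -
    have "Xt v \<le> A powr \<theta> * tsum n (\<lambda>v. if S v then \<omega> v powr (1 - \<theta>) * \<mu> v powr \<theta> else 0) v"
      unfolding tsum_def sum_distrib_left by (intro sum_mono tau_om) (auto simp: below_def)
    also have "\<dots> \<le> A powr \<theta> * ((1 + \<Lambda>)\<^sup>2 / \<theta> * (\<omega> v powr (1 - \<theta>) * \<mu> v powr \<theta>))"
      by (intro mult_left_mono kolmogorov th) auto
    finally show ?thesis by (simp add: C_def \<theta>_def)
  qed
  have X2: "Xt v powr (p - 1) \<le> A * C powr (p - 1) * \<omega> v powr (p - 2) * \<mu> v" for v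
  proof -
    have "Xt v powr (p - 1) \<le> (A powr \<theta> * (C * (\<omega> v powr (1 - \<theta>) * \<mu> v powr \<theta>))) powr (p - 1)"
      using p by (intro powr_mono2 X1) auto
    also have "\<dots> = A * C powr (p - 1) * \<omega> v powr (p - 2) * \<mu> v"
    proof -
      have "\<theta> * (p - 1) = 1" "(1 - \<theta>) * (p - 1) = p - 2" using p by (auto simp: \<theta>_def field_simps)
      then show ?thesis using A by (simp add: powr_mult powr_powr)
    qed
    finally show ?thesis .
  qed
  have "Xt w powr p / \<omega> w powr (p - 1) \<le> p * C powr (p - 1) * A * Yt w"
  proof (induction w rule: tree_induct[of n])
    case (leaf w) then show ?case using p by (simp add: tsum_empty)
  next
    case (node w)
    let ?c = "p * C powr (p - 1) * A"
    let ?x0 = "Xt (False # w)" and ?x1 = "Xt (True # w)"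
    have rec: "Xt w = ?x0 + ?x1 + \<tau> w * \<omega> w" "Yt w = \<tau> w * \<mu> w + Yt (False # w) + Yt (True # w)"
      using tsum_rec[OF node(1), of "\<lambda>v. \<tau> v * \<omega> v"] tsum_rec[OF node(1), of "\<lambda>v. \<tau> v * \<mu> v"] by auto
    have h: "(?x0 + ?x1) powr p / \<omega> w powr (p - 1) \<le> ?x0 powr p / \<omega> (False # w) powr (p - 1)
       + ?x1 powr p / \<omega> (True # w) powr (p - 1)"
      using powr_quotient_subadditive[of p ?x0 ?x1 "\<omega> (False # w)" "\<omega> (True # w)"] p
      by (simp add: om_pos additiveD[OF om_add])
    have "Xt w powr p \<le> (?x0 + ?x1) powr p + p * (\<tau> w * \<omega> w) * Xt w powr (p - 1)"
      unfolding rec(1) using p by (intro powr_increment) (auto simp: tau_nonneg)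
    also have "\<dots> \<le> (?x0 + ?x1) powr p + p * (\<tau> w * \<omega> w) * (A * C powr (p - 1) * \<omega> w powr (p - 2) * \<mu> w)"
      using p tau_nonneg[of w] by (intro add_left_mono mult_left_mono X2) auto
    also have "p * (\<tau> w * \<omega> w) * (A * C powr (p - 1) * \<omega> w powr (p - 2) * \<mu> w)
      = ?c * (\<tau> w * \<mu> w) * (\<omega> w * \<omega> w powr (p - 2))" by (simp only: mult_ac)
    also have "\<omega> w * \<omega> w powr (p - 2) = \<omega> w powr (p - 1)" by (simp add: powr_mult_base)
    finally have "Xt w powr p / \<omega> w powr (p - 1)
      \<le> (?x0 + ?x1) powr p / \<omega> w powr (p - 1) + ?c * (\<tau> w * \<mu> w)"
      using om_pos[of w] by (simp add: divide_le_eq distrib_right)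
    with h node(2,3) show ?case unfolding rec(2) distrib_left by linarith
  qed
  then show ?thesis using om_pos[of w] by (simp add: C_def divide_le_eq mult_ac)
qed

text \<open>For \<open>p \<le> 2\<close> one integrates over the leaves: \<open>path_sum u w\<close> adds \<open>\<tau>\<close> along the path from \<open>w\<close> to
  the leaf \<open>u @ w\<close>. Since \<open>p - 1 \<le> 1\<close>, the power \<open>p - 1\<close> of a path sum is at most the sum of the
  powers, to which the packing condition applies.\<close>

primrec path_sum :: "node \<Rightarrow> node \<Rightarrow> real" where
  "path_sum [] w = \<tau> w"
| "path_sum (b # u) w = \<tau> (b # u @ w) + path_sum u w"

lemma path_sum_snoc: "path_sum (u @ [b]) w = \<tau> w + path_sum u (b # w)"
  by (induction u) auto

lemma path_sum_nonneg: "0 \<le> path_sum u w"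
  by (induction u) (auto simp: tau_nonneg)

lemma testing_small_p:
  assumes p2: "p \<le> 2" and w: "length w \<le> n"
  shows "Xt w powr p \<le> p * \<Lambda> * A * \<omega> w powr (p - 1) * Yt w"
proof -
  let ?q = "p - 1"
  have leaf: "tsum (length w) \<phi> w = \<phi> w" for \<phi> :: "node \<Rightarrow> real" and w
    by (simp add: tsum_rec tsum_empty)
  have step: "(\<Sum>u | length u = Suc k. \<omega> (u @ w) * g (path_sum u w)) =
      (\<Sum>u | length u = k. \<omega> (u @ False # w) * g (\<tau> w + path_sum u (False # w))) +
      (\<Sum>u | length u = k. \<omega> (u @ True # w) * g (\<tau> w + path_sum u (True # w)))" for k w and g :: "real \<Rightarrow> real"
    unfolding lists_Suc_snoc
    by (subst sum.union_disjoint) (auto simp: finite_lists_eq sum.reindex inj_on_def path_sum_snoc)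
  \<comment> \<open>The leaves below a node carry its weight, so the integral of the path sums is \<open>Xt\<close>.\<close>
  have a: "length w + k = n \<Longrightarrow> (\<Sum>u | length u = k. \<omega> (u @ w) * path_sum u w) = Xt w" for k w
  proof (induction k arbitrary: w)
    case 0 then show ?case using leaf[where \<phi> = "\<lambda>v. \<tau> v * \<omega> v" and w = w] by (simp add: mult.commute)
  next
    case (Suc k)
    have "(\<Sum>u | length u = Suc k. \<omega> (u @ w) * path_sum u w) =
      \<tau> w * (\<Sum>u | length u = k. \<omega> (u @ False # w)) + \<tau> w * (\<Sum>u | length u = k. \<omega> (u @ True # w))
      + (\<Sum>u | length u = k. \<omega> (u @ False # w) * path_sum u (False # w))
      + (\<Sum>u | length u = k. \<omega> (u @ True # w) * path_sum u (True # w))"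
      using step[where w = w and k = k and g = "\<lambda>x. x"] by (simp add: distrib_left sum.distrib sum_distrib_left mult.commute)
    then show ?case using Suc
      by (simp add: sum_level_additive[OF om_add] distrib_left[symmetric] additiveD[OF om_add] tsum_rec)
  qed
  define E where "E = tsum n (\<lambda>v. \<tau> v powr ?q * \<omega> v)"
  have b: "length w + k = n \<Longrightarrow> (\<Sum>u | length u = k. \<omega> (u @ w) * path_sum u w powr ?q) \<le> E w" for k w
  proof (induction k arbitrary: w)
    case 0 then show ?case using leaf[where \<phi> = "\<lambda>v. \<tau> v powr ?q * \<omega> v" and w = w] by (simp add: mult.commute E_def)
  next
    case (Suc k)
    have sub: "(\<Sum>u | length u = k. \<omega> (u @ b # w) * (\<tau> w + path_sum u (b # w)) powr ?q)
      \<le> \<tau> w powr ?q * \<omega> (b # w) + E (b # w)" for b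
    proof -
      have "(\<Sum>u | length u = k. \<omega> (u @ b # w) * (\<tau> w + path_sum u (b # w)) powr ?q)
        \<le> (\<Sum>u | length u = k. \<omega> (u @ b # w) * (\<tau> w powr ?q + path_sum u (b # w) powr ?q))"
        using p p2 by (intro sum_mono mult_left_mono powr_add_le) (auto simp: tau_nonneg path_sum_nonneg)
      also have "\<dots> = \<tau> w powr ?q * (\<Sum>u | length u = k. \<omega> (u @ b # w))
         + (\<Sum>u | length u = k. \<omega> (u @ b # w) * path_sum u (b # w) powr ?q)"
        by (simp add: distrib_left sum.distrib sum_distrib_left mult.commute)
      also have "\<dots> \<le> \<tau> w powr ?q * \<omega> (b # w) + E (b # w)"
        using Suc by (simp add: sum_level_additive[OF om_add])
      finally show ?thesis .
    qed
    have "E w = \<tau> w powr ?q * \<omega> w + E (False # w) + E (True # w)"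
      using Suc.prems by (simp add: E_def tsum_rec)
    then show ?case unfolding step[where w = w and k = k and g = "\<lambda>x. x powr ?q"] using sub[of False] sub[of True]
      by (simp add: additiveD[OF om_add, of w, symmetric] distrib_left)
  qed
  have E_le: "E w \<le> A * \<Lambda> * \<mu> w" for w
  proof -
    have "E w \<le> (\<Sum>v\<in>below n w. A * (if S v then \<mu> v else 0))"
      unfolding E_def tsum_def
    proof (rule sum_mono)
      fix v assume "v \<in> below n w"
      then have "length v \<le> n" by (simp add: below_def)
      then show "\<tau> v powr ?q * \<omega> v \<le> A * (if S v then \<mu> v else 0)"
        using tau_le[of v] tau_supp[of v] by (cases "S v") auto
    qed
    also have "\<dots> = A * tsum n (\<lambda>v. if S v then \<mu> v else 0) w" by (simp add: tsum_def sum_distrib_left)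
    also have "\<dots> \<le> A * (\<Lambda> * \<mu> w)" by (intro mult_left_mono packing A)
    finally show ?thesis by (simp add: mult.assoc)
  qed
  \<comment> \<open>By \<open>powr_increment\<close>, passing from the children to \<open>w\<close> costs \<open>\<tau> w\<close> times an integral of powers \<open>p - 1\<close>.\<close>
  have c: "length w + k = n \<Longrightarrow>
    (\<Sum>u | length u = k. \<omega> (u @ w) * path_sum u w powr p) \<le> p * \<Lambda> * A * Yt w" for k w
  proof (induction k arbitrary: w)
    case 0
    have "\<omega> w * \<tau> w powr p = \<tau> w powr ?q * \<omega> w * \<tau> w"
      using powr_p_split[OF tau_nonneg, of w p] by (simp add: mult_ac)
    also have "\<dots> \<le> A * \<mu> w * \<tau> w" using 0 by (intro mult_right_mono tau_le tau_nonneg) auto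
    also have "\<dots> \<le> p * \<Lambda> * (A * \<mu> w * \<tau> w)"
    proof -
      have "1 \<le> p * \<Lambda>" using p Lam mult_mono[of 1 p 1 \<Lambda>] by simp
      then show ?thesis using mult_right_mono[of 1 "p * \<Lambda>" "A * \<mu> w * \<tau> w"] A tau_nonneg[of w] by simp
    qed
    finally show ?case using 0 leaf[where \<phi> = "\<lambda>v. \<tau> v * \<mu> v" and w = w] by (simp add: mult_ac)
  next
    case (Suc k)
    let ?g = "\<lambda>b u. \<tau> w + path_sum u (b # w)"
    have sub: "(\<Sum>u | length u = k. \<omega> (u @ b # w) * (?g b u) powr p)
      \<le> p * \<Lambda> * A * Yt (b # w) + p * \<tau> w * (\<Sum>u | length u = k. \<omega> (u @ b # w) * (?g b u) powr ?q)" for b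
    proof -
      have "(\<Sum>u | length u = k. \<omega> (u @ b # w) * (?g b u) powr p) \<le>
        (\<Sum>u | length u = k. \<omega> (u @ b # w) * (path_sum u (b # w) powr p + p * \<tau> w * (?g b u) powr ?q))"
      proof (intro sum_mono mult_left_mono)
        fix u show "(?g b u) powr p \<le> path_sum u (b # w) powr p + p * \<tau> w * (?g b u) powr ?q"
          using powr_increment[of p "path_sum u (b # w)" "\<tau> w"] p
          by (simp add: tau_nonneg path_sum_nonneg add.commute)
      qed auto
      also have "\<dots> = (\<Sum>u | length u = k. \<omega> (u @ b # w) * path_sum u (b # w) powr p)
        + p * \<tau> w * (\<Sum>u | length u = k. \<omega> (u @ b # w) * (?g b u) powr ?q)"
        by (simp add: distrib_left sum.distrib sum_distrib_left mult_ac)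
      also have "\<dots> \<le> p * \<Lambda> * A * Yt (b # w) + p * \<tau> w * (\<Sum>u | length u = k. \<omega> (u @ b # w) * (?g b u) powr ?q)"
        using Suc by simp
      finally show ?thesis .
    qed
    have "(\<Sum>u | length u = Suc k. \<omega> (u @ w) * path_sum u w powr p)
      \<le> p * \<Lambda> * A * (Yt (False # w) + Yt (True # w))
        + p * \<tau> w * (\<Sum>u | length u = Suc k. \<omega> (u @ w) * path_sum u w powr ?q)"
      unfolding step[where w = w and k = k and g = "\<lambda>x. x powr ?q"]
        step[where w = w and k = k and g = "\<lambda>x. x powr p"] distrib_left using sub[of False] sub[of True] by linarith
    also have "\<dots> \<le> p * \<Lambda> * A * (Yt (False # w) + Yt (True # w)) + p * \<tau> w * (A * \<Lambda> * \<mu> w)"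
      using b[OF Suc.prems] E_le[of w] p tau_nonneg[of w]
      by (intro add_left_mono mult_left_mono) auto
    also have "\<dots> = p * \<Lambda> * A * Yt w" using Suc.prems by (simp add: tsum_rec algebra_simps)
    finally show ?case .
  qed
  obtain k where k: "length w + k = n" using w by (metis le_add_diff_inverse)
  have "Xt w = (\<Sum>u | length u = k. (\<omega> (u @ w) * path_sum u w powr p) powr (1 / p) * \<omega> (u @ w) powr (?q / p))"
    unfolding a[OF k, symmetric]
  proof (intro sum.cong refl)
    fix u
    have "\<omega> (u @ w) powr (1 / p) * \<omega> (u @ w) powr (?q / p) = \<omega> (u @ w)"
      using p by (simp add: powr_add[symmetric] add_divide_distrib[symmetric])
    moreover have "(\<omega> (u @ w) * path_sum u w powr p) powr (1 / p) = \<omega> (u @ w) powr (1 / p) * path_sum u w"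
      using p path_sum_nonneg[of u w] by (simp add: powr_mult powr_powr)
    ultimately show "\<omega> (u @ w) * path_sum u w
      = (\<omega> (u @ w) * path_sum u w powr p) powr (1 / p) * \<omega> (u @ w) powr (?q / p)"
      by (metis mult.assoc mult.commute)
  qed
  also have "\<dots> \<le> (\<Sum>u | length u = k. \<omega> (u @ w) * path_sum u w powr p) powr (1 / p)
      * (\<Sum>u | length u = k. \<omega> (u @ w)) powr (?q / p)"
    using p by (intro Holder_sum) (auto simp: add_divide_distrib[symmetric])
  also have "\<dots> \<le> (p * \<Lambda> * A * Yt w) powr (1 / p) * \<omega> w powr (?q / p)"
    unfolding sum_level_additive[OF om_add] using p c[OF k]
    by (intro mult_right_mono powr_mono2) (auto intro!: sum_nonneg)
  finally have "Xt w powr p \<le> ((p * \<Lambda> * A * Yt w) powr (1 / p) * \<omega> w powr (?q / p)) powr p"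
    using p by (intro powr_mono2) auto
  also have "\<dots> = p * \<Lambda> * A * Yt w * \<omega> w powr (p - 1)"
    using p A Lam by (simp add: powr_mult powr_powr)
  finally show ?thesis by (simp add: mult_ac)
qed

lemma testing:
  assumes "length w \<le> n"
  shows "Xt w powr p \<le> testing_const * A * \<omega> w powr (p - 1) * Yt w"
proof -
  have m: "c * (A * \<omega> w powr (p - 1) * Yt w) \<le> c' * (A * \<omega> w powr (p - 1) * Yt w)" if "c \<le> c'" for c c'
    using that A by (intro mult_right_mono) auto
  show ?thesis
  proof (cases "p \<le> 2")
    case True
    have "p * \<Lambda> \<le> testing_const" using p by (simp add: testing_const_def distrib_left)
    from order_trans[OF testing_small_p[OF True assms]] m[OF this] show ?thesis by (simp add: mult.assoc)
  next
    case False
    have "p * ((1 + \<Lambda>)\<^sup>2 * (p - 1)) powr (p - 1) \<le> testing_const"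
      using p Lam by (simp add: testing_const_def distrib_left)
    from order_trans[OF testing_large_p, of w] m[OF this] False show ?thesis by (simp add: mult.assoc)
  qed
qed

end

section \<open>Weighted bound for a sparse form\<close>

lemma sum_fibers_le:
  fixes \<phi> :: "'b \<Rightarrow> real"
  assumes fin: "finite T" "finite B" and key: "\<And>t. t \<in> T \<Longrightarrow> key t \<in> B"
    and card: "\<And>b. b \<in> B \<Longrightarrow> card {t \<in> T. key t = b} \<le> M" and nn: "\<And>b. b \<in> B \<Longrightarrow> 0 \<le> \<phi> b"
  shows "(\<Sum>t\<in>T. \<phi> (key t)) \<le> real M * (\<Sum>b\<in>B. \<phi> b)"
proof -
  have "(\<Sum>t\<in>T. \<phi> (key t)) = (\<Sum>b\<in>B. \<Sum>t\<in>{t \<in> T. key t = b}. \<phi> (key t))"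
    by (rule sum.group[symmetric]) (use fin key in auto)
  also have "\<dots> = (\<Sum>b\<in>B. real (card {t \<in> T. key t = b}) * \<phi> b)" by (intro sum.cong) auto
  also have "\<dots> \<le> (\<Sum>b\<in>B. real M * \<phi> b)"
    using card nn by (intro sum_mono mult_right_mono) auto
  finally show ?thesis by (simp add: sum_distrib_left)
qed

text \<open>A triple \<open>(w, u, v)\<close> stands for the pair of nodes \<open>u @ w\<close> and \<open>v @ w\<close> with the common ancestor
  \<open>w\<close>.\<close>

definition left_node :: "node \<times> node \<times> node \<Rightarrow> node" where "left_node t = fst (snd t) @ fst t"
definition right_node :: "node \<times> node \<times> node \<Rightarrow> node" where "right_node t = snd (snd t) @ fst t"

text \<open>A bound for the number of triples that share their left node, their right node, or a node strictly
  between \<open>w\<close> and the right node.\<close>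

definition mult_const :: "nat \<Rightarrow> nat" where
  "mult_const d = Suc d * card {u::node. length u \<le> d} * card {u::node. length u \<le> d}"

lemma mult_const_pos: "1 \<le> mult_const d"
proof -
  have "[] \<in> {u::node. length u \<le> d}" by simp
  then have "0 < card {u::node. length u \<le> d}" using finite_lists_le[of d] by (metis card_gt_0_iff empty_iff)
  then show ?thesis by (simp add: mult_const_def Suc_le_eq)
qed

lemma card_triples_le:
  assumes "inj_on h T" "h ` T \<subseteq> {..d} \<times> {u::node. length u \<le> d} \<times> {u::node. length u \<le> d}"
  shows "card T \<le> mult_const d"
proof -
  have "card T = card (h ` T)" using assms(1) by (simp add: card_image)
  also have "\<dots> \<le> card ({..d} \<times> {u::node. length u \<le> d} \<times> {u::node. length u \<le> d})"
    by (rule card_mono) (use assms finite_lists_le in auto)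
  finally show ?thesis by (simp only: card_cartesian_product mult_const_def mult.assoc card_atMost)
qed

text \<open>The form is the sum of \<open>F(I) G(J) / \<mu>(J)\<close> over pairs of nearby nodes \<open>I\<close>, \<open>J\<close> of a packed
  family with comparable measures. The packing constant \<open>L\<close> refers to \<open>\<sigma>\<close>, the weight of the
  left function.\<close>

locale sparse_pairs = positive_tree \<mu> + f: weighted_avg p \<sigma> F X + g: weighted_avg q \<omega> G Y
  for \<mu> \<sigma> F X \<omega> G Y :: "node \<Rightarrow> real" and p q :: real +
  fixes S :: "node \<Rightarrow> bool" and \<Theta> :: "(node \<times> node \<times> node) set" and n d :: nat and A \<Lambda> L c :: real
  assumes q_def: "q = p / (p - 1)"
    and csts: "0 \<le> A" "1 \<le> \<Lambda>" "0 \<le> L" "1 \<le> c"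
    and mu_packing: "tsum n (\<lambda>v. if S v then \<mu> v else 0) z \<le> \<Lambda> * \<mu> z"
    and sg_packing: "tsum n (\<lambda>v. if S v then \<sigma> v else 0) z \<le> L * \<sigma> z"
    and triples: "(w, u, v) \<in> \<Theta> \<Longrightarrow> length u \<le> d \<and> length v \<le> d \<and> length (u @ w) \<le> n \<and> length (v @ w) \<le> n"
      "(w, u, v) \<in> \<Theta> \<Longrightarrow> S (u @ w) \<and> S (v @ w)"
      "(w, u, v) \<in> \<Theta> \<Longrightarrow> \<mu> (u @ w) \<le> c * \<mu> (v @ w) \<and> \<mu> (v @ w) \<le> c * \<mu> (u @ w)"
      "(w, u, v) \<in> \<Theta> \<Longrightarrow> \<omega> (v @ w) / \<mu> (v @ w) * (\<sigma> (u @ w) / \<mu> (u @ w)) powr (p - 1) \<le> A"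
begin

abbreviation I :: "node \<times> node \<times> node \<Rightarrow> node" where "I \<equiv> left_node"
abbreviation J :: "node \<times> node \<times> node \<Rightarrow> node" where "J \<equiv> right_node"
abbreviation M :: real where "M \<equiv> real (mult_const d)"

lemma p1: "1 < p" by (rule f.p)
lemma q1: "1 < q" by (rule g.p)
lemma conj: "1 / p + 1 / q = 1" "1 / q + 1 / p = 1" "(p - 1) / p = 1 / q"
  using p1 by (auto simp: q_def field_simps)

lemma M1: "1 \<le> M" using mult_const_pos[of d] by simp

lemma theta:
  assumes "t \<in> \<Theta>"
  shows "length (fst (snd t)) \<le> d" "length (snd (snd t)) \<le> d" "length (I t) \<le> n" "length (J t) \<le> n"
    "S (I t)" "S (J t)" "\<mu> (I t) \<le> c * \<mu> (J t)" "\<mu> (J t) \<le> c * \<mu> (I t)"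
    "\<omega> (J t) / \<mu> (J t) * (\<sigma> (I t) / \<mu> (I t)) powr (p - 1) \<le> A"
    "suffix (fst t) (I t)" "suffix (fst t) (J t)" "length (fst t) \<le> n"
proof -
  obtain w u v where t: "t = (w, u, v)" by (cases t) auto
  note * = triples[of w u v, folded t, OF assms]
  show "length (fst (snd t)) \<le> d" "length (snd (snd t)) \<le> d" "length (I t) \<le> n" "length (J t) \<le> n"
    "S (I t)" "S (J t)" "\<mu> (I t) \<le> c * \<mu> (J t)" "\<mu> (J t) \<le> c * \<mu> (I t)"
    "\<omega> (J t) / \<mu> (J t) * (\<sigma> (I t) / \<mu> (I t)) powr (p - 1) \<le> A"
    "suffix (fst t) (I t)" "suffix (fst t) (J t)" "length (fst t) \<le> n"
    using * by (auto simp: t left_node_def right_node_def suffix_def)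
qed

lemma finite_theta: "finite \<Theta>"
proof (rule finite_subset)
  show "\<Theta> \<subseteq> {w. length w \<le> n} \<times> {u. length u \<le> d} \<times> {v. length v \<le> d}"
    using theta by (fastforce simp: mem_Times_iff)
qed (intro finite_cartesian_product finite_lists_le)

lemma card_left: "T \<subseteq> \<Theta> \<Longrightarrow> card {t \<in> T. I t = b} \<le> mult_const d"
  by (rule card_triples_le[of "\<lambda>t. (0, snd t)"])
    (auto simp: inj_on_def left_node_def dest!: subsetD triples(1))

lemma card_right: "T \<subseteq> \<Theta> \<Longrightarrow> card {t \<in> T. J t = b} \<le> mult_const d"
  by (rule card_triples_le[of "\<lambda>t. (0, snd t)"])
    (auto simp: inj_on_def right_node_def dest!: subsetD triples(1))

text \<open>A triple is \<open>near\<close> if the principal node of \<open>J\<close> lies below the common ancestor, thus within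
  \<open>d\<close> generations of \<open>J\<close>. It is \<open>far\<close> if the principal node of \<open>J\<close> lies above the common ancestor
  and below that of \<open>I\<close>. Up to exchanging the roles of the two functions, every triple is one or the
  other.\<close>

definition near :: "(node \<times> node \<times> node) set" where
  "near = {t \<in> \<Theta>. length (fst t) < length (g.principal (J t))}"

definition far :: "(node \<times> node \<times> node) set" where
  "far = {t \<in> \<Theta>. length (f.principal (I t)) \<le> length (g.principal (J t)) \<and> length (g.principal (J t)) \<le> length (fst t)}"

lemma card_near: "card {t \<in> near. g.principal (J t) = b} \<le> mult_const d"
proof (rule card_triples_le[of "\<lambda>t. (length b - length (fst t), snd t)"])
  have suf: "suffix (fst t) b" if "t \<in> near" "g.principal (J t) = b" for t
  proof -
    have "t \<in> \<Theta>" using that by (simp add: near_def)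
    from theta(11)[OF this] show ?thesis
      by (rule suffix_length_suffix) (use that prin_suffix[of _ "J t"] in \<open>auto simp: near_def\<close>)
  qed
  show "inj_on (\<lambda>t. (length b - length (fst t), snd t)) {t \<in> near. g.principal (J t) = b}"
  proof (rule inj_onI)
    fix s t assume s: "s \<in> {t \<in> near. g.principal (J t) = b}" and t: "t \<in> {t \<in> near. g.principal (J t) = b}"
      and e: "(length b - length (fst s), snd s) = (length b - length (fst t), snd t)"
    have sb: "suffix (fst s) b" and tb: "suffix (fst t) b" using suf s t by auto
    have "length (fst s) = length (fst t)"
      using e suffix_length_le[OF sb] suffix_length_le[OF tb] by (simp add: diff_eq_diff_eq le_antisym) linarith
    then have "fst s = fst t" using sb tb by (auto simp: suffix_def)
    then show "s = t" using e by (simp add: prod_eq_iff)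
  qed
  show "(\<lambda>t. (length b - length (fst t), snd t)) ` {t \<in> near. g.principal (J t) = b}
    \<subseteq> {..d} \<times> {u. length u \<le> d} \<times> {u. length u \<le> d}"
  proof (rule image_subsetI)
    fix t assume t: "t \<in> {t \<in> near. g.principal (J t) = b}"
    then have th: "t \<in> \<Theta>" by (simp add: near_def)
    have "length b \<le> length (J t)" using t prin_length[of _ "J t"] by auto
    then have "length b - length (fst t) \<le> d" using theta(2)[OF th] by (simp add: right_node_def)
    then show "(length b - length (fst t), snd t) \<in> {..d} \<times> {u. length u \<le> d} \<times> {u. length u \<le> d}"
      using theta(1,2)[OF th] by (simp add: mem_Times_iff)
  qed
qed

lemma term_le:
  assumes t: "t \<in> \<Theta>"
  shows "F (I t) * G (J t) / \<mu> (J t) \<le>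
    f.K * g.K * (f.average (f.principal (I t)) * g.average (g.principal (J t)) * (\<sigma> (I t) * \<omega> (J t) / \<mu> (J t)))"
proof -
  have "F (I t) * G (J t) / \<mu> (J t) = f.average (I t) * g.average (J t) * (\<sigma> (I t) * \<omega> (J t) / \<mu> (J t))" by simp
  also have "\<dots> \<le> (f.K * f.average (f.principal (I t))) * (g.K * g.average (g.principal (J t))) * (\<sigma> (I t) * \<omega> (J t) / \<mu> (J t))"
    using f.K_ge g.K_ge by (intro mult_right_mono mult_mono f.average_le_principal g.average_le_principal) auto
  finally show ?thesis by (simp only: mult_ac)
qed

lemma left_sum:
  assumes T: "T \<subseteq> \<Theta>"
  shows "(\<Sum>t\<in>T. f.average (f.principal (I t)) powr p * \<sigma> (I t)) \<le> M * (2 * L * X [])"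
proof -
  let ?\<phi> = "\<lambda>v. if S v then f.average (f.principal v) powr p * \<sigma> v else 0"
  have "(\<Sum>t\<in>T. f.average (f.principal (I t)) powr p * \<sigma> (I t)) = (\<Sum>t\<in>T. ?\<phi> (I t))"
    using T theta(5) by (intro sum.cong) auto
  also have "\<dots> \<le> M * (\<Sum>v\<in>below n []. ?\<phi> v)"
  proof (rule sum_fibers_le)
    show "finite T" using T finite_theta finite_subset by blast
    show "finite (below n [])" by simp
  qed (use T theta(3) card_left[OF T] in \<open>auto simp: below_Nil\<close>)
  also have "\<dots> \<le> M * (2 * L * X [])"
    using f.carleson_embedding[where n = n, OF sg_packing csts(3)] by (intro mult_left_mono) (auto simp: tsum_def)
  finally show ?thesis .
qed

text \<open>The \<open>p\<close>-th root of the \<open>A\<^sub>p\<close> relation.\<close>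

lemma pair_weight:
  assumes t: "t \<in> \<Theta>"
  shows "\<sigma> (I t) * \<omega> (J t) / \<mu> (J t) \<le> c * A powr (1 / p) * (\<sigma> (I t) powr (1 / p) * \<omega> (J t) powr (1 / q))"
proof -
  let ?s = "\<sigma> (I t)" and ?o = "\<omega> (J t)" and ?m = "\<mu> (I t)" and ?n = "\<mu> (J t)"
  have "(?o / ?n * (?s / ?m) powr (p - 1)) powr (1 / p) \<le> A powr (1 / p)"
    using theta(9)[OF t] p1 by (intro powr_mono2) auto
  then have "(?o / ?n) powr (1 / p) * (?s / ?m) powr (1 / q) \<le> A powr (1 / p)"
    unfolding powr_mult powr_powr by (simp add: conj(3))
  then have le: "?o powr (1 / p) * ?s powr (1 / q) \<le> A powr (1 / p) * (?n powr (1 / p) * ?m powr (1 / q))"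
    using mu_pos[of "I t"] mu_pos[of "J t"] by (simp add: powr_divide field_simps)
  have "?m powr (1 / q) \<le> (c * ?n) powr (1 / q)" using theta(7)[OF t] q1 by (intro powr_mono2) auto
  also have "\<dots> \<le> c * ?n powr (1 / q)"
    using csts(4) q1 powr_mono[of "1 / q" 1 c] by (simp add: powr_mult mult_right_mono)
  finally have "?n powr (1 / p) * ?m powr (1 / q) \<le> ?n powr (1 / p) * (c * ?n powr (1 / q))"
    by (rule mult_left_mono) simp
  also have "\<dots> = c * ?n" by (simp add: powr_add[symmetric] conj)
  finally have "A powr (1 / p) * (?n powr (1 / p) * ?m powr (1 / q)) \<le> A powr (1 / p) * (c * ?n)"
    by (rule mult_left_mono) simp
  with le have le2: "?o powr (1 / p) * ?s powr (1 / q) \<le> A powr (1 / p) * (c * ?n)" by simp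
  have split: "x powr (1 / p) * x powr (1 / q) = x" if "0 < x" for x :: real
    using that by (simp add: powr_add[symmetric] conj)
  have "?s * ?o = (?s powr (1 / p) * ?s powr (1 / q)) * (?o powr (1 / p) * ?o powr (1 / q))"
    by (simp only: split f.sg_pos g.sg_pos)
  also have "\<dots> = (?s powr (1 / p) * ?o powr (1 / q)) * (?o powr (1 / p) * ?s powr (1 / q))"
    by (simp only: mult_ac)
  also have "\<dots> \<le> (?s powr (1 / p) * ?o powr (1 / q)) * (A powr (1 / p) * (c * ?n))"
    by (rule mult_left_mono[OF le2]) simp
  finally show ?thesis using mu_pos[of "J t"] by (simp add: divide_le_eq mult_ac)
qed

text \<open>Hoelder's inequality over the triples. The factor with \<open>\<sigma>\<close> is a Carleson embedding; in the factor
  with \<open>\<omega>\<close> every principal node occurs boundedly often, because it is close to \<open>J\<close>.\<close>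

lemma near_bound:
  "(\<Sum>t\<in>near. F (I t) * G (J t) / \<mu> (J t)) \<le> f.K * g.K * c * A powr (1 / p) *
    ((M * (2 * L * X [])) powr (1 / p) * (M * (2 * Y [])) powr (1 / q))"
proof -
  let ?a = "\<lambda>t. f.average (f.principal (I t)) powr p * \<sigma> (I t)" and ?b = "\<lambda>t. g.average (g.principal (J t)) powr q * \<omega> (g.principal (J t))"
  let ?C = "f.K * g.K * c * A powr (1 / p)"
  have C: "0 \<le> ?C" using f.K_ge g.K_ge csts by simp
  have sub: "near \<subseteq> \<Theta>" by (auto simp: near_def)
  have "(\<Sum>t\<in>near. F (I t) * G (J t) / \<mu> (J t)) \<le> (\<Sum>t\<in>near. ?C * (?a t powr (1 / p) * ?b t powr (1 / q)))"
  proof (rule sum_mono)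
    fix t assume "t \<in> near"
    then have t: "t \<in> \<Theta>" using sub by auto
    let ?k = "f.K * g.K * (f.average (f.principal (I t)) * g.average (g.principal (J t)))"
    have k: "0 \<le> ?k" using f.K_ge g.K_ge by simp
    have "F (I t) * G (J t) / \<mu> (J t) \<le> ?k * (\<sigma> (I t) * \<omega> (J t) / \<mu> (J t))"
      using term_le[OF t] by (simp only: mult.assoc)
    also have "\<dots> \<le> ?k * (c * A powr (1 / p) * (\<sigma> (I t) powr (1 / p) * \<omega> (J t) powr (1 / q)))"
      by (intro mult_left_mono pair_weight t k)
    also have "\<dots> = ?C * ((f.average (f.principal (I t)) * \<sigma> (I t) powr (1 / p)) * (g.average (g.principal (J t)) * \<omega> (J t) powr (1 / q)))"
      by (simp only: mult_ac)
    also have "\<dots> \<le> ?C * (?a t powr (1 / p) * ?b t powr (1 / q))"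
    proof (intro mult_left_mono mult_mono C)
      show "f.average (f.principal (I t)) * \<sigma> (I t) powr (1 / p) \<le> ?a t powr (1 / p)"
        using p1 by (simp add: powr_mult powr_powr)
      have "\<omega> (J t) \<le> \<omega> (g.principal (J t))" by (rule g.sg_mono[OF prin_suffix])
      then have "\<omega> (J t) powr (1 / q) \<le> \<omega> (g.principal (J t)) powr (1 / q)" using q1 by (intro powr_mono2) auto
      then have "g.average (g.principal (J t)) * \<omega> (J t) powr (1 / q) \<le> g.average (g.principal (J t)) * \<omega> (g.principal (J t)) powr (1 / q)"
        by (rule mult_left_mono) simp
      also have "\<dots> = ?b t powr (1 / q)" using q1 by (simp add: powr_mult powr_powr)
      finally show "g.average (g.principal (J t)) * \<omega> (J t) powr (1 / q) \<le> ?b t powr (1 / q)" .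
    qed auto
    finally show "F (I t) * G (J t) / \<mu> (J t) \<le> ?C * (?a t powr (1 / p) * ?b t powr (1 / q))" .
  qed
  also have "\<dots> = ?C * (\<Sum>t\<in>near. ?a t powr (1 / p) * ?b t powr (1 / q))" by (simp only: sum_distrib_left)
  also have "\<dots> \<le> ?C * ((\<Sum>t\<in>near. ?a t) powr (1 / p) * (\<Sum>t\<in>near. ?b t) powr (1 / q))"
    using p1 q1 conj by (intro mult_left_mono Holder_sum C) auto
  also have "\<dots> \<le> ?C * ((M * (2 * L * X [])) powr (1 / p) * (M * (2 * Y [])) powr (1 / q))"
  proof (intro mult_left_mono mult_mono powr_mono2 C left_sum sub)
    let ?\<phi> = "\<lambda>v. if g.principal v = v then g.average v powr q * \<omega> v else 0"
    have "(\<Sum>t\<in>near. ?b t) = (\<Sum>t\<in>near. ?\<phi> (g.principal (J t)))" by (intro sum.cong) auto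
    also have "\<dots> \<le> M * (\<Sum>v\<in>below n []. ?\<phi> v)"
    proof (rule sum_fibers_le)
      show "finite near" using sub finite_theta finite_subset by blast
      fix t assume "t \<in> near"
      then have "length (J t) \<le> n" using sub theta(4)[of t] by blast
      then show "g.principal (J t) \<in> below n []" using prin_length[of _ "J t"] by (auto simp: below_Nil intro: order_trans)
    qed (use card_near in auto)
    also have "\<dots> \<le> M * (2 * Y [])"
      using g.principal_sum[of n] by (intro mult_left_mono) (auto simp: tsum_def)
    finally show "(\<Sum>t\<in>near. ?b t) \<le> M * (2 * Y [])" .
  qed (use p1 q1 csts in \<open>auto intro!: sum_nonneg\<close>)
  finally show ?thesis .
qed

text \<open>The far triples are grouped by the principal node \<open>Q\<close> of \<open>J\<close>. Since \<open>Q\<close> lies between \<open>I\<close>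
  and the principal node of \<open>I\<close>, the latter is determined by \<open>Q\<close>.\<close>

definition to_principal :: "node \<Rightarrow> (node \<times> node \<times> node) set" where
  "to_principal Q = {t \<in> far. g.principal (J t) = Q}"

lemma far_principal:
  assumes t: "t \<in> to_principal Q"
  shows "f.principal (I t) = f.principal Q" "suffix Q (J t)" "t \<in> \<Theta>"
proof -
  show th: "t \<in> \<Theta>" using t by (simp add: to_principal_def far_def)
  have Q: "g.principal (J t) = Q" and len: "length (f.principal (I t)) \<le> length Q" "length Q \<le> length (fst t)"
    using t by (auto simp: to_principal_def far_def)
  show "suffix Q (J t)" using prin_suffix[of "\<lambda>w s. g.K * g.average s < g.average w" "J t"] unfolding Q .
  then have Qw: "suffix Q (fst t)" by (rule suffix_length_suffix[OF _ theta(11)[OF th] len(2)])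
  then have "suffix Q (I t)" using theta(10)[OF th] by (rule suffix_order.trans)
  from prin_between_length[OF this len(1)] show "f.principal (I t) = f.principal Q" by simp
qed

definition H :: real where "H = packed_tree.testing_const p \<Lambda> * M powr (p - 1) * c"

lemma testing_const_nonneg: "0 \<le> packed_tree.testing_const p \<Lambda>"
proof -
  have "packed_tree \<mu> \<omega> (\<lambda>_. 0) S n p 0 \<Lambda>"
    using p1 csts mu_packing g.sg_add g.sg_pos by unfold_locales auto
  from packed_tree.testing_const_def[OF this] show ?thesis using p1 csts by simp
qed

text \<open>The testing estimate on the tree below \<open>Q\<close>, with \<open>\<tau>(J)\<close> the sum of the averages of \<open>\<sigma>\<close> over
  the partners of \<open>J\<close>.\<close>

lemma far_testing:
  "(\<Sum>t\<in>to_principal Q. \<sigma> (I t) / \<mu> (I t) * \<omega> (J t))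
    \<le> (H * A) powr (1 / p) * ((\<Sum>t\<in>to_principal Q. \<sigma> (I t)) powr (1 / p) * \<omega> Q powr (1 / q))"
proof (cases "length Q \<le> n")
  case False
  have "t \<notin> to_principal Q" for t
  proof
    assume t: "t \<in> to_principal Q"
    from suffix_length_le[OF far_principal(2)[OF t]] theta(4)[OF far_principal(3)[OF t]] False
    show False by simp
  qed
  then have "to_principal Q = {}" by blast
  then show ?thesis by simp
next
  case True
  let ?T = "to_principal Q"
  have fin: "finite ?T" by (rule finite_subset[OF _ finite_theta]) (use far_principal(3) in auto)
  define \<tau> where "\<tau> j = (\<Sum>t\<in>{t \<in> ?T. J t = j}. \<sigma> (I t) / \<mu> (I t))" for j
  have tau_card: "real (card {t \<in> ?T. J t = j}) \<le> M" for j
  proof -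
    have "?T \<subseteq> \<Theta>" using far_principal(3) by blast
    from card_right[OF this, of j] show ?thesis by simp
  qed
  interpret pt: packed_tree \<mu> \<omega> \<tau> S n p "M powr (p - 1) * A" \<Lambda>
  proof unfold_locales
    fix w
    show "0 \<le> \<tau> w" unfolding \<tau>_def by (intro sum_nonneg) auto
    show "\<tau> w = 0" if "\<not> S w" unfolding \<tau>_def
    proof (intro sum.neutral ballI)
      fix t assume "t \<in> {t \<in> ?T. J t = w}"
      then have "S w" using theta(6)[of t] far_principal(3)[of t] by auto
      with that show "\<sigma> (I t) / \<mu> (I t) = 0" by simp
    qed
    show "\<tau> w powr (p - 1) * \<omega> w \<le> M powr (p - 1) * A * \<mu> w"
    proof -
      define r where "r = (A * \<mu> w / \<omega> w) powr (1 / (p - 1))"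
      have "\<sigma> (I t) / \<mu> (I t) \<le> r" if "t \<in> {t \<in> ?T. J t = w}" for t
      proof -
        have "\<omega> w / \<mu> w * (\<sigma> (I t) / \<mu> (I t)) powr (p - 1) \<le> A"
          using theta(9)[of t] far_principal(3)[of t] that by auto
        then have "(\<sigma> (I t) / \<mu> (I t)) powr (p - 1) \<le> A * \<mu> w / \<omega> w"
          using mu_pos[of w] g.sg_pos[of w] by (simp add: field_simps)
        then have "((\<sigma> (I t) / \<mu> (I t)) powr (p - 1)) powr (1 / (p - 1)) \<le> r"
          unfolding r_def using p1 by (intro powr_mono2) auto
        then show ?thesis using p1 by (simp add: powr_powr)
      qed
      then have "\<tau> w \<le> real (card {t \<in> ?T. J t = w}) * r"
        unfolding \<tau>_def using sum_bounded_above[of "{t \<in> ?T. J t = w}" "\<lambda>t. \<sigma> (I t) / \<mu> (I t)" r] by simp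
      also have "\<dots> \<le> M * r" by (intro mult_right_mono tau_card) (simp add: r_def)
      finally have "\<tau> w powr (p - 1) \<le> (M * r) powr (p - 1)"
        using p1 by (intro powr_mono2) (auto simp: \<tau>_def intro!: sum_nonneg)
      also have "\<dots> = M powr (p - 1) * (A * \<mu> w / \<omega> w)"
        using p1 csts by (simp add: powr_mult r_def powr_powr)
      finally have "\<tau> w powr (p - 1) * \<omega> w \<le> M powr (p - 1) * (A * \<mu> w / \<omega> w) * \<omega> w"
        by (rule mult_right_mono) simp
      then show ?thesis by simp
    qed
  qed (use p1 csts mu_packing g.sg_add g.sg_pos in auto)
  have group: "(\<Sum>t\<in>?T. \<sigma> (I t) / \<mu> (I t) * h (J t)) = tsum n (\<lambda>v. \<tau> v * h v) Q" for h :: "node \<Rightarrow> real"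
  proof -
    have "J ` ?T \<subseteq> below n Q" using far_principal(2,3) theta(4) by (auto simp: below_def)
    then have "(\<Sum>t\<in>?T. \<sigma> (I t) / \<mu> (I t) * h (J t))
        = (\<Sum>j\<in>below n Q. \<Sum>t\<in>{t \<in> ?T. J t = j}. \<sigma> (I t) / \<mu> (I t) * h (J t))"
      by (intro sum.group[symmetric] fin) auto
    also have "\<dots> = tsum n (\<lambda>v. \<tau> v * h v) Q"
      unfolding tsum_def \<tau>_def sum_distrib_right by (intro sum.cong) auto
    finally show ?thesis .
  qed
  let ?X = "\<Sum>t\<in>?T. \<sigma> (I t) / \<mu> (I t) * \<omega> (J t)"
  have X0: "0 \<le> ?X" by (intro sum_nonneg) auto
  have "?X powr p \<le> packed_tree.testing_const p \<Lambda> * (M powr (p - 1) * A) * \<omega> Q powr (p - 1)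
      * (\<Sum>t\<in>?T. \<sigma> (I t) / \<mu> (I t) * \<mu> (J t))"
    unfolding group by (rule pt.testing[OF True])
  also have "\<dots> \<le> packed_tree.testing_const p \<Lambda> * (M powr (p - 1) * A) * \<omega> Q powr (p - 1)
      * (c * (\<Sum>t\<in>?T. \<sigma> (I t)))"
  proof (intro mult_left_mono)
    show "(\<Sum>t\<in>?T. \<sigma> (I t) / \<mu> (I t) * \<mu> (J t)) \<le> c * (\<Sum>t\<in>?T. \<sigma> (I t))"
      unfolding sum_distrib_left
    proof (rule sum_mono)
      fix t assume "t \<in> ?T"
      then have "\<mu> (J t) \<le> c * \<mu> (I t)" using theta(8) far_principal(3) by blast
      then have "\<sigma> (I t) / \<mu> (I t) * \<mu> (J t) \<le> \<sigma> (I t) / \<mu> (I t) * (c * \<mu> (I t))"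
        by (rule mult_left_mono) simp
      then show "\<sigma> (I t) / \<mu> (I t) * \<mu> (J t) \<le> c * \<sigma> (I t)" by (simp add: mult.commute)
    qed
    show "0 \<le> packed_tree.testing_const p \<Lambda> * (M powr (p - 1) * A) * \<omega> Q powr (p - 1)"
      using testing_const_nonneg csts by simp
  qed
  finally have "(?X powr p) powr (1 / p) \<le> (H * A * (\<omega> Q powr (p - 1) * (\<Sum>t\<in>?T. \<sigma> (I t)))) powr (1 / p)"
    using p1 by (intro powr_mono2) (auto simp: H_def mult_ac)
  also have "\<dots> = (H * A) powr (1 / p) * ((\<Sum>t\<in>?T. \<sigma> (I t)) powr (1 / p) * \<omega> Q powr (1 / q))"
    by (simp add: powr_mult powr_powr conj(3) mult_ac)
  finally show ?thesis using X0 p1 by (simp add: powr_powr)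
qed

text \<open>The averages of \<open>\<phi>\<close> and \<open>\<psi>\<close> are frozen at the two principal nodes. After the testing estimate,
  Hoelder's inequality over \<open>Q\<close> separates a Carleson embedding for \<open>\<sigma>\<close> from the sum over the
  principal nodes of \<open>\<psi>\<close>.\<close>

lemma far_bound:
  "(\<Sum>t\<in>far. F (I t) * G (J t) / \<mu> (J t)) \<le> f.K * g.K * c * (H * A) powr (1 / p) *
    ((M * (2 * L * X [])) powr (1 / p) * (2 * Y []) powr (1 / q))"
proof -
  let ?P = "{Q \<in> below n []. g.principal Q = Q}"
  let ?s = "\<lambda>Q. \<Sum>t\<in>to_principal Q. \<sigma> (I t)"
  let ?C = "f.K * g.K * c"
  have C: "0 \<le> ?C" using f.K_ge g.K_ge csts by simp
  have sub: "far \<subseteq> \<Theta>" by (auto simp: far_def)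
  have fin: "finite far" using sub finite_theta finite_subset by blast
  have im: "(\<lambda>t. g.principal (J t)) ` far \<subseteq> ?P"
  proof (rule image_subsetI)
    fix t assume "t \<in> far"
    then have "length (J t) \<le> n" using sub theta(4)[of t] by blast
    then show "g.principal (J t) \<in> ?P" using prin_length[of _ "J t"] by (auto simp: below_Nil intro: order_trans)
  qed
  have grp: "(\<Sum>t\<in>far. h t) = (\<Sum>Q\<in>?P. \<Sum>t\<in>to_principal Q. h t)" for h :: "_ \<Rightarrow> real"
    unfolding to_principal_def by (rule sum.group[symmetric, OF fin _ im]) simp
  have "(\<Sum>t\<in>far. F (I t) * G (J t) / \<mu> (J t))
    \<le> (\<Sum>Q\<in>?P. ?C * (f.average (f.principal Q) * g.average Q) * (\<Sum>t\<in>to_principal Q. \<sigma> (I t) / \<mu> (I t) * \<omega> (J t)))"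
    unfolding grp
  proof (rule sum_mono)
    fix Q
    have "(\<Sum>t\<in>to_principal Q. F (I t) * G (J t) / \<mu> (J t))
      \<le> (\<Sum>t\<in>to_principal Q. ?C * (f.average (f.principal Q) * g.average Q) * (\<sigma> (I t) / \<mu> (I t) * \<omega> (J t)))"
    proof (rule sum_mono)
      fix t assume t: "t \<in> to_principal Q"
      note fp = far_principal[OF t]
      have Q: "g.principal (J t) = Q" using t by (simp add: to_principal_def)
      let ?k = "f.K * g.K * (f.average (f.principal Q) * g.average Q)"
      have k: "0 \<le> ?k" using f.K_ge g.K_ge by simp
      have "1 / \<mu> (J t) \<le> c / \<mu> (I t)"
        using theta(7)[OF fp(3)] mu_pos[of "I t"] mu_pos[of "J t"] by (simp add: field_simps)
      then have "\<sigma> (I t) * \<omega> (J t) * (1 / \<mu> (J t)) \<le> \<sigma> (I t) * \<omega> (J t) * (c / \<mu> (I t))"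
        by (rule mult_left_mono) simp
      then have "?k * (\<sigma> (I t) * \<omega> (J t) / \<mu> (J t)) \<le> ?k * (c * (\<sigma> (I t) / \<mu> (I t) * \<omega> (J t)))"
        by (intro mult_left_mono k) (simp add: mult_ac)
      moreover have "F (I t) * G (J t) / \<mu> (J t) \<le> ?k * (\<sigma> (I t) * \<omega> (J t) / \<mu> (J t))"
        using term_le[OF fp(3)] unfolding fp(1) Q by (simp only: mult.assoc)
      ultimately show "F (I t) * G (J t) / \<mu> (J t) \<le> ?C * (f.average (f.principal Q) * g.average Q) * (\<sigma> (I t) / \<mu> (I t) * \<omega> (J t))"
        by (simp only: mult_ac)
    qed
    then show "(\<Sum>t\<in>to_principal Q. F (I t) * G (J t) / \<mu> (J t))
      \<le> ?C * (f.average (f.principal Q) * g.average Q) * (\<Sum>t\<in>to_principal Q. \<sigma> (I t) / \<mu> (I t) * \<omega> (J t))"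
      by (simp only: sum_distrib_left)
  qed
  also have "\<dots> \<le> (\<Sum>Q\<in>?P. ?C * (H * A) powr (1 / p) *
      ((f.average (f.principal Q) powr p * ?s Q) powr (1 / p) * (g.average Q powr q * \<omega> Q) powr (1 / q)))"
  proof (rule sum_mono)
    fix Q
    have "?C * (f.average (f.principal Q) * g.average Q) * (\<Sum>t\<in>to_principal Q. \<sigma> (I t) / \<mu> (I t) * \<omega> (J t))
      \<le> ?C * (f.average (f.principal Q) * g.average Q) * ((H * A) powr (1 / p) * (?s Q powr (1 / p) * \<omega> Q powr (1 / q)))"
      by (rule mult_left_mono[OF far_testing mult_nonneg_nonneg[OF C]]) simp
    also have "\<dots> = ?C * (H * A) powr (1 / p) *
      ((f.average (f.principal Q) * ?s Q powr (1 / p)) * (g.average Q * \<omega> Q powr (1 / q)))" by (simp only: mult_ac)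
    also have "f.average (f.principal Q) * ?s Q powr (1 / p) = (f.average (f.principal Q) powr p * ?s Q) powr (1 / p)"
      using p1 by (simp add: powr_mult powr_powr)
    also have "g.average Q * \<omega> Q powr (1 / q) = (g.average Q powr q * \<omega> Q) powr (1 / q)"
      using q1 by (simp add: powr_mult powr_powr)
    finally show "?C * (f.average (f.principal Q) * g.average Q) * (\<Sum>t\<in>to_principal Q. \<sigma> (I t) / \<mu> (I t) * \<omega> (J t))
      \<le> ?C * (H * A) powr (1 / p) *
      ((f.average (f.principal Q) powr p * ?s Q) powr (1 / p) * (g.average Q powr q * \<omega> Q) powr (1 / q))" .
  qed
  also have "\<dots> = ?C * (H * A) powr (1 / p) *
      (\<Sum>Q\<in>?P. (f.average (f.principal Q) powr p * ?s Q) powr (1 / p) * (g.average Q powr q * \<omega> Q) powr (1 / q))"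
    by (simp only: sum_distrib_left)
  also have "\<dots> \<le> ?C * (H * A) powr (1 / p) *
      ((\<Sum>Q\<in>?P. f.average (f.principal Q) powr p * ?s Q) powr (1 / p) * (\<Sum>Q\<in>?P. g.average Q powr q * \<omega> Q) powr (1 / q))"
    using p1 q1 conj by (intro mult_left_mono Holder_sum mult_nonneg_nonneg[OF C powr_ge_zero])
      (auto intro!: sum_nonneg mult_nonneg_nonneg)
  also have "\<dots> \<le> ?C * (H * A) powr (1 / p) * ((M * (2 * L * X [])) powr (1 / p) * (2 * Y []) powr (1 / q))"
  proof (intro mult_left_mono mult_mono powr_mono2)
    have "(\<Sum>Q\<in>?P. f.average (f.principal Q) powr p * ?s Q) = (\<Sum>t\<in>far. f.average (f.principal (I t)) powr p * \<sigma> (I t))"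
      unfolding grp sum_distrib_left using far_principal(1) by (intro sum.cong refl) auto
    also have "\<dots> \<le> M * (2 * L * X [])" by (rule left_sum[OF sub])
    finally show "(\<Sum>Q\<in>?P. f.average (f.principal Q) powr p * ?s Q) \<le> M * (2 * L * X [])" .
    show "(\<Sum>Q\<in>?P. g.average Q powr q * \<omega> Q) \<le> 2 * Y []"
      using g.principal_sum[of n] by (simp add: tsum_def sum.inter_filter)
  qed (use C p1 q1 in \<open>auto intro!: sum_nonneg mult_nonneg_nonneg\<close>)
  finally show ?thesis .
qed

definition half_const :: real where
  "half_const = f.K * g.K * c * (4 * M) * (1 + H powr (1 / p))"

text \<open>Only the packing constant of \<open>\<sigma>\<close> occurs. The triples that are left out are treated by the same
  lemma with the two functions exchanged and produce the packing constant of \<open>\<omega>\<close>; hence the sum, and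
  not the product, of the two constants in the end.\<close>

lemma half_bound:
  "(\<Sum>t\<in>near. F (I t) * G (J t) / \<mu> (J t)) + (\<Sum>t\<in>far. F (I t) * G (J t) / \<mu> (J t))
    \<le> half_const * (A powr (1 / p) * L powr (1 / p) * X [] powr (1 / p) * Y [] powr (1 / q))"
proof -
  let ?R = "A powr (1 / p) * L powr (1 / p) * X [] powr (1 / p) * Y [] powr (1 / q)"
  let ?k = "f.K * g.K * c"
  have k: "0 \<le> ?k" using f.K_ge g.K_ge csts by simp
  have two: "2 powr (1 / p) \<le> 2" "2 powr (1 / q) \<le> 2"
    using p1 q1 powr_mono[of "1 / p" 1 "2::real"] powr_mono[of "1 / q" 1 "2::real"] by auto
  have four: "2 powr (1 / p) * 2 powr (1 / q) \<le> (4::real)" using mult_mono[OF two] by simp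
  have MM: "M powr (1 / p) \<le> M" using M1 p1 powr_mono[of "1 / p" 1 M] by simp
  have MM2: "M powr (1 / p) * M powr (1 / q) = M" using M1 by (simp add: powr_add[symmetric] conj)
  have "(M * (2 * L * X [])) powr (1 / p) * (M * (2 * Y [])) powr (1 / q)
    = (2 powr (1 / p) * 2 powr (1 / q)) * (M powr (1 / p) * M powr (1 / q)) *
      (L powr (1 / p) * X [] powr (1 / p) * Y [] powr (1 / q))" by (simp only: powr_mult mult_ac)
  also have "\<dots> \<le> 4 * M * (L powr (1 / p) * X [] powr (1 / p) * Y [] powr (1 / q))"
    unfolding MM2 using four by (intro mult_right_mono) auto
  finally have "?k * A powr (1 / p) * ((M * (2 * L * X [])) powr (1 / p) * (M * (2 * Y [])) powr (1 / q))
    \<le> ?k * A powr (1 / p) * (4 * M * (L powr (1 / p) * X [] powr (1 / p) * Y [] powr (1 / q)))"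
    using k by (intro mult_left_mono) auto
  with near_bound have n: "(\<Sum>t\<in>near. F (I t) * G (J t) / \<mu> (J t)) \<le> ?k * (4 * M) * ?R"
    by (simp add: mult_ac)
  have "(M * (2 * L * X [])) powr (1 / p) * (2 * Y []) powr (1 / q)
    = (2 powr (1 / p) * 2 powr (1 / q)) * M powr (1 / p) *
      (L powr (1 / p) * X [] powr (1 / p) * Y [] powr (1 / q))" by (simp only: powr_mult mult_ac)
  also have "\<dots> \<le> 4 * M * (L powr (1 / p) * X [] powr (1 / p) * Y [] powr (1 / q))"
    using four MM by (intro mult_right_mono mult_mono) auto
  finally have "?k * (H * A) powr (1 / p) * ((M * (2 * L * X [])) powr (1 / p) * (2 * Y []) powr (1 / q))
    \<le> ?k * (H * A) powr (1 / p) * (4 * M * (L powr (1 / p) * X [] powr (1 / p) * Y [] powr (1 / q)))"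
    using k by (intro mult_left_mono) auto
  with far_bound have "(\<Sum>t\<in>far. F (I t) * G (J t) / \<mu> (J t)) \<le> ?k * (4 * M) * H powr (1 / p) * ?R"
    by (simp add: powr_mult mult_ac)
  with n show ?thesis by (simp add: half_const_def distrib_left distrib_right)
qed

end

section \<open>Packing with respect to a weight\<close>

text \<open>For an \<open>A\<^sub>p\<close> weight, a family packed with respect to \<open>\<mu>\<close> is packed with respect to the weight.
  The potential is the convex function \<open>x\<^sup>p / \<sigma>\<^sup>p\<^sup>-\<^sup>1\<close> of \<open>x = 2 \<Lambda> \<mu> - e\<close>, where \<open>e\<close> is the mass of the
  family: it drops by the required amount whenever \<open>e\<close> jumps.\<close>

lemma Ap_packing:
  fixes \<mu> \<sigma> \<omega> :: "node \<Rightarrow> real"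
  assumes "positive_tree \<mu>" and dual: "weighted_avg p \<sigma> \<mu> \<omega>" and Lam: "1 \<le> \<Lambda>" and A: "0 \<le> A"
    and Ap: "\<And>w. \<omega> w / \<mu> w * (\<sigma> w / \<mu> w) powr (p - 1) \<le> A"
    and packing: "\<And>z. tsum n (\<lambda>v. if S v then \<mu> v else 0) z \<le> \<Lambda> * \<mu> z"
  shows "tsum n (\<lambda>v. if S v then \<omega> v else 0) z \<le> A * (2 * \<Lambda>) powr p * \<omega> z"
proof -
  interpret positive_tree \<mu> by fact
  interpret weighted_avg p \<sigma> \<mu> \<omega> by fact
  have holder: "\<mu> w powr p / \<sigma> w powr (p - 1) \<le> \<omega> w" for w
  proof -
    have e1: "(\<mu> w / \<sigma> w) powr (p - 1) * \<mu> w = \<mu> w powr p / \<sigma> w powr (p - 1)"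
      using powr_p_split[of "\<mu> w" p] by (simp add: powr_divide)
    have "(\<mu> w / \<sigma> w) powr p = (\<mu> w / \<sigma> w) powr (p - 1) * (\<mu> w / \<sigma> w)" using powr_p_split[of "\<mu> w / \<sigma> w" p] by simp
    then have e2: "(\<mu> w / \<sigma> w) powr p * \<sigma> w = \<mu> w powr p / \<sigma> w powr (p - 1)"
      using e1 by simp
    have "p * ((\<mu> w / \<sigma> w) powr (p - 1) * \<mu> w) \<le> \<omega> w + (p - 1) * ((\<mu> w / \<sigma> w) powr p * \<sigma> w)"
      using tangent[of "\<mu> w / \<sigma> w" w] by (simp add: mult.assoc)
    moreover have "z \<le> o'" if "p * z \<le> o' + (p - 1) * z" for z o' :: real
      using that by (simp add: left_diff_distrib)
    ultimately show ?thesis unfolding e1 e2 by blast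
  qed
  define e :: "node \<Rightarrow> real" where "e = tsum n (\<lambda>v. if S v then \<mu> v else 0)"
  have e0: "0 \<le> e v" for v unfolding e_def tsum_def by (intro sum_nonneg) auto
  define x where "x v = 2 * \<Lambda> * \<mu> v - e v" for v
  have x1: "\<Lambda> * \<mu> v \<le> x v" for v using packing[of v] by (simp add: x_def e_def)
  have Lmu: "\<mu> v \<le> \<Lambda> * \<mu> v" for v using mult_right_mono[OF Lam, of "\<mu> v"] by simp
  have x2: "x v \<le> 2 * \<Lambda> * \<mu> v" for v using e0 by (simp add: x_def)
  have x0: "0 \<le> x v" for v using x1[of v] Lmu[of v] mu_pos[of v] by linarith
  define h where "h v = x v powr p / \<sigma> v powr (p - 1)" for v
  have "tsum n (\<lambda>v. if S v then \<mu> v powr p / \<sigma> v powr (p - 1) else 0) z \<le> (2 * \<Lambda>) powr p * \<omega> z - h z"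
  proof (rule bellman)
    fix v
    have "x v powr p \<le> (2 * \<Lambda> * \<mu> v) powr p" using p x0 x2 by (intro powr_mono2) auto
    then have "h v \<le> (2 * \<Lambda> * \<mu> v) powr p / \<sigma> v powr (p - 1)"
      unfolding h_def by (rule divide_right_mono) simp
    also have "\<dots> = (2 * \<Lambda>) powr p * (\<mu> v powr p / \<sigma> v powr (p - 1))" by (simp add: powr_mult)
    also have "\<dots> \<le> (2 * \<Lambda>) powr p * \<omega> v" by (intro mult_left_mono holder) auto
    finally show "0 \<le> (2 * \<Lambda>) powr p * \<omega> v - h v" by simp
  next
    fix v :: node assume v: "length v \<le> n"
    define c where "c = (if S v then \<mu> v else 0)"
    have c: "0 \<le> c" by (simp add: c_def)
    have ec: "e v = c + e (False # v) + e (True # v)" unfolding e_def by (simp add: tsum_rec[OF v] c_def)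
    have "2 * \<Lambda> * \<mu> v = 2 * \<Lambda> * \<mu> (False # v) + 2 * \<Lambda> * \<mu> (True # v)"
      unfolding mu_split[of v, symmetric] by (rule distrib_left)
    then have a: "x (False # v) + x (True # v) = x v + c" unfolding x_def using ec by linarith
    have "(x v + c) powr p / \<sigma> v powr (p - 1) \<le> h (False # v) + h (True # v)"
      using powr_quotient_subadditive[OF p x0 x0 sg_pos sg_pos, of "False # v" "True # v" "False # v" "True # v"]
      unfolding a h_def additiveD[OF sg_add] .
    moreover have "x v powr p + c * \<mu> v powr (p - 1) \<le> (x v + c) powr p"
    proof -
      have "x v powr (p - 1) \<le> (x v + c) powr (p - 1)" "\<mu> v powr (p - 1) \<le> (x v + c) powr (p - 1)"
        using p x0[of v] c x1[of v] Lmu[of v] by (auto intro!: powr_mono2)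
      then have "x v powr (p - 1) * x v + \<mu> v powr (p - 1) * c \<le> (x v + c) powr (p - 1) * x v + (x v + c) powr (p - 1) * c"
        using x0 c by (intro add_mono mult_right_mono) auto
      also have "\<dots> = (x v + c) powr p"
        using powr_p_split[of "x v + c" p] x0[of v] c by (simp add: distrib_left)
      finally show ?thesis using powr_p_split[OF x0, of v p] by (simp add: mult.commute)
    qed
    then have "(x v powr p + c * \<mu> v powr (p - 1)) / \<sigma> v powr (p - 1) \<le> (x v + c) powr p / \<sigma> v powr (p - 1)"
      by (rule divide_right_mono) simp
    moreover have "c * \<mu> v powr (p - 1) / \<sigma> v powr (p - 1) = (if S v then \<mu> v powr p / \<sigma> v powr (p - 1) else 0)"
      using powr_p_split[of "\<mu> v" p] by (simp add: c_def mult.commute)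
    moreover have "(2 * \<Lambda>) powr p * \<omega> (False # v) + (2 * \<Lambda>) powr p * \<omega> (True # v) = (2 * \<Lambda>) powr p * \<omega> v"
      unfolding additiveD[OF X_add, of v, symmetric] by (rule distrib_left[symmetric])
    ultimately show "(if S v then \<mu> v powr p / \<sigma> v powr (p - 1) else 0)
      + ((2 * \<Lambda>) powr p * \<omega> (False # v) - h (False # v)) + ((2 * \<Lambda>) powr p * \<omega> (True # v) - h (True # v))
      \<le> (2 * \<Lambda>) powr p * \<omega> v - h v" unfolding h_def add_divide_distrib by linarith
  qed
  also have "\<dots> \<le> (2 * \<Lambda>) powr p * \<omega> z" by (simp add: h_def)
  finally have *: "tsum n (\<lambda>v. if S v then \<mu> v powr p / \<sigma> v powr (p - 1) else 0) z \<le> (2 * \<Lambda>) powr p * \<omega> z" .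
  have "\<omega> v \<le> A * (\<mu> v powr p / \<sigma> v powr (p - 1))" for v
  proof -
    have "\<omega> v / \<mu> v * (\<sigma> v / \<mu> v) powr (p - 1) = \<omega> v * \<sigma> v powr (p - 1) / (\<mu> v powr (p - 1) * \<mu> v)"
      by (simp add: powr_divide)
    then have "\<omega> v * \<sigma> v powr (p - 1) / \<mu> v powr p \<le> A" using Ap[of v] powr_p_split[of "\<mu> v" p] by simp
    then show ?thesis using mu_pos[of v] sg_pos[of v] by (simp add: field_simps)
  qed
  then have "tsum n (\<lambda>v. if S v then \<omega> v else 0) z
      \<le> (\<Sum>v\<in>below n z. A * (if S v then \<mu> v powr p / \<sigma> v powr (p - 1) else 0))"
    unfolding tsum_def by (intro sum_mono) auto
  also have "\<dots> \<le> A * ((2 * \<Lambda>) powr p * \<omega> z)"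
    using mult_left_mono[OF * A] by (simp add: tsum_def sum_distrib_left)
  finally show ?thesis by (simp add: mult.assoc)
qed

section \<open>The weighted bound on a tree\<close>

text \<open>\<open>pack_const\<close> is the packing constant of the enlarged stopping family, \<open>comp_const\<close> bounds the
  ratio of the measures of two nearby stopping nodes that interact.\<close>

definition pack_const :: "nat \<Rightarrow> real" where "pack_const N = 4 * 2 ^ Suc N * real (Suc (Suc N))"

definition comp_const :: "real \<Rightarrow> nat \<Rightarrow> real" where "comp_const \<beta> N = 2 * \<beta> ^ Suc N * \<beta> ^ Suc N"

definition tree_const :: "real \<Rightarrow> real \<Rightarrow> real \<Rightarrow> nat \<Rightarrow> real" where
  "tree_const \<beta> p q N = haar_form.sparse_const \<beta> (Suc N) * (comp_const \<beta> N)\<^sup>2 *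
    (sparse_pairs.half_const p q (Suc N) (pack_const N) (comp_const \<beta> N)
     + sparse_pairs.half_const q p (Suc N) (pack_const N) (comp_const \<beta> N))"

context sparse_pairs
begin

lemma half_const_nonneg: "0 \<le> half_const"
  unfolding half_const_def using f.K_ge g.K_ge csts M1 by simp

end

lemma sparse_pairs_both:
  fixes \<mu> \<sigma> \<omega> F G X Y :: "node \<Rightarrow> real"
  assumes sp: "sparse_pairs \<mu> \<sigma> F X \<omega> G Y p q S \<Theta> n d A \<Lambda> L c"
    and om_packing: "\<And>z. tsum n (\<lambda>v. if S v then \<omega> v else 0) z \<le> L' * \<omega> z" and L': "0 \<le> L'"
  shows "(\<Sum>(w, u, v)\<in>\<Theta>. F (u @ w) * G (v @ w) / \<mu> (v @ w))
    \<le> c * (sparse_pairs.half_const p q d \<Lambda> c + sparse_pairs.half_const q p d \<Lambda> c) *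
      (A powr (1 / p) * (L powr (1 / p) + L' powr (1 / q)) * (X [] powr (1 / p) * Y [] powr (1 / q)))"
    and "0 \<le> sparse_pairs.half_const p q d \<Lambda> c + sparse_pairs.half_const q p d \<Lambda> c"
proof -
  interpret a: sparse_pairs \<mu> \<sigma> F X \<omega> G Y p q S \<Theta> n d A \<Lambda> L c by fact
  \<comment> \<open>Exchange the two functions; the \<open>A\<^sub>p\<close> relation is raised to the power \<open>q - 1\<close>.\<close>
  let ?sw = "\<lambda>t :: node \<times> node \<times> node. (fst t, snd (snd t), fst (snd t))"
  define \<Theta>' where "\<Theta>' = ?sw ` \<Theta>"
  have p1: "1 < p" by (rule a.p1)
  have pq: "p = q / (q - 1)" "q - 1 = 1 / (p - 1)" "(q - 1) / q = 1 / p"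
    using p1 by (auto simp: a.q_def field_simps)
  interpret b: sparse_pairs \<mu> \<omega> G Y \<sigma> F X q p S \<Theta>' n d "A powr (q - 1)" \<Lambda> L' c
  proof unfold_locales
    show "p = q / (q - 1)" by (rule pq)
    fix w u v assume "(w, u, v) \<in> \<Theta>'"
    then have t: "(w, v, u) \<in> \<Theta>" by (auto simp: \<Theta>'_def)
    note th = a.triples[OF t]
    show "length u \<le> d \<and> length v \<le> d \<and> length (u @ w) \<le> n \<and> length (v @ w) \<le> n"
      "S (u @ w) \<and> S (v @ w)" "\<mu> (u @ w) \<le> c * \<mu> (v @ w) \<and> \<mu> (v @ w) \<le> c * \<mu> (u @ w)"
      using th by auto
    let ?o = "\<omega> (u @ w) / \<mu> (u @ w)" and ?s = "\<sigma> (v @ w) / \<mu> (v @ w)"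
    have "(?o * ?s powr (p - 1)) powr (q - 1) \<le> A powr (q - 1)"
      using th(4) a.q1 by (intro powr_mono2) auto
    then have "?o powr (q - 1) * ?s powr ((p - 1) * (q - 1)) \<le> A powr (q - 1)"
      unfolding powr_mult powr_powr .
    moreover have "(p - 1) * (q - 1) = 1" using p1 by (simp add: pq(2))
    ultimately show "?s * ?o powr (q - 1) \<le> A powr (q - 1)" by (simp add: mult.commute)
  qed (use a.csts L' a.mu_packing om_packing in auto)
  let ?h = "\<lambda>t. F (a.I t) * G (a.J t) / \<mu> (a.J t)" and ?h' = "\<lambda>t. G (b.I t) * F (b.J t) / \<mu> (b.J t)"
  have h0: "0 \<le> ?h t" for t by simp
  have h': "?h t \<le> c * ?h' (?sw t)" if "t \<in> \<Theta>" for t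
  proof -
    have m: "1 / \<mu> (a.J t) \<le> c / \<mu> (a.I t)"
      using a.theta(7)[OF that] a.mu_pos[of "a.I t"] a.mu_pos[of "a.J t"] by (simp add: field_simps)
    have "F (a.I t) * G (a.J t) * (1 / \<mu> (a.J t)) \<le> F (a.I t) * G (a.J t) * (c / \<mu> (a.I t))"
      by (rule mult_left_mono[OF m]) simp
    then show ?thesis by (simp add: left_node_def right_node_def mult_ac)
  qed
  have cover: "t \<in> a.near \<union> a.far \<or> ?sw t \<in> b.near \<union> b.far" if "t \<in> \<Theta>" for t
  proof -
    have "?sw t \<in> \<Theta>'" using that by (auto simp: \<Theta>'_def)
    moreover have "b.J (?sw t) = a.I t" "b.I (?sw t) = a.J t" by (auto simp: left_node_def right_node_def)
    ultimately show ?thesis using that unfolding a.near_def a.far_def b.near_def b.far_def by auto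
  qed
  have fin: "finite a.near" "finite a.far" "finite b.near" "finite b.far"
    using a.finite_theta b.finite_theta by (auto simp: a.near_def a.far_def b.near_def b.far_def)
  have inj: "inj_on ?sw T" for T by (auto simp: inj_on_def prod_eq_iff)
  let ?A = "a.near \<union> a.far" and ?B = "{t \<in> \<Theta>. ?sw t \<in> b.near \<union> b.far}"
  have "(\<Sum>(w, u, v)\<in>\<Theta>. F (u @ w) * G (v @ w) / \<mu> (v @ w)) = (\<Sum>t\<in>\<Theta>. ?h t)"
    by (intro sum.cong) (auto simp: left_node_def right_node_def)
  also have "\<dots> \<le> (\<Sum>t\<in>?A \<union> ?B. ?h t)"
    using cover fin a.finite_theta by (intro sum_mono2) (auto simp: a.near_def a.far_def)
  also have "\<dots> \<le> (\<Sum>t\<in>?A. ?h t) + (\<Sum>t\<in>?B. ?h t)"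
    using fin a.finite_theta h0 by (subst sum.union_inter[symmetric]) (auto intro!: sum_nonneg)
  also have "(\<Sum>t\<in>?A. ?h t) \<le> (\<Sum>t\<in>a.near. ?h t) + (\<Sum>t\<in>a.far. ?h t)"
    using fin h0 by (subst sum.union_inter[symmetric]) (auto intro!: sum_nonneg)
  also have "\<dots> \<le> a.half_const * (A powr (1 / p) * L powr (1 / p) * X [] powr (1 / p) * Y [] powr (1 / q))"
    by (rule a.half_bound)
  also have "(\<Sum>t\<in>?B. ?h t) \<le> (\<Sum>t\<in>?B. c * ?h' (?sw t))" by (rule sum_mono) (use h' in auto)
  also have "\<dots> = c * (\<Sum>t\<in>?sw ` ?B. ?h' t)"
    by (simp add: sum.reindex[OF inj] sum_distrib_left)
  also have "\<dots> \<le> c * (\<Sum>t\<in>b.near \<union> b.far. ?h' t)"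
    using fin a.csts by (intro mult_left_mono sum_mono2) auto
  also have "\<dots> \<le> c * ((\<Sum>t\<in>b.near. ?h' t) + (\<Sum>t\<in>b.far. ?h' t))"
    using fin a.csts by (intro mult_left_mono, subst sum.union_inter[symmetric]) (auto intro!: sum_nonneg)
  also have "\<dots> \<le> c * (b.half_const * ((A powr (q - 1)) powr (1 / q) * L' powr (1 / q) * Y [] powr (1 / q) * X [] powr (1 / p)))"
    using a.csts by (intro mult_left_mono b.half_bound) auto
  also have "(A powr (q - 1)) powr (1 / q) = A powr (1 / p)" using pq(3) by (simp add: powr_powr)
  finally have le: "(\<Sum>(w, u, v)\<in>\<Theta>. F (u @ w) * G (v @ w) / \<mu> (v @ w))
    \<le> a.half_const * (A powr (1 / p) * L powr (1 / p) * X [] powr (1 / p) * Y [] powr (1 / q))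
      + c * (b.half_const * (A powr (1 / p) * L' powr (1 / q) * Y [] powr (1 / q) * X [] powr (1 / p)))" by simp
  define R where "R = A powr (1 / p) * (X [] powr (1 / p) * Y [] powr (1 / q))"
  have R: "0 \<le> R" by (simp add: R_def)
  have "a.half_const * (L powr (1 / p) * R) \<le> c * (a.half_const + b.half_const) * (L powr (1 / p) * R)"
  proof (rule mult_right_mono)
    have "1 * a.half_const \<le> c * (a.half_const + b.half_const)"
      using a.csts a.half_const_nonneg b.half_const_nonneg by (intro mult_mono) auto
    then show "a.half_const \<le> c * (a.half_const + b.half_const)" by simp
  qed (use R in simp)
  moreover have "c * (b.half_const * (L' powr (1 / q) * R)) \<le> c * (a.half_const + b.half_const) * (L' powr (1 / q) * R)"
    unfolding mult.assoc[symmetric, of c] using a.csts a.half_const_nonneg R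
    by (intro mult_right_mono mult_left_mono) auto
  ultimately have "a.half_const * (L powr (1 / p) * R) + c * (b.half_const * (L' powr (1 / q) * R))
    \<le> c * (a.half_const + b.half_const) * ((L powr (1 / p) + L' powr (1 / q)) * R)"
    by (simp add: distrib_left distrib_right)
  with le show "(\<Sum>(w, u, v)\<in>\<Theta>. F (u @ w) * G (v @ w) / \<mu> (v @ w))
    \<le> c * (a.half_const + b.half_const) *
      (A powr (1 / p) * (L powr (1 / p) + L' powr (1 / q)) * (X [] powr (1 / p) * Y [] powr (1 / q)))"
    by (simp add: R_def mult_ac)
  show "0 \<le> a.half_const + b.half_const" using a.half_const_nonneg b.half_const_nonneg by simp
qed

text \<open>For the interacting pairs, measures and \<open>m\<close> are comparable, so that the mixed condition between
  two nearby nodes reduces to an \<open>A\<^sub>p\<close> relation between the averages of the weights over these two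
  nodes. The last two hypotheses ask that families packed for \<open>\<mu>\<close> be packed for the weights.\<close>

theorem tree_bound:
  fixes \<mu> \<sigma> \<omega> F G X Y :: "node \<Rightarrow> real" and f g :: "node \<Rightarrow> complex"
  assumes hf: "haar_form \<mu> \<beta> F G f g"
    and wf: "weighted_avg p \<sigma> F X" and wg: "weighted_avg q \<omega> G Y" and q: "q = p / (p - 1)"
    and A: "0 \<le> A" and L: "0 \<le> L" "0 \<le> L'" and kl: "k + l \<le> N"
    and Ap1: "\<And>w. \<omega> w / \<mu> w * (\<sigma> w / \<mu> w) powr (p - 1) \<le> A"
    and Ap2: "\<And>w u v. length u + length v \<le> N + 2 \<Longrightarrow> u @ w \<noteq> v @ w \<Longrightarrow>
      m_node \<mu> (v @ w) powr (p / 2) * m_node \<mu> (u @ w) powr (p / 2) / (\<mu> (u @ w) * \<mu> (v @ w) powr (p - 1)) *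
        (\<omega> (v @ w) / \<mu> (v @ w)) * (\<sigma> (u @ w) / \<mu> (u @ w)) powr (p - 1) \<le> A"
    and packing: "\<And>S n z. (\<And>z. tsum n (\<lambda>v. if S v then \<mu> v else 0) z \<le> pack_const N * \<mu> z) \<Longrightarrow>
      tsum n (\<lambda>v. if S v then \<sigma> v else 0) z \<le> L * \<sigma> z"
      "\<And>S n z. (\<And>z. tsum n (\<lambda>v. if S v then \<mu> v else 0) z \<le> pack_const N * \<mu> z) \<Longrightarrow>
      tsum n (\<lambda>v. if S v then \<omega> v else 0) z \<le> L' * \<omega> z"
  shows "(\<Sum>w\<in>below n []. (\<Sum>u | length u = k. haar_coeff \<mu> f (u @ w)) * (\<Sum>v | length v = l. haar_coeff \<mu> g (v @ w)))
    \<le> tree_const \<beta> p q N * (A powr (1 / p) * (L powr (1 / p) + L' powr (1 / q)) * (X [] powr (1 / p) * Y [] powr (1 / q)))"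
proof -
  interpret haar_form \<mu> \<beta> F G f g by fact
  interpret wf: weighted_avg p \<sigma> F X by fact
  interpret wg: weighted_avg q \<omega> G Y by fact
  let ?d = "Suc N" and ?c = "comp_const \<beta> N"
  have d: "Suc k \<le> ?d" "Suc l \<le> ?d" using kl by auto
  have bd: "1 \<le> \<beta> ^ ?d" by (rule beta_pow)
  have c1: "1 \<le> ?c"
  proof -
    have "1 * 1 \<le> (2 * \<beta> ^ ?d) * \<beta> ^ ?d" using bd by (intro mult_mono) auto
    then show ?thesis by (simp add: comp_const_def)
  qed
  \<comment> \<open>A diagonal term at \<open>w\<close> is treated as the interaction of \<open>w\<close> with itself.\<close>
  define D :: "(node \<times> node \<times> node) set" where "D = (\<lambda>w. (w, [], [])) ` {w \<in> below n []. near_stop ?d w}"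
  define P where "P = small_pairs n k l ?d"
  have finP: "finite P"
  proof (rule finite_subset)
    show "P \<subseteq> below n [] \<times> ulist k \<times> ulist l" by (auto simp: P_def small_pairs_def)
  qed auto
  have finD: "finite D" by (simp add: D_def)
  have disj: "D \<inter> P = {}" by (auto simp: D_def P_def small_pairs_def ulist_def)
  have pair: "\<mu> (u @ w) \<le> ?c * \<mu> (v @ w) \<and> \<mu> (v @ w) \<le> ?c * \<mu> (u @ w)"
     "\<omega> (v @ w) / \<mu> (v @ w) * (\<sigma> (u @ w) / \<mu> (u @ w)) powr (p - 1) \<le> ?c powr p * A"
    if t: "(w, u, v) \<in> P" for w u v
  proof -
    have ul: "u \<noteq> []" "v \<noteq> []" "length u \<le> ?d" "length v \<le> ?d" "length u + length v \<le> N + 2"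
      and mu: "\<mu> (u @ w) \<le> 2 * \<beta> ^ ?d * m_node \<mu> w" and mv: "\<mu> (v @ w) \<le> 2 * \<beta> ^ ?d * m_node \<mu> w"
      using t d kl by (auto simp: P_def small_pairs_def ulist_def)
    have pw: "\<beta> ^ length x \<le> \<beta> ^ ?d" if "length x \<le> ?d" for x :: node
      using that beta by (intro power_increasing)
    have dn: "m_node \<mu> w \<le> \<beta> ^ ?d * \<mu> (x @ w)" if "x \<noteq> []" "length x \<le> ?d" for x
      using m_node_le_descendant[OF that(1), of w] mult_right_mono[OF pw[OF that(2)], of "\<mu> (x @ w)"] by simp
    have dm: "m_node \<mu> w \<le> \<beta> ^ ?d * m_node \<mu> (x @ w)" if "length x \<le> ?d" for x
      using m_node_descendant(2)[of w x] mult_right_mono[OF pw[OF that], of "m_node \<mu> (x @ w)"] by simp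
    have cmp: "2 * \<beta> ^ ?d * m_node \<mu> w \<le> ?c * \<mu> (x @ w)" if "x \<noteq> []" "length x \<le> ?d" for x
      using mult_left_mono[OF dn[OF that], of "2 * \<beta> ^ ?d"] bd by (simp only: comp_const_def mult.assoc)
    show "\<mu> (u @ w) \<le> ?c * \<mu> (v @ w) \<and> \<mu> (v @ w) \<le> ?c * \<mu> (u @ w)"
      using order_trans[OF mu cmp[OF ul(2,4)]] order_trans[OF mv cmp[OF ul(1,3)]] by simp
    let ?r = "\<omega> (v @ w) / \<mu> (v @ w) * (\<sigma> (u @ w) / \<mu> (u @ w)) powr (p - 1)"
    have r0: "0 \<le> ?r" by simp
    show "?r \<le> ?c powr p * A"
    proof (cases "u = v")
      case True
      have "1 \<le> ?c powr p" using c1 wf.p by (intro ge_one_powr_ge_zero) auto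
      then have "1 * A \<le> ?c powr p * A" using A by (rule mult_right_mono)
      then show ?thesis using Ap1[of "v @ w"] True by simp
    next
      case False
      have big: "\<mu> (y @ w) \<le> ?c * m_node \<mu> (x @ w)" if "\<mu> (y @ w) \<le> 2 * \<beta> ^ ?d * m_node \<mu> w" "length x \<le> ?d" for x y
        using order_trans[OF that(1) mult_left_mono[OF dm[OF that(2)], of "2 * \<beta> ^ ?d"]] bd
        by (simp only: comp_const_def mult.assoc)
      define a b where "a = ?c * m_node \<mu> (u @ w)" and "b = ?c * m_node \<mu> (v @ w)"
      have ab: "\<mu> (u @ w) \<le> a" "\<mu> (v @ w) \<le> a" "\<mu> (u @ w) \<le> b" "\<mu> (v @ w) \<le> b"
        unfolding a_def b_def using mu mv ul by (auto intro!: big)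
      \<comment> \<open>Both measures are at most a constant times the value of \<open>m_node\<close> at either node; so the coefficient in the mixed condition is bounded below.\<close>
      define m where "m = min a b"
      have m0: "0 < m" using ab mu_pos[of "u @ w"] by (auto simp: m_def)
      have "\<mu> (u @ w) * \<mu> (v @ w) powr (p - 1) \<le> m * m powr (p - 1)"
        using ab wf.p m0 by (intro mult_mono powr_mono2) (auto simp: m_def)
      also have "\<dots> = m powr (p / 2) * m powr (p / 2)"
        using m0 powr_p_split[of m p] by (simp add: mult.commute powr_add[symmetric])
      also have "\<dots> \<le> b powr (p / 2) * a powr (p / 2)"
        using m0 wf.p by (intro mult_mono powr_mono2) (auto simp: m_def)
      also have "\<dots> = ?c powr p * (m_node \<mu> (v @ w) powr (p / 2) * m_node \<mu> (u @ w) powr (p / 2))"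
        using c1 by (simp add: a_def b_def powr_mult powr_add[symmetric])
      finally have "1 \<le> ?c powr p * (m_node \<mu> (v @ w) powr (p / 2) * m_node \<mu> (u @ w) powr (p / 2)
        / (\<mu> (u @ w) * \<mu> (v @ w) powr (p - 1)))"
        using mu_pos[of "u @ w"] mu_pos[of "v @ w"] by (simp add: field_simps)
      then have "1 * ?r \<le> ?c powr p * (m_node \<mu> (v @ w) powr (p / 2) * m_node \<mu> (u @ w) powr (p / 2)
        / (\<mu> (u @ w) * \<mu> (v @ w) powr (p - 1))) * ?r" using r0 by (rule mult_right_mono)
      also have "\<dots> \<le> ?c powr p * A"
        using mult_left_mono[OF Ap2[OF ul(5)], of w "?c powr p"] False by (simp add: mult.assoc)
      finally show ?thesis by simp
    qed
  qed
  have pk: "tsum m (\<lambda>v. if near_stop ?d v then \<mu> v else 0) z \<le> pack_const N * \<mu> z" for m z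
    using near_stop_carleson[of m ?d z] by (simp only: pack_const_def)
  have sp: "sparse_pairs \<mu> \<sigma> F X \<omega> G Y p q (near_stop ?d) (D \<union> P) (n + ?d) ?d (?c powr p * A) (pack_const N) L ?c"
  proof unfold_locales
    have "(1::real) \<le> 2 ^ N" by simp
    then have "1 \<le> 4 * (2::real) ^ Suc N" unfolding power_Suc by linarith
    then have "1 * 1 \<le> 4 * 2 ^ Suc N * real (Suc (Suc N))" by (intro mult_mono) auto
    then show "1 \<le> pack_const N" by (simp add: pack_const_def)
    show "tsum (n + ?d) (\<lambda>v. if near_stop ?d v then \<sigma> v else 0) z \<le> L * \<sigma> z" for z
      by (rule packing(1)[OF pk])
    fix w u v assume t: "(w, u, v) \<in> D \<union> P"
    show "length u \<le> ?d \<and> length v \<le> ?d \<and> length (u @ w) \<le> n + ?d \<and> length (v @ w) \<le> n + ?d"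
      using t d by (auto simp: D_def P_def small_pairs_def ulist_def below_Nil)
    show "near_stop ?d (u @ w) \<and> near_stop ?d (v @ w)"
      using t near_stop_self by (auto simp: D_def P_def small_pairs_def)
    show "\<mu> (u @ w) \<le> ?c * \<mu> (v @ w) \<and> \<mu> (v @ w) \<le> ?c * \<mu> (u @ w)"
      using t
    proof
      assume "(w, u, v) \<in> D" then show ?thesis using mult_right_mono[OF c1, of "\<mu> w"] by (auto simp: D_def)
    qed (rule pair(1))
    show "\<omega> (v @ w) / \<mu> (v @ w) * (\<sigma> (u @ w) / \<mu> (u @ w)) powr (p - 1) \<le> ?c powr p * A"
      using t
    proof
      assume "(w, u, v) \<in> D"
      then have e: "u = []" "v = []" by (auto simp: D_def)
      have "1 \<le> ?c powr p" using c1 wf.p by (intro ge_one_powr_ge_zero) auto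
      then have "1 * A \<le> ?c powr p * A" using A by (rule mult_right_mono)
      then show ?thesis using Ap1[of w] e by simp
    qed (rule pair(2))
  qed (use q A L c1 pk in auto)
  note both = sparse_pairs_both[OF sp packing(2)[OF pk] L(2)]
  have sc: "0 \<le> sparse_const ?d" using bd by (simp add: sparse_const_def)
  have "(\<Sum>w\<in>below n []. (\<Sum>u | length u = k. hc (u @ w)) * (\<Sum>v | length v = l. swap.hc (v @ w)))
    \<le> sparse_const ?d * ((\<Sum>w\<in>below n []. if near_stop ?d w then F w * G w / \<mu> w else 0)
      + (\<Sum>(w, u, v)\<in>P. F (u @ w) * G (v @ w) / \<mu> (v @ w)))"
    unfolding P_def by (rule haar_form_le[OF d])
  also have "(\<Sum>w\<in>below n []. if near_stop ?d w then F w * G w / \<mu> w else 0)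
    = (\<Sum>(w, u, v)\<in>D. F (u @ w) * G (v @ w) / \<mu> (v @ w))"
    unfolding D_def by (subst sum.reindex) (auto simp: inj_on_def sum.inter_filter)
  also have "(\<Sum>(w, u, v)\<in>D. F (u @ w) * G (v @ w) / \<mu> (v @ w)) + (\<Sum>(w, u, v)\<in>P. F (u @ w) * G (v @ w) / \<mu> (v @ w))
    = (\<Sum>(w, u, v)\<in>D \<union> P. F (u @ w) * G (v @ w) / \<mu> (v @ w))"
    by (rule sum.union_disjoint[OF finD finP disj, symmetric])
  also have "sparse_const ?d * \<dots> \<le> sparse_const ?d * (?c *
      (sparse_pairs.half_const p q ?d (pack_const N) ?c + sparse_pairs.half_const q p ?d (pack_const N) ?c) *
      ((?c powr p * A) powr (1 / p) * (L powr (1 / p) + L' powr (1 / q)) * (X [] powr (1 / p) * Y [] powr (1 / q))))"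
    by (rule mult_left_mono[OF both(1) sc])
  also have "(?c powr p * A) powr (1 / p) = ?c * A powr (1 / p)"
    using c1 wf.p by (simp add: powr_mult powr_powr)
  finally show ?thesis by (simp add: tree_const_def power2_eq_square mult_ac)
qed

section \<open>Dyadic lattices as binary trees\<close>

primrec node_ivl :: "real set \<Rightarrow> node \<Rightarrow> real set" where
  "node_ivl Q [] = Q"
| "node_ivl Q (b # w) = (if b then right_half (node_ivl Q w) else left_half (node_ivl Q w))"

definition is_ivl :: "real set \<Rightarrow> bool" where
  "is_ivl I \<longleftrightarrow> (\<exists>a b. a < b \<and> I = {a..<b})"

lemma halves:
  assumes "a < b"
  shows "left_half {a..<b} = {a..<(a + b) / 2}" "right_half {a..<b} = {(a + b) / 2..<b}"
  using assms by (auto simp: left_half_def right_half_def)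

lemma is_ivlI: "a < b \<Longrightarrow> is_ivl {a..<b}"
  by (auto simp: is_ivl_def)

lemma ivl_halves:
  assumes "is_ivl I"
  shows "is_ivl (left_half I)" "is_ivl (right_half I)" "left_half I \<union> right_half I = I"
    "left_half I \<inter> right_half I = {}"
proof -
  obtain a b where "a < b" and I: "I = {a..<b}" using assms by (auto simp: is_ivl_def)
  then have *: "a < (a + b) / 2" "(a + b) / 2 < b" by auto
  show "is_ivl (left_half I)" "is_ivl (right_half I)" "left_half I \<union> right_half I = I"
    "left_half I \<inter> right_half I = {}"
    unfolding I halves[OF \<open>a < b\<close>] using * by (auto intro!: is_ivlI)
qed

lemma node_ivl_append: "node_ivl (node_ivl Q w) u = node_ivl Q (u @ w)"
  by (induction u) auto

lemma node_ivl_is_ivl: "is_ivl Q \<Longrightarrow> is_ivl (node_ivl Q w)"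
  by (induction w) (auto simp: ivl_halves)

lemma node_ivl_children:
  assumes "is_ivl Q"
  shows "node_ivl Q (False # w) \<union> node_ivl Q (True # w) = node_ivl Q w"
    "node_ivl Q (False # w) \<inter> node_ivl Q (True # w) = {}"
  using ivl_halves[OF node_ivl_is_ivl[OF assms]] by auto

lemma node_ivl_child_subset: "is_ivl Q \<Longrightarrow> node_ivl Q (b # w) \<subseteq> node_ivl Q w"
  using node_ivl_children(1)[of Q w] by (cases b) auto

lemma node_ivl_subset: "is_ivl Q \<Longrightarrow> node_ivl Q (u @ w) \<subseteq> node_ivl Q w"
proof (induction u)
  case (Cons b u)
  then show ?case using node_ivl_child_subset[of Q b "u @ w"] by (simp only: append_Cons) blast
qed simp

lemma node_ivl_nonempty: "is_ivl Q \<Longrightarrow> node_ivl Q w \<noteq> {}"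
  using node_ivl_is_ivl[of Q w] by (auto simp: is_ivl_def)

lemma node_ivl_disjoint:
  assumes "is_ivl Q" "length u = length v" "u \<noteq> v"
  shows "node_ivl Q u \<inter> node_ivl Q v = {}"
  using assms(2,3)
proof (induction u v rule: list_induct2)
  case (Cons b u c v)
  show ?case
  proof (cases "u = v")
    case True
    then show ?thesis using Cons node_ivl_children(2)[OF assms(1), of v]
      by (cases b; cases c) (auto simp: Int_commute)
  next
    case False
    then show ?thesis using Cons.IH node_ivl_child_subset[OF assms(1), of b u]
        node_ivl_child_subset[OF assms(1), of c v] by blast
  qed
qed simp

lemma node_ivl_length: "is_ivl Q \<Longrightarrow>
  Sup (node_ivl Q w) - Inf (node_ivl Q w) = (Sup Q - Inf Q) / 2 ^ length w"
proof (induction w)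
  case (Cons b w)
  obtain x y where xy: "x < y" and I: "node_ivl Q w = {x..<y}"
    using node_ivl_is_ivl[OF Cons(2), of w] by (auto simp: is_ivl_def)
  have "x < (x + y) / 2" "(x + y) / 2 < y" using xy by auto
  then have "Sup (node_ivl Q (b # w)) - Inf (node_ivl Q (b # w)) = (y - x) / 2"
    by (auto simp: I halves[OF xy] field_simps)
  also have "y - x = (Sup Q - Inf Q) / 2 ^ length w" using Cons xy by (simp add: I)
  finally show ?case by simp
qed simp

text \<open>An interval of the tree determines its generation by its length, and intervals of one generation
  are disjoint.\<close>

lemma node_ivl_inj:
  assumes Q: "is_ivl Q" and eq: "node_ivl Q u = node_ivl Q v"
  shows "u = v"
proof -
  define l where "l = Sup Q - Inf Q"
  have "0 < l" using Q by (auto simp: is_ivl_def l_def)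
  moreover have "l / 2 ^ length u = l / 2 ^ length v"
    unfolding l_def node_ivl_length[OF Q, symmetric] eq ..
  ultimately have "(2::real) ^ length u = 2 ^ length v" by (simp add: field_simps)
  then have "length u = length v" by simp
  then show ?thesis using node_ivl_disjoint[OF Q, of u v] node_ivl_nonempty[OF Q, of u] eq by auto
qed

lemma child_iff_node_ivl: "dyadic_child I J \<longleftrightarrow> (\<exists>b. I = node_ivl J [b])"
proof -
  have "(\<exists>b. I = node_ivl J [b]) \<longleftrightarrow> I = node_ivl J [False] \<or> I = node_ivl J [True]"
    by (metis (full_types))
  then show ?thesis by (simp add: dyadic_child_def)
qed

lemma rtranclp_child_node_ivl: "dyadic_child\<^sup>*\<^sup>* I J \<Longrightarrow> \<exists>u. I = node_ivl J u"
proof (induction rule: rtranclp_induct)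
  case base
  have "I = node_ivl I []" by simp
  then show ?case by blast
next
  case (step J K)
  then obtain u b where "I = node_ivl J u" "J = node_ivl K [b]" by (auto simp: child_iff_node_ivl)
  then have "I = node_ivl K (u @ [b])" by (simp only: node_ivl_append)
  then show ?case by blast
qed

locale lattice_tree =
  fixes D :: "real set set"
  assumes lattice: "dyadic_lattice D"
begin

lemma D_ivl: "I \<in> D \<Longrightarrow> is_ivl I"
  using lattice by (auto simp: dyadic_lattice_def is_ivl_def)

lemma D_node_ivl: "Q \<in> D \<Longrightarrow> node_ivl Q w \<in> D"
  using lattice by (induction w) (auto simp: dyadic_lattice_def)

lemma common_ancestor:
  assumes "I \<in> D" "J \<in> D"
  obtains K u v where "K \<in> D" "I = node_ivl K u" "J = node_ivl K v"
proof -
  obtain K where "K \<in> D" "dyadic_child\<^sup>*\<^sup>* I K" "dyadic_child\<^sup>*\<^sup>* J K"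
    using lattice assms unfolding dyadic_lattice_def by blast
  then show ?thesis using rtranclp_child_node_ivl[of I K] rtranclp_child_node_ivl[of J K] that by blast
qed

lemma parent_node_ivl:
  assumes "Q \<in> D" shows "dyadic_parent D (node_ivl Q (b # w)) = node_ivl Q w"
  unfolding dyadic_parent_def
proof (rule the_equality)
  show "node_ivl Q w \<in> D \<and> dyadic_child (node_ivl Q (b # w)) (node_ivl Q w)"
    using D_node_ivl[OF assms] by (auto simp: dyadic_child_def)
  fix J assume J: "J \<in> D \<and> dyadic_child (node_ivl Q (b # w)) J"
  then obtain c where c: "node_ivl Q (b # w) = node_ivl J [c]" by (auto simp: child_iff_node_ivl)
  obtain K u v where K: "K \<in> D" "J = node_ivl K u" "node_ivl Q w = node_ivl K v"
    using common_ancestor[of J "node_ivl Q w"] J D_node_ivl[OF assms] by blast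
  have "node_ivl K ([c] @ u) = node_ivl (node_ivl Q w) [b]"
    using c unfolding K(2) node_ivl_append by simp
  also have "\<dots> = node_ivl K ([b] @ v)" by (simp only: K(3) node_ivl_append)
  finally have "node_ivl K (c # u) = node_ivl K (b # v)" by simp
  then have "u = v" using node_ivl_inj[OF D_ivl[OF K(1)]] by blast
  then show "J = node_ivl Q w" using K by simp
qed

lemma ancestor_node_ivl:
  assumes "Q \<in> D" shows "dyadic_ancestor D (length u) (node_ivl Q (u @ w)) = node_ivl Q w"
proof (induction u)
  case (Cons b u)
  have "dyadic_ancestor D (length (b # u)) (node_ivl Q ((b # u) @ w))
    = (dyadic_parent D ^^ length u) (dyadic_parent D (node_ivl Q (b # (u @ w))))"
    unfolding dyadic_ancestor_def by (simp add: funpow_swap1 del: node_ivl.simps)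
  then show ?case using Cons by (simp add: parent_node_ivl[OF assms] dyadic_ancestor_def del: node_ivl.simps)
qed (simp add: dyadic_ancestor_def)

text \<open>Some member of the lattice contains the closure of \<open>I\<close>, hence is not contained in \<open>I\<close>; on the
  path to a common ancestor there is the parent.\<close>

lemma has_parent:
  assumes "I \<in> D" obtains Q b where "Q \<in> D" "I = node_ivl Q [b]"
proof -
  obtain x y where xy: "x < y" "I = {x..<y}" using D_ivl[OF assms] by (auto simp: is_ivl_def)
  obtain J where J: "J \<in> D" "{x..y} \<subseteq> J"
    using lattice compact_Icc[of x y] unfolding dyadic_lattice_def by blast
  obtain K u v where K: "K \<in> D" "I = node_ivl K u" "J = node_ivl K v" using common_ancestor[OF assms J(1)] .
  have "y \<in> J" "y \<notin> I" using J xy by auto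
  have "u \<noteq> []"
  proof
    assume "u = []"
    then have "J \<subseteq> I" using K node_ivl_subset[OF D_ivl[OF K(1)], of v "[]"] by simp
    then show False using \<open>y \<in> J\<close> \<open>y \<notin> I\<close> by auto
  qed
  then obtain b u' where "u = b # u'" by (cases u) auto
  then have "I = node_ivl (node_ivl K u') [b]" using K by simp
  then show ?thesis using that D_node_ivl[OF K(1)] by blast
qed

lemma ancestor_eq_imp_node_ivl:
  "J \<in> D \<Longrightarrow> dyadic_ancestor D s J = I \<Longrightarrow> \<exists>u. length u = s \<and> J = node_ivl I u"
proof (induction s arbitrary: J)
  case 0 then show ?case by (auto simp: dyadic_ancestor_def)
next
  case (Suc s)
  obtain Q b where Q: "Q \<in> D" "J = node_ivl Q [b]" using has_parent[OF Suc.prems(1)] .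
  have "dyadic_ancestor D (Suc s) J = dyadic_ancestor D s (dyadic_parent D J)"
    by (simp add: dyadic_ancestor_def funpow_swap1)
  then have "dyadic_ancestor D s Q = I" using Suc.prems Q parent_node_ivl[OF Q(1), of b "[]"] by simp
  then obtain u where "length u = s" "Q = node_ivl I u" using Suc.IH Q by blast
  then have "length (b # u) = Suc s \<and> J = node_ivl I (b # u)" using Q by simp
  then show ?case by blast
qed

lemma descendants_node_ivl:
  assumes Q: "Q \<in> D"
  shows "dyadic_descendants D s (node_ivl Q w) = (\<lambda>u. node_ivl Q (u @ w)) ` {u. length u = s}"
proof (intro equalityI subsetI)
  fix J assume "J \<in> dyadic_descendants D s (node_ivl Q w)"
  then obtain u where "length u = s" "J = node_ivl (node_ivl Q w) u"
    using ancestor_eq_imp_node_ivl[of J s "node_ivl Q w"] by (auto simp: dyadic_descendants_def)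
  then show "J \<in> (\<lambda>u. node_ivl Q (u @ w)) ` {u. length u = s}" by (auto simp: node_ivl_append)
next
  fix J assume "J \<in> (\<lambda>u. node_ivl Q (u @ w)) ` {u. length u = s}"
  then obtain u where u: "length u = s" "J = node_ivl Q (u @ w)" by auto
  then show "J \<in> dyadic_descendants D s (node_ivl Q w)"
    using D_node_ivl[OF Q] node_ivl_subset[OF D_ivl[OF Q]] ancestor_node_ivl[OF Q, of u w]
    by (auto simp: dyadic_descendants_def)
qed

lemma inj_node_ivl_append:
  assumes "Q \<in> D" shows "inj_on (\<lambda>u. node_ivl Q (u @ w)) U"
proof (rule inj_onI)
  fix u v assume "node_ivl Q (u @ w) = node_ivl Q (v @ w)"
  from node_ivl_inj[OF D_ivl[OF assms] this] show "u = v" by simp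
qed

lemma dist_node_ivl:
  assumes "Q \<in> D"
  shows "dyadic_dist D (node_ivl Q (u @ w)) (node_ivl Q (v @ w)) \<le> length u + length v"
  unfolding dyadic_dist_def
proof (rule Least_le)
  have "dyadic_ancestor D (length u) (node_ivl Q (u @ w)) = dyadic_ancestor D (length v) (node_ivl Q (v @ w))"
    using ancestor_node_ivl[OF assms] by simp
  then show "\<exists>r t. length u + length v = r + t \<and>
      dyadic_ancestor D r (node_ivl Q (u @ w)) = dyadic_ancestor D t (node_ivl Q (v @ w))" by blast
qed

lemma D_nonempty: "D \<noteq> {}"
  using lattice compact_empty unfolding dyadic_lattice_def by blast

lemma common_root:
  assumes "finite \<F>" "\<F> \<subseteq> D"
  shows "\<exists>Q\<in>D. \<forall>I\<in>\<F>. \<exists>w. I = node_ivl Q w"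
  using assms
proof (induction \<F>)
  case empty then show ?case using D_nonempty by auto
next
  case (insert I \<F>)
  then obtain Q where Q: "Q \<in> D" "\<forall>I\<in>\<F>. \<exists>w. I = node_ivl Q w" by auto
  obtain K u v where K: "K \<in> D" "I = node_ivl K u" "Q = node_ivl K v"
    using common_ancestor[of I Q] insert Q by auto
  have "\<exists>w. J = node_ivl K w" if "J \<in> \<F>" for J
    using Q(2) that K(3) node_ivl_append by metis
  then show ?case using K by auto
qed

lemma balanced_node:
  assumes "balanced_with \<beta> D \<mu>" "Q \<in> D"
  shows "m_meas \<mu> (node_ivl Q (b # w)) \<le> \<beta> * m_meas \<mu> (node_ivl Q w)"
    "m_meas \<mu> (node_ivl Q w) \<le> \<beta> * m_meas \<mu> (node_ivl Q (b # w))" "1 \<le> \<beta>"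
proof -
  have *: "1 \<le> \<beta>" "m_meas \<mu> (dyadic_parent D (node_ivl Q (b # w))) / \<beta> \<le> m_meas \<mu> (node_ivl Q (b # w))"
    "m_meas \<mu> (node_ivl Q (b # w)) \<le> \<beta> * m_meas \<mu> (dyadic_parent D (node_ivl Q (b # w)))"
    using assms D_node_ivl[OF assms(2)] unfolding balanced_with_def by blast+
  show "m_meas \<mu> (node_ivl Q (b # w)) \<le> \<beta> * m_meas \<mu> (node_ivl Q w)"
    "m_meas \<mu> (node_ivl Q w) \<le> \<beta> * m_meas \<mu> (node_ivl Q (b # w))" "1 \<le> \<beta>"
    using * unfolding parent_node_ivl[OF assms(2)] by (auto simp: field_simps)
qed

lemma m_meas_nonneg: "0 \<le> m_meas \<mu> I" by (simp add: m_meas_def)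

text \<open>Balance compares \<open>m\<close> at an interval and at its parent, and any two intervals are connected by a
  path through a common ancestor.\<close>

lemma m_meas_zero_iff:
  assumes bal: "balanced_with \<beta> D \<mu>" and I: "I \<in> D" and J: "J \<in> D"
  shows "m_meas \<mu> I = 0 \<longleftrightarrow> m_meas \<mu> J = 0"
proof -
  obtain K u v where K: "K \<in> D" "I = node_ivl K u" "J = node_ivl K v" using common_ancestor[OF I J] .
  have "m_meas \<mu> (node_ivl K w) = 0 \<longleftrightarrow> m_meas \<mu> K = 0" for w
  proof (induction w)
    case (Cons b w)
    note B = balanced_node(1,2)[OF bal K(1), where b = b and w = w]
    have "m_meas \<mu> (node_ivl K (b # w)) = 0 \<longleftrightarrow> m_meas \<mu> (node_ivl K w) = 0"
    proof
      assume z: "m_meas \<mu> (node_ivl K (b # w)) = 0"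
      from B(2) have "m_meas \<mu> (node_ivl K w) \<le> 0" unfolding z by simp
      then show "m_meas \<mu> (node_ivl K w) = 0" using m_meas_nonneg[of \<mu> "node_ivl K w"] by linarith
    next
      assume z: "m_meas \<mu> (node_ivl K w) = 0"
      from B(1) have "m_meas \<mu> (node_ivl K (b # w)) \<le> 0" unfolding z by simp
      then show "m_meas \<mu> (node_ivl K (b # w)) = 0" using m_meas_nonneg[of \<mu> "node_ivl K (b # w)"] by linarith
    qed
    then show ?case using Cons by blast
  qed simp
  then show ?thesis using K by blast
qed

end

section \<open>Integrals over the intervals of a tree\<close>

lemma locally_finite_compact:
  assumes lf: "locally_finite_borel \<mu>" and K: "compact K"
  shows "emeasure \<mu> K < \<infinity>"
proof -
  have "\<forall>x. \<exists>U. open U \<and> x \<in> U \<and> emeasure \<mu> U < \<infinity>" using lf by (simp add: locally_finite_borel_def)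
  then obtain U where U: "\<And>x. open (U x)" "\<And>x. x \<in> U x" "\<And>x. emeasure \<mu> (U x) < \<infinity>" by metis
  obtain T where T: "finite T" "T \<subseteq> K" "K \<subseteq> (\<Union>x\<in>T. U x)"
  proof (rule compactE_image[OF K, of K U])
    show "K \<subseteq> (\<Union>c\<in>K. U c)" using U(2) by blast
  qed (use U(1) in auto)
  have s: "sets \<mu> = sets borel" using lf by (simp add: locally_finite_borel_def)
  have "emeasure \<mu> K \<le> emeasure \<mu> (\<Union>x\<in>T. U x)"
    using T U s by (intro emeasure_mono) auto
  also have "\<dots> \<le> (\<Sum>x\<in>T. emeasure \<mu> (U x))"
    using T U s by (intro emeasure_subadditive_finite) auto
  also have "\<dots> < \<infinity>" using T U by simp
  finally show ?thesis .
qed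

locale meas_tree = lattice_tree D for D +
  fixes \<mu> :: "real measure" and Q :: "real set"
  assumes lf: "locally_finite_borel \<mu>" and Q: "Q \<in> D" and pos: "\<And>I. I \<in> D \<Longrightarrow> 0 < measure \<mu> I"
begin

abbreviation N :: "node \<Rightarrow> real set" where "N w \<equiv> node_ivl Q w"

definition node_measure :: "node \<Rightarrow> real" where "node_measure w = measure \<mu> (N w)"

definition node_int :: "(real \<Rightarrow> 'b::{banach, second_countable_topology}) \<Rightarrow> node \<Rightarrow> 'b" where
  "node_int \<phi> w = (LINT x:N w|\<mu>. \<phi> x)"

lemma sets_mu: "sets \<mu> = sets borel" using lf by (simp add: locally_finite_borel_def)

lemma Q_ivl: "is_ivl Q" by (rule D_ivl[OF Q])

lemma ivl_sets: "is_ivl I \<Longrightarrow> I \<in> sets \<mu>" by (auto simp: is_ivl_def sets_mu)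

lemma N_sets [measurable]: "N w \<in> sets \<mu>" by (intro ivl_sets node_ivl_is_ivl Q_ivl)

lemma ivl_finite: "is_ivl I \<Longrightarrow> emeasure \<mu> I < \<infinity>"
proof -
  assume "is_ivl I"
  then obtain a b where I: "I = {a..<b}" by (auto simp: is_ivl_def)
  have "emeasure \<mu> I \<le> emeasure \<mu> {a..b}" unfolding I by (rule emeasure_mono) (auto simp: sets_mu)
  also have "\<dots> < \<infinity>" by (rule locally_finite_compact[OF lf compact_Icc])
  finally show ?thesis .
qed

lemma N_finite: "emeasure \<mu> (N w) < \<infinity>" by (intro ivl_finite node_ivl_is_ivl Q_ivl)

lemma emeasure_N: "emeasure \<mu> (N w) = ennreal (node_measure w)"
  using N_finite[of w] by (simp add: node_measure_def emeasure_eq_ennreal_measure less_top)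

lemma N_children: "N (False # w) \<union> N (True # w) = N w" "N (False # w) \<inter> N (True # w) = {}"
  by (rule node_ivl_children[OF Q_ivl])+

lemma N_subset: "N (u @ w) \<subseteq> N w" by (rule node_ivl_subset[OF Q_ivl])

lemma N_subset_Q: "N w \<subseteq> Q" using N_subset[of w "[]"] by simp

lemma node_measure_pos: "0 < node_measure w" unfolding node_measure_def by (rule pos[OF D_node_ivl[OF Q]])

lemma node_measure_add: "tree_additive node_measure"
  unfolding tree_additive_def node_measure_def
proof
  fix w
  have "measure \<mu> (N (False # w) \<union> N (True # w)) = measure \<mu> (N (False # w)) + measure \<mu> (N (True # w))"
    by (rule measure_Union) (use N_finite[of "False # w"] N_finite[of "True # w"] N_sets[of "False # w"]
        N_sets[of "True # w"] N_children(2)[of w] in auto)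
  then show "measure \<mu> (N w) = measure \<mu> (N (False # w)) + measure \<mu> (N (True # w))"
    unfolding N_children .
qed

sublocale positive_tree node_measure by unfold_locales (auto simp: node_measure_add node_measure_pos)

lemma node_int_integrable:
  fixes \<phi> :: "real \<Rightarrow> 'b::{banach, second_countable_topology}"
  shows "set_integrable \<mu> Q \<phi> \<Longrightarrow> set_integrable \<mu> (N w) \<phi>"
  using set_integrable_subset[of \<mu> Q \<phi> "N w"] N_sets[of w] N_subset_Q[of w] by blast

lemma node_int_add:
  assumes "set_integrable \<mu> Q \<phi>" shows "tree_additive (node_int \<phi>)"
  unfolding tree_additive_def node_int_def
proof
  fix w
  show "(LINT x:N w|\<mu>. \<phi> x) = (LINT x:N (False # w)|\<mu>. \<phi> x) + (LINT x:N (True # w)|\<mu>. \<phi> x)"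
    using set_integral_Un[OF N_children(2)[of w], of \<mu> \<phi>] node_int_integrable[OF assms]
    unfolding N_children(1) by blast
qed

lemma node_int_nonneg:
  fixes \<phi> :: "real \<Rightarrow> real"
  assumes "AE x in \<mu>. 0 \<le> \<phi> x" shows "0 \<le> node_int \<phi> w"
  unfolding node_int_def set_lebesgue_integral_def
  by (rule integral_nonneg_AE) (use assms in \<open>auto elim!: eventually_mono\<close>)

lemma nn_node_int:
  fixes \<phi> :: "real \<Rightarrow> real"
  assumes int: "set_integrable \<mu> Q \<phi>" and nn: "AE x in \<mu>. 0 \<le> \<phi> x"
  shows "(\<integral>\<^sup>+x\<in>N w. ennreal (\<phi> x) \<partial>\<mu>) = ennreal (node_int \<phi> w)"
proof -
  have "(\<integral>\<^sup>+x\<in>N w. ennreal (\<phi> x) \<partial>\<mu>) = (\<integral>\<^sup>+x. ennreal (indicator (N w) x *\<^sub>R \<phi> x) \<partial>\<mu>)"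
    by (intro nn_integral_cong) (auto simp: indicator_def)
  also have "\<dots> = ennreal (node_int \<phi> w)"
    unfolding node_int_def set_lebesgue_integral_def
    by (rule nn_integral_eq_integral)
      (use node_int_integrable[OF int, of w] nn in \<open>auto simp: set_integrable_def elim!: eventually_mono\<close>)
  finally show ?thesis .
qed

lemma node_int_pos:
  fixes \<phi> :: "real \<Rightarrow> real"
  assumes int: "set_integrable \<mu> Q \<phi>" and p: "AE x in \<mu>. 0 < \<phi> x"
  shows "0 < node_int \<phi> w"
proof (rule ccontr)
  assume "\<not> 0 < node_int \<phi> w"
  moreover have nn: "AE x in \<mu>. 0 \<le> \<phi> x" using p by (auto elim!: eventually_mono)
  ultimately have "node_int \<phi> w = 0" using node_int_nonneg[OF nn, of w] by simp
  then have "(\<integral>\<^sup>+x. ennreal (indicator (N w) x *\<^sub>R \<phi> x) \<partial>\<mu>) = 0"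
  proof -
    have "(\<integral>\<^sup>+x. ennreal (indicator (N w) x *\<^sub>R \<phi> x) \<partial>\<mu>) = (\<integral>\<^sup>+x\<in>N w. ennreal (\<phi> x) \<partial>\<mu>)"
      by (intro nn_integral_cong) (auto simp: indicator_def)
    with \<open>node_int \<phi> w = 0\<close> show ?thesis by (simp only: nn_node_int[OF int nn] ennreal_0)
  qed
  then have "AE x in \<mu>. ennreal (indicator (N w) x *\<^sub>R \<phi> x) = 0"
    using node_int_integrable[OF int, of w] by (subst (asm) nn_integral_0_iff_AE) (auto simp: set_integrable_def)
  with p have "AE x in \<mu>. x \<notin> N w" by eventually_elim (auto simp: indicator_def split: if_splits)
  then have "emeasure \<mu> (N w) = 0" by (subst (asm) AE_iff_measurable[OF N_sets[of w]]) (use sets.sets_into_space[OF N_sets[of w]] in auto)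
  then show False using node_measure_pos[of w] by (simp add: emeasure_N)
qed

lemma node_int_le_norm:
  fixes \<phi> :: "real \<Rightarrow> complex"
  assumes "set_integrable \<mu> Q \<phi>"
  shows "cmod (node_int \<phi> w) \<le> node_int (\<lambda>x. cmod (\<phi> x)) w"
  unfolding node_int_def by (rule set_integral_norm_bound[OF node_int_integrable[OF assms]])

lemma node_int_linear_mono:
  fixes \<phi> \<psi> \<eta> :: "real \<Rightarrow> real"
  assumes i: "set_integrable \<mu> Q \<phi>" "set_integrable \<mu> Q \<psi>" "set_integrable \<mu> Q \<eta>"
    and le: "AE x in \<mu>. a * \<phi> x \<le> \<psi> x + b * \<eta> x"
  shows "a * node_int \<phi> w \<le> node_int \<psi> w + b * node_int \<eta> w"
proof -
  note i' = i[THEN node_int_integrable, of w]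
  have "(LINT x:N w|\<mu>. a * \<phi> x) \<le> (LINT x:N w|\<mu>. \<psi> x + b * \<eta> x)"
    unfolding set_lebesgue_integral_def
    using i' le
    by (intro integral_mono_AE) (auto simp: set_integrable_def indicator_def algebra_simps elim!: eventually_mono)
  then show ?thesis
    using set_integral_add(2)[OF i'(2), of "\<lambda>x. b * \<eta> x"] i' by (simp add: node_int_def)
qed

text \<open>Young's inequality turns a weight \<open>s\<close>, a function \<open>\<phi>\<close> and the integrals of
  \<open>(\<phi> / s)\<^sup>p s\<close> into data for the principal intervals.\<close>

lemma weighted_avg_node_int:
  fixes s \<phi> \<psi> :: "real \<Rightarrow> real"
  assumes p: "1 < p"
    and i: "set_integrable \<mu> Q s" "set_integrable \<mu> Q \<phi>" "set_integrable \<mu> Q \<psi>"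
    and s: "AE x in \<mu>. 0 < s x" and \<phi>: "AE x in \<mu>. 0 \<le> \<phi> x"
    and \<psi>: "AE x in \<mu>. \<psi> x = (\<phi> x / s x) powr p * s x"
  shows "weighted_avg p (node_int s) (node_int \<phi>) (node_int \<psi>)"
proof unfold_locales
  fix y :: real and w assume y: "0 \<le> y"
  have "AE x in \<mu>. p * y powr (p - 1) * \<phi> x \<le> \<psi> x + (p - 1) * y powr p * s x"
    using s \<phi> \<psi>
  proof eventually_elim
    case (elim x)
    have "p * y powr (p - 1) * (\<phi> x / s x) \<le> (\<phi> x / s x) powr p + (p - 1) * y powr p"
      using elim p y by (intro powr_tangent) auto
    then have "p * y powr (p - 1) * (\<phi> x / s x) * s x \<le> ((\<phi> x / s x) powr p + (p - 1) * y powr p) * s x"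
      using elim by (intro mult_right_mono) auto
    then show ?case using elim by (simp add: distrib_right)
  qed
  from node_int_linear_mono[OF i(2,3,1) this]
  show "p * y powr (p - 1) * node_int \<phi> w \<le> node_int \<psi> w + (p - 1) * y powr p * node_int s w" .
qed (use p i s \<phi> node_int_add node_int_pos node_int_nonneg in auto)

section \<open>Packing and the maximal function\<close>

text \<open>The maximum of \<open>y\<close> and of the averages over the first \<open>k\<close> nodes of the path from \<open>w\<close> towards
  \<open>x\<close>, and its integral. This simple function lies below the maximal function.\<close>

primrec path_max :: "(node \<Rightarrow> real) \<Rightarrow> nat \<Rightarrow> node \<Rightarrow> real \<Rightarrow> real \<Rightarrow> real" where
  "path_max s 0 w y x = y"
| "path_max s (Suc k) w y x = (if x \<in> N (False # w) then path_max s k (False # w) (max y (s w / node_measure w)) x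
     else path_max s k (True # w) (max y (s w / node_measure w)) x)"

primrec path_max_int :: "(node \<Rightarrow> real) \<Rightarrow> nat \<Rightarrow> node \<Rightarrow> real \<Rightarrow> real" where
  "path_max_int s 0 w y = y * node_measure w"
| "path_max_int s (Suc k) w y = path_max_int s k (False # w) (max y (s w / node_measure w)) + path_max_int s k (True # w) (max y (s w / node_measure w))"

lemma path_max_measurable [measurable]: "path_max s k w y \<in> borel_measurable \<mu>"
proof (induction k arbitrary: w y)
  case (Suc k)
  note [measurable] = Suc
  have "path_max s (Suc k) w y = (\<lambda>x. if x \<in> N (False # w) then path_max s k (False # w) (max y (s w / node_measure w)) x
     else path_max s k (True # w) (max y (s w / node_measure w)) x)" by (rule ext) simp
  then show ?case
    by (simp only:) (intro measurable_If_set Suc sets.Int N_sets sets.top)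
next
  case (0 w y)
  have "path_max s 0 w y = (\<lambda>x. y)" by (rule ext) simp
  then show ?case by simp
qed

lemma path_max_int_eq:
  assumes s: "\<And>w. 0 \<le> s w" and y: "0 \<le> y"
  shows "0 \<le> path_max_int s k w y \<and> (\<integral>\<^sup>+x\<in>N w. ennreal (path_max s k w y x) \<partial>\<mu>) = ennreal (path_max_int s k w y)"
  using y
proof (induction k arbitrary: w y)
  case 0
  have "(\<integral>\<^sup>+x\<in>N w. ennreal y \<partial>\<mu>) = ennreal y * ennreal (node_measure w)"
    by (simp add: nn_integral_cmult_indicator emeasure_N)
  then show ?case using 0 by (simp add: ennreal_mult)
next
  case (Suc k)
  let ?z = "max y (s w / node_measure w)"
  have z: "0 \<le> ?z" using Suc.prems by simp
  have "(\<integral>\<^sup>+x\<in>N w. ennreal (path_max s (Suc k) w y x) \<partial>\<mu>) =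
    (\<integral>\<^sup>+x. (ennreal (path_max s k (False # w) ?z x) * indicator (N (False # w)) x
      + ennreal (path_max s k (True # w) ?z x) * indicator (N (True # w)) x) \<partial>\<mu>)"
    using N_children[of w] by (intro nn_integral_cong) (auto simp: indicator_def simp del: node_ivl.simps)
  also have "\<dots> = (\<integral>\<^sup>+x\<in>N (False # w). ennreal (path_max s k (False # w) ?z x) \<partial>\<mu>)
     + (\<integral>\<^sup>+x\<in>N (True # w). ennreal (path_max s k (True # w) ?z x) \<partial>\<mu>)"
    by (rule nn_integral_add; intro borel_measurable_times_ennreal borel_measurable_indicator N_sets
        measurable_compose[OF path_max_measurable measurable_ennreal])
  also have "\<dots> = ennreal (path_max_int s k (False # w) ?z) + ennreal (path_max_int s k (True # w) ?z)"
    unfolding Suc.IH[OF z, THEN conjunct2] ..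
  finally show ?case using Suc.IH[OF z] by (simp add: ennreal_plus)
qed

lemma path_max_le:
  assumes "\<And>u x. x \<in> N (u @ w) \<Longrightarrow> ennreal (s (u @ w) / node_measure (u @ w)) \<le> M x" and "x \<in> N w"
  shows "ennreal (path_max s k w y x) \<le> max (ennreal y) (M x)"
  using assms
proof (induction k arbitrary: w y)
  case (Suc k)
  let ?z = "max y (s w / node_measure w)"
  have zM: "ennreal ?z \<le> max (ennreal y) (M x)"
    using Suc.prems(1)[of x "[]"] Suc.prems(2) by (auto simp: max_def ennreal_leI le_max_iff_disj)
  have b: "ennreal (path_max s k (b # w) ?z x) \<le> max (ennreal y) (M x)" if "x \<in> N (b # w)" for b
  proof -
    have "ennreal (path_max s k (b # w) ?z x) \<le> max (ennreal ?z) (M x)"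
      by (rule Suc.IH) (use Suc.prems(1)[of _ "_ @ [b]"] that in auto)
    also have "\<dots> \<le> max (ennreal y) (M x)" using zM by simp
    finally show ?thesis .
  qed
  show ?case using b[of False] b[of True] N_children(1)[of w] Suc.prems(2)
    by (auto simp del: node_ivl.simps)
qed simp

text \<open>A discrete layer-cake argument: whenever the running maximum grows from \<open>y\<close> to \<open>z\<close>, the sum gains
  at most \<open>z - y\<close> times the mass of the family below, which is at most \<open>\<Lambda>\<close> times the measure.\<close>

lemma packing_path_max:
  fixes s :: "node \<Rightarrow> real"
  assumes packing: "\<And>z. tsum n (\<lambda>v. if S v then node_measure v else 0) z \<le> \<Lambda> * node_measure z"
  shows "tsum n (\<lambda>v. if S v then node_measure v * max y (s v / node_measure v) else 0) w - y * tsum n (\<lambda>v. if S v then node_measure v else 0) w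
    \<le> \<Lambda> * (path_max_int s (Suc n - length w) w y - y * node_measure w)"
proof (induction w arbitrary: y rule: tree_induct[of n])
  case (leaf w)
  then show ?case by (simp add: tsum_empty Suc_leI)
next
  case (node w)
  let ?z = "max y (s w / node_measure w)"
  let ?V = "\<lambda>y w. tsum n (\<lambda>v. if S v then node_measure v * max y (s v / node_measure v) else 0) w"
  let ?C = "\<lambda>w. tsum n (\<lambda>v. if S v then node_measure v else 0) w"
  let ?E = "\<lambda>b. path_max_int s (Suc n - length (b # w)) (b # w) ?z"
  define c where "c = (if S w then node_measure w else 0)"
  have k: "Suc n - length w = Suc (Suc n - length (b # w))" for b using node(1) by simp
  have E: "path_max_int s (Suc n - length w) w y = ?E False + ?E True"
    by (subst k[of False]) simp
  have Vm: "?V y v \<le> ?V ?z v" for v unfolding tsum_def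
    by (intro sum_mono) (auto intro!: mult_left_mono max.mono)
  have V: "?V y w = c * ?z + ?V y (False # w) + ?V y (True # w)"
    using tsum_rec[OF node(1), of "\<lambda>v. if S v then node_measure v * max y (s v / node_measure v) else 0"] by (simp add: c_def)
  have C: "?C w = c + ?C (False # w) + ?C (True # w)"
    using tsum_rec[OF node(1), of "\<lambda>v. if S v then node_measure v else 0"] by (simp add: c_def)
  have ih: "?V ?z (False # w) \<le> ?z * ?C (False # w) + \<Lambda> * ?E False - \<Lambda> * (?z * node_measure (False # w))"
    "?V ?z (True # w) \<le> ?z * ?C (True # w) + \<Lambda> * ?E True - \<Lambda> * (?z * node_measure (True # w))"
    using node(2)[of ?z] node(3)[of ?z] unfolding right_diff_distrib by linarith+
  have "?V y w \<le> ?z * ?C w + \<Lambda> * (?E False + ?E True) - \<Lambda> * (?z * node_measure w)"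
  proof -
    have "?z * ?C w = c * ?z + ?z * ?C (False # w) + ?z * ?C (True # w)" unfolding C by (simp add: algebra_simps)
    moreover have "\<Lambda> * (?z * node_measure w) = \<Lambda> * (?z * node_measure (False # w)) + \<Lambda> * (?z * node_measure (True # w))"
      unfolding mu_split[of w, symmetric] by (simp add: algebra_simps)
    ultimately show ?thesis
      using ih Vm[of "False # w"] Vm[of "True # w"] unfolding V distrib_left by linarith
  qed
  moreover have "(?z - y) * ?C w \<le> (?z - y) * (\<Lambda> * node_measure w)"
    by (intro mult_left_mono packing) auto
  ultimately show ?case unfolding E by (simp add: algebra_simps)
qed

text \<open>By \<open>packing_path_max\<close>, the sum of the weight over the family below a node is at most the integral of
  the maximal function of the weight on this node, and the \<open>A\<^sub>\<infinity>\<close> characteristic compares that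
  integral with the weight.\<close>

lemma Ainf_packing:
  fixes s :: "real \<Rightarrow> real"
  assumes int: "set_integrable \<mu> Q s" and sp: "AE x in \<mu>. 0 < s x"
    and fin: "Ainf_char \<mu> D s < \<infinity>" and Lam: "0 \<le> \<Lambda>"
    and packing: "\<And>z. tsum n (\<lambda>v. if S v then node_measure v else 0) z \<le> \<Lambda> * node_measure z"
  shows "tsum n (\<lambda>v. if S v then node_int s v else 0) z \<le> \<Lambda> * enn2real (Ainf_char \<mu> D s) * node_int s z"
proof -
  have snn: "AE x in \<mu>. 0 \<le> s x" using sp by (auto elim!: eventually_mono)
  let ?M = "dyadic_maximal \<mu> D (\<lambda>y. s y * indicator (N z) y)"
  let ?E = "path_max_int (node_int s) (Suc n - length z) z 0"
  have emp: "0 < emeasure \<mu> (N w)" for w using node_measure_pos[of w] by (simp add: emeasure_N)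
  then have Npos: "N w \<in> positive_intervals D \<mu>" for w
    using D_node_ivl[OF Q] by (simp add: positive_intervals_def)
  have E: "0 \<le> ?E" "(\<integral>\<^sup>+x\<in>N z. ennreal (path_max (node_int s) (Suc n - length z) z 0 x) \<partial>\<mu>) = ennreal ?E"
    using path_max_int_eq[of "node_int s" 0] node_int_nonneg[OF snn] by auto
  have Mge: "ennreal (node_int s (u @ z) / node_measure (u @ z)) \<le> ?M x" if x: "x \<in> N (u @ z)" for u x
  proof -
    have "avg \<mu> (N (u @ z)) (\<lambda>y. \<bar>s y * indicator (N z) y\<bar>) = ennreal (node_int s (u @ z)) / ennreal (node_measure (u @ z))"
    proof -
      have "(\<integral>\<^sup>+y\<in>N (u @ z). ennreal \<bar>s y * indicator (N z) y\<bar> \<partial>\<mu>) = (\<integral>\<^sup>+y\<in>N (u @ z). ennreal (s y) \<partial>\<mu>)"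
        by (rule nn_integral_cong_AE)
          (use snn N_subset[of u z] in \<open>auto simp: indicator_def elim!: eventually_mono\<close>)
      then show ?thesis using nn_node_int[OF int snn, of "u @ z"] by (simp add: avg_def emeasure_N)
    qed
    also have "\<dots> = ennreal (node_int s (u @ z) / node_measure (u @ z))"
      using node_int_nonneg[OF snn] node_measure_pos by (simp add: divide_ennreal)
    finally have "ennreal (node_int s (u @ z) / node_measure (u @ z))
        = avg \<mu> (N (u @ z)) (\<lambda>y. \<bar>s y * indicator (N z) y\<bar>) * indicator (N (u @ z)) x" using x by simp
    also have "\<dots> \<le> ?M x" unfolding dyadic_maximal_def by (rule SUP_upper[OF Npos])
    finally show ?thesis .
  qed
  have "ennreal ?E \<le> (\<integral>\<^sup>+x\<in>N z. ?M x \<partial>\<mu>)"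
    unfolding E(2)[symmetric]
  proof (rule nn_integral_mono)
    fix x
    show "ennreal (path_max (node_int s) (Suc n - length z) z 0 x) * indicator (N z) x \<le> ?M x * indicator (N z) x"
      using path_max_le[of z "node_int s" ?M x "Suc n - length z" 0] Mge by (auto simp: indicator_def)
  qed
  also have "\<dots> \<le> Ainf_char \<mu> D s * ennreal (node_int s z)"
  proof -
    have t: "0 < node_int s z" by (rule node_int_pos[OF int sp])
    have "(\<integral>\<^sup>+x\<in>N z. ?M x \<partial>\<mu>) / ennreal (node_int s z) \<le> Ainf_char \<mu> D s"
      unfolding Ainf_char_def nn_node_int[OF int snn, of z, symmetric] by (rule SUP_upper[OF Npos])
    then have "(\<integral>\<^sup>+x\<in>N z. ?M x \<partial>\<mu>) / ennreal (node_int s z) * ennreal (node_int s z) \<le> Ainf_char \<mu> D s * ennreal (node_int s z)"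
      by (rule mult_right_mono) simp
    moreover have "(\<integral>\<^sup>+x\<in>N z. ?M x \<partial>\<mu>) / ennreal (node_int s z) * ennreal (node_int s z) = (\<integral>\<^sup>+x\<in>N z. ?M x \<partial>\<mu>)"
      using t by (simp add: ennreal_divide_times ennreal_times_divide[symmetric] ennreal_divide_self)
    ultimately show ?thesis by simp
  qed
  also have "\<dots> = ennreal (enn2real (Ainf_char \<mu> D s) * node_int s z)"
    using fin node_int_nonneg[OF snn, of z] by (simp add: ennreal_mult ennreal_enn2real less_top)
  finally have le: "?E \<le> enn2real (Ainf_char \<mu> D s) * node_int s z"
    using node_int_nonneg[OF snn, of z] by (subst (asm) ennreal_le_iff) auto
  have "tsum n (\<lambda>v. if S v then node_int s v else 0) z = tsum n (\<lambda>v. if S v then node_measure v * max 0 (node_int s v / node_measure v) else 0) z"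
    unfolding tsum_def using node_int_nonneg[OF snn] by (intro sum.cong) (auto simp: max_def not_le divide_less_0_iff not_less)
  also have "\<dots> \<le> \<Lambda> * ?E" using packing_path_max[OF packing, where y = 0 and w = z and s = "node_int s"] by simp
  also have "\<dots> \<le> \<Lambda> * (enn2real (Ainf_char \<mu> D s) * node_int s z)" by (rule mult_left_mono[OF le Lam])
  finally show ?thesis by (simp add: mult.assoc)
qed

end

section \<open>Haar shifts on a tree\<close>

lemma epowr_ennreal: "0 \<le> x \<Longrightarrow> epowr (ennreal x) a = ennreal (x powr a)"
  by (simp add: epowr_def)

context meas_tree
begin

lemma m_meas_N: "m_meas \<mu> (N w) = m_node node_measure w"
  by (simp add: m_meas_def m_node_def node_measure_def)

lemma haar_N: "haar \<mu> (N w) x = sqrt (m_node node_measure w) *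
    (indicator (N (False # w)) x / node_measure (False # w) - indicator (N (True # w)) x / node_measure (True # w))"
  using node_measure_pos[of "False # w"] node_measure_pos[of "True # w"]
  by (simp add: haar_def m_meas_N node_measure_def)

lemma haar_integral:
  fixes \<phi> :: "real \<Rightarrow> complex"
  assumes "set_integrable \<mu> Q \<phi>"
  shows "integrable \<mu> (\<lambda>x. \<phi> x * of_real (haar \<mu> (N w) x))"
    and "cmod (LINT x|\<mu>. \<phi> x * of_real (haar \<mu> (N w) x)) = haar_coeff node_measure (node_int \<phi>) w"
proof -
  let ?a = "\<lambda>b x. indicator (N (b # w)) x *\<^sub>R \<phi> x"
  let ?c = "\<lambda>b. complex_of_real (node_measure (b # w))"
  have i: "integrable \<mu> (?a b)" for b
    using node_int_integrable[OF assms, of "b # w"] by (simp only: set_integrable_def)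
  have eq: "(\<lambda>x. \<phi> x * of_real (haar \<mu> (N w) x))
    = (\<lambda>x. of_real (sqrt (m_node node_measure w)) * (?a False x / ?c False - ?a True x / ?c True))"
    unfolding haar_N by (rule ext) (simp add: scaleR_conv_of_real algebra_simps del: node_ivl.simps)
  show "integrable \<mu> (\<lambda>x. \<phi> x * of_real (haar \<mu> (N w) x))"
    unfolding eq by (intro integrable_mult_right Bochner_Integration.integrable_diff integrable_divide i)
  have t: "(LINT x|\<mu>. ?a b x) = node_int \<phi> (b # w)" for b by (simp only: node_int_def set_lebesgue_integral_def)
  have "(LINT x|\<mu>. \<phi> x * of_real (haar \<mu> (N w) x)) =
    of_real (sqrt (m_node node_measure w)) * (node_int \<phi> (False # w) / ?c False - node_int \<phi> (True # w) / ?c True)"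
  proof -
    have "(LINT x|\<mu>. of_real (sqrt (m_node node_measure w)) * (?a False x / ?c False - ?a True x / ?c True))
      = of_real (sqrt (m_node node_measure w)) * (LINT x|\<mu>. ?a False x / ?c False - ?a True x / ?c True)"
      by (rule integral_mult_right_zero)
    also have "(LINT x|\<mu>. ?a False x / ?c False - ?a True x / ?c True)
      = (LINT x|\<mu>. ?a False x / ?c False) - (LINT x|\<mu>. ?a True x / ?c True)"
      by (rule Bochner_Integration.integral_diff) (intro integrable_divide i)+
    also have "\<dots> = node_int \<phi> (False # w) / ?c False - node_int \<phi> (True # w) / ?c True"
      unfolding t[symmetric] by (simp only: integral_divide_zero)
    finally show ?thesis unfolding eq .
  qed
  then show "cmod (LINT x|\<mu>. \<phi> x * of_real (haar \<mu> (N w) x)) = haar_coeff node_measure (node_int \<phi>) w"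
    using m_node_pos[of w] by (simp add: haar_coeff_def norm_mult del: node_ivl.simps)
qed

lemma haar_block_N:
  "haar_block \<mu> D s t \<alpha> f (N w) x = (\<Sum>u | length u = s. \<Sum>v | length v = t.
     \<alpha> (N w) (N (u @ w)) (N (v @ w)) * (LINT y|\<mu>. f y * of_real (haar \<mu> (N (u @ w)) y)) *
       of_real (haar \<mu> (N (v @ w)) x))"
  unfolding haar_block_def descendants_node_ivl[OF Q]
  by (simp add: sum.reindex[OF inj_node_ivl_append[OF Q]])

lemma coeff_N:
  assumes "coeffs_bounded_by_1 D s t \<alpha>" "length u = s" "length v = t"
  shows "cmod (\<alpha> (N w) (N (u @ w)) (N (v @ w))) \<le> 1"
  using assms D_node_ivl[OF Q, of w] unfolding coeffs_bounded_by_1_def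
  by (auto simp: descendants_node_ivl[OF Q])

lemma haar_bounded: "\<bar>haar \<mu> (N w) x\<bar> \<le> sqrt (m_node node_measure w) * (1 / node_measure (False # w) + 1 / node_measure (True # w))"
proof -
  have "\<bar>indicator A x / m - indicator B x / n\<bar> \<le> 1 / m + 1 / n" if "0 < m" "0 < n" for A B :: "real set" and m n :: real
    using that abs_triangle_ineq4[of "indicator A x / m" "indicator B x / n"] by (auto simp: indicator_def)
  then show ?thesis unfolding haar_N abs_mult using m_node_pos[of w] node_measure_pos
    by (simp add: mult_left_mono del: node_ivl.simps)
qed

lemma haar_outside: "x \<notin> Q \<Longrightarrow> haar \<mu> (N w) x = 0"
  using N_subset_Q[of "False # w"] N_subset_Q[of "True # w"] unfolding haar_N
  by (auto simp: indicator_def simp del: node_ivl.simps)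

lemma haar_measurable [measurable]: "(\<lambda>x. haar \<mu> (N w) x) \<in> borel_measurable \<mu>"
  unfolding haar_N by (intro borel_measurable_times borel_measurable_diff borel_measurable_divide
      borel_measurable_indicator N_sets borel_measurable_const)

end

section \<open>The weighted bound for a finite shift\<close>

lemma weight_measurable:
  assumes "sets \<mu> = sets borel" "is_weight \<mu> \<omega>"
  shows "\<omega> \<in> borel_measurable \<mu>"
proof (rule borel_measurable_LIMSEQ_metric)
  fix i :: nat
  have "set_integrable \<mu> {-real i..real i} \<omega>" using assms by (auto simp: is_weight_def)
  then show "(\<lambda>x. indicator {-real i..real i} x *\<^sub>R \<omega> x) \<in> borel_measurable \<mu>"
    unfolding set_integrable_def by (rule borel_measurable_integrable)
next
  fix x :: real
  obtain n :: nat where n: "\<bar>x\<bar> \<le> real n" using real_arch_simple by blast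
  have "eventually (\<lambda>i. indicator {-real i..real i} x *\<^sub>R \<omega> x = \<omega> x) sequentially"
    using eventually_ge_at_top[of n]
  proof eventually_elim
    case (elim i)
    then have "\<bar>x\<bar> \<le> real i" using n by linarith
    then show ?case by (simp add: indicator_def abs_le_iff)
  qed
  then show "(\<lambda>i. indicator {-real i..real i} x *\<^sub>R \<omega> x) \<longlonglongrightarrow> \<omega> x" by (rule tendsto_eventually)
qed

lemma powr_quotient_mult: "0 < s \<Longrightarrow> (a / s) powr p * s = a powr p * s powr (1 - p)" for a s p :: real
  by (simp add: powr_divide powr_diff)

text \<open>If the \<open>A\<^sub>p\<close> characteristic is finite, the dual weight is integrable on the intervals of the
  lattice, and both weights enter only by their integrals.\<close>

locale weighted_tree = meas_tree +
  fixes \<omega> :: "real \<Rightarrow> real" and p \<beta> :: real and \<kappa> :: nat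
  assumes p: "1 < p" and weight: "is_weight \<mu> \<omega>" and balanced: "balanced_with \<beta> D \<mu>"
    and Ap_fin: "Ap_char \<mu> D \<kappa> p \<omega> < \<infinity>"
begin

definition q :: real where "q = p / (p - 1)"
definition \<sigma> :: "real \<Rightarrow> real" where "\<sigma> = dual_weight p \<omega>"
definition A :: real where "A = enn2real (Ap_char \<mu> D \<kappa> p \<omega>)"

lemma q1: "1 < q" "q - 1 = 1 / (p - 1)" "(p - 1) * q = p" "1 / p + 1 / q = 1" "(1 - q) * (1 - p) = 1"
  using p by (auto simp: q_def field_simps)

lemma om_pos: "AE x in \<mu>. 0 < \<omega> x" using weight by (simp add: is_weight_def)

lemma om_meas [measurable]: "\<omega> \<in> borel_measurable \<mu>"
  by (rule weight_measurable[OF sets_mu weight])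

lemma sg_eq: "\<sigma> x = \<omega> x powr (1 - q)"
  by (simp add: \<sigma>_def dual_weight_def conj_exp_def q_def)

lemma sg_meas [measurable]: "\<sigma> \<in> borel_measurable \<mu>"
  unfolding sg_eq by measurable

lemma sg_pos: "AE x in \<mu>. 0 < \<sigma> x" using om_pos by eventually_elim (simp add: sg_eq)

lemma om_int: "set_integrable \<mu> Q \<omega>"
proof -
  obtain a b where Qab: "Q = {a..<b}" using Q_ivl by (auto simp: is_ivl_def)
  have "set_integrable \<mu> {a..b} \<omega>" using weight by (auto simp: is_weight_def)
  then show ?thesis by (rule set_integrable_subset) (auto simp: Qab sets_mu)
qed

lemma nonneg_AE: "AE x in \<mu>. 0 \<le> \<omega> x" "AE x in \<mu>. 0 \<le> \<sigma> x"
proof -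
  show "AE x in \<mu>. 0 \<le> \<omega> x" using om_pos by eventually_elim simp
  show "AE x in \<mu>. 0 \<le> \<sigma> x" using sg_pos by eventually_elim simp
qed

lemma N_positive: "N w \<in> positive_intervals D \<mu>"
  using D_node_ivl[OF Q] node_measure_pos[of w] by (simp add: positive_intervals_def emeasure_N)

lemma avg_om: "avg \<mu> (N w) \<omega> = ennreal (node_int \<omega> w / node_measure w)"
  using node_measure_pos[of w] node_int_nonneg[OF nonneg_AE(1)]
  by (simp add: avg_def nn_node_int[OF om_int nonneg_AE(1)] emeasure_N divide_ennreal)

lemma sg_int: "set_integrable \<mu> Q \<sigma>"
proof -
  have "avg \<mu> Q \<omega> * epowr (avg \<mu> Q \<sigma>) (p - 1) \<le> Ap_char \<mu> D \<kappa> p \<omega>"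
    unfolding Ap_char_def \<sigma>_def
    by (rule max.coboundedI1, rule SUP_upper2[of Q]) (use N_positive[of "[]"] in auto)
  then have fin: "avg \<mu> Q \<omega> * epowr (avg \<mu> Q \<sigma>) (p - 1) < \<infinity>" using Ap_fin by simp
  have om: "avg \<mu> Q \<omega> > 0" using avg_om[of "[]"] node_int_pos[OF om_int om_pos, of "[]"] node_measure_pos[of "[]"] by simp
  have "avg \<mu> Q \<sigma> \<noteq> \<infinity>"
  proof
    assume "avg \<mu> Q \<sigma> = \<infinity>"
    then have "avg \<mu> Q \<omega> * epowr (avg \<mu> Q \<sigma>) (p - 1) = \<infinity>" using om by (simp add: epowr_def ennreal_mult_top)
    then show False using fin by simp
  qed
  then have "(\<integral>\<^sup>+x\<in>Q. ennreal (\<sigma> x) \<partial>\<mu>) < \<infinity>"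
    using emeasure_N[of "[]"] node_measure_pos[of "[]"]
    by (simp add: avg_def less_top ennreal_divide_eq_top_iff)
  moreover have "(\<integral>\<^sup>+x\<in>Q. ennreal (\<sigma> x) \<partial>\<mu>) = (\<integral>\<^sup>+x. ennreal (norm (indicator Q x *\<^sub>R \<sigma> x)) \<partial>\<mu>)"
    by (intro nn_integral_cong) (simp add: indicator_def sg_eq)
  ultimately show ?thesis unfolding set_integrable_def
    using N_sets[of "[]"] by (intro integrableI_bounded) auto
qed

lemma avg_sg: "avg \<mu> (N w) \<sigma> = ennreal (node_int \<sigma> w / node_measure w)"
  using node_measure_pos[of w] node_int_nonneg[OF nonneg_AE(2)]
  by (simp add: avg_def nn_node_int[OF sg_int nonneg_AE(2)] emeasure_N divide_ennreal)

lemma A_ennreal: "Ap_char \<mu> D \<kappa> p \<omega> = ennreal A"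
  unfolding A_def using Ap_fin by (simp add: less_top)

lemma A_nonneg: "0 \<le> A" by (simp add: A_def)

lemma node_int_avg_nonneg: "0 \<le> node_int \<omega> w / node_measure w" "0 \<le> node_int \<sigma> w / node_measure w"
  using node_int_nonneg[OF nonneg_AE(1)] node_int_nonneg[OF nonneg_AE(2)] by auto

lemma Ap1: "node_int \<omega> w / node_measure w * (node_int \<sigma> w / node_measure w) powr (p - 1) \<le> A"
proof -
  have "avg \<mu> (N w) \<omega> * epowr (avg \<mu> (N w) \<sigma>) (p - 1) \<le> ennreal A"
    unfolding A_ennreal[symmetric] Ap_char_def \<sigma>_def
    by (rule max.coboundedI1, rule SUP_upper2[of "N w"]) (use N_positive[of w] in auto)
  then have "ennreal (node_int \<omega> w / node_measure w * (node_int \<sigma> w / node_measure w) powr (p - 1)) \<le> ennreal A"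
    using node_int_avg_nonneg[of w] by (simp only: avg_om avg_sg epowr_ennreal ennreal_mult powr_ge_zero)
  then show ?thesis using A_nonneg by (simp add: ennreal_le_iff)
qed

lemma Ap2:
  assumes "length u + length v \<le> \<kappa> + 2" "u @ w \<noteq> v @ w"
  shows "m_node node_measure (v @ w) powr (p / 2) * m_node node_measure (u @ w) powr (p / 2) / (node_measure (u @ w) * node_measure (v @ w) powr (p - 1)) *
        (node_int \<omega> (v @ w) / node_measure (v @ w)) * (node_int \<sigma> (u @ w) / node_measure (u @ w)) powr (p - 1) \<le> A"
proof -
  let ?I = "N (v @ w)" and ?J = "N (u @ w)"
  have nn: "0 \<le> m_node node_measure (v @ w) powr (p / 2) * m_node node_measure (u @ w) powr (p / 2) / (node_measure (u @ w) * node_measure (v @ w) powr (p - 1))"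
    by simp
  have ne: "?I \<noteq> ?J" using node_ivl_inj[OF Q_ivl, of "v @ w" "u @ w"] assms(2) by auto
  have "dyadic_dist D ?I ?J \<le> \<kappa> + 2" using dist_node_ivl[OF Q, of v w u] assms(1) by simp
  then have "ennreal (m_meas \<mu> ?I powr (p / 2) * m_meas \<mu> ?J powr (p / 2) /
      (measure \<mu> ?J * measure \<mu> ?I powr (p - 1))) *
      avg \<mu> ?I \<omega> * epowr (avg \<mu> ?J \<sigma>) (p - 1) \<le> ennreal A"
    unfolding A_ennreal[symmetric] Ap_char_def \<sigma>_def
    by (intro max.coboundedI2 SUP_upper2[of "(?I, ?J)"]) (use N_positive ne in auto)
  then have "ennreal (m_node node_measure (v @ w) powr (p / 2) * m_node node_measure (u @ w) powr (p / 2) / (node_measure (u @ w) * node_measure (v @ w) powr (p - 1)) *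
        (node_int \<omega> (v @ w) / node_measure (v @ w)) * (node_int \<sigma> (u @ w) / node_measure (u @ w)) powr (p - 1)) \<le> ennreal A"
    unfolding m_meas_N node_measure_def[symmetric] avg_om avg_sg epowr_ennreal[OF node_int_avg_nonneg(2)]
      ennreal_mult[OF mult_nonneg_nonneg[OF nn node_int_avg_nonneg(1)] powr_ge_zero] ennreal_mult[OF nn node_int_avg_nonneg(1)] .
  then show ?thesis using A_nonneg by (simp add: ennreal_le_iff)
qed

lemma one_int: "set_integrable \<mu> Q (\<lambda>_. 1 :: real)"
  unfolding set_integrable_def using N_sets[of "[]"] N_finite[of "[]"] by simp

lemma node_int_one: "node_int (\<lambda>_. 1 :: real) = node_measure"
  by (rule ext) (simp add: node_int_def node_measure_def set_lebesgue_integral_def)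

lemma dual_om: "weighted_avg p (node_int \<sigma>) node_measure (node_int \<omega>)"
  unfolding node_int_one[symmetric]
proof (rule weighted_avg_node_int[OF p sg_int one_int om_int sg_pos])
  show "AE x in \<mu>. \<omega> x = (1 / \<sigma> x) powr p * \<sigma> x"
    using om_pos
  proof eventually_elim
    case (elim x)
    have "(1 / \<sigma> x) powr p * \<sigma> x = \<sigma> x powr (1 - p)"
      using elim powr_quotient_mult[of "\<sigma> x" 1 p] by (simp add: sg_eq)
    also have "\<dots> = \<omega> x" using elim q1(5) by (simp add: sg_eq powr_powr)
    finally show ?case ..
  qed
qed simp

lemma dual_sg: "weighted_avg q (node_int \<omega>) node_measure (node_int \<sigma>)"
  unfolding node_int_one[symmetric]
proof (rule weighted_avg_node_int[OF q1(1) om_int one_int sg_int om_pos])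
  show "AE x in \<mu>. \<sigma> x = (1 / \<omega> x) powr q * \<omega> x"
    using om_pos by eventually_elim (simp add: sg_eq powr_divide powr_diff)
qed simp

text \<open>Hoelder's inequality in the form of the tangent at the quotient of the measure and the dual weight.\<close>

lemma A_ge_1: "1 \<le> A"
proof -
  interpret w: weighted_avg p "node_int \<sigma>" node_measure "node_int \<omega>" by (rule dual_om)
  let ?y = "node_measure [] / node_int \<sigma> []"
  have y: "0 < ?y" using node_measure_pos[of "[]"] w.sg_pos[of "[]"] by simp
  have "?y powr p * node_int \<sigma> [] = ?y powr (p - 1) * node_measure []"
    using powr_p_split[of ?y p] y w.sg_pos[of "[]"] by (simp add: field_simps)
  then have "(p - 1) * ?y powr p * node_int \<sigma> [] = (p - 1) * (?y powr (p - 1) * node_measure [])" by simp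
  with w.tangent[of ?y "[]"] y have "?y powr (p - 1) * node_measure [] \<le> node_int \<omega> []" by (simp add: left_diff_distrib mult.assoc)
  then have "1 \<le> node_int \<omega> [] / node_measure [] / ?y powr (p - 1)" using node_measure_pos[of "[]"] y by (simp add: field_simps)
  also have "\<dots> = node_int \<omega> [] / node_measure [] * (node_int \<sigma> [] / node_measure []) powr (p - 1)" by (simp add: powr_divide)
  also have "\<dots> \<le> A" by (rule Ap1)
  finally show ?thesis .
qed

text \<open>The image \<open>h\<close> of \<open>f\<close> is tested against \<open>g = cnj h |h|\<^sup>p\<^sup>-\<^sup>2 \<omega>\<close>, for which the pairing is
  \<open>Y = \<integral> |h|\<^sup>p \<omega>\<close> and the norm of \<open>g / \<omega>\<close> in the dual space is a power of \<open>Y\<close>. As \<open>Y\<close> is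
  finite, it cancels. Haar coefficients depend only on integrals over nodes, so that \<open>tree_bound\<close>
  applies.\<close>

lemma shift_on_tree:
  fixes f :: "real \<Rightarrow> complex" and W :: "node set"
  assumes f_meas: "f \<in> borel_measurable \<mu>" and f_bd: "\<And>x. cmod (f x) \<le> B"
    and W: "finite W" and st: "s + t \<le> \<kappa>" and \<alpha>: "coeffs_bounded_by_1 D s t \<alpha>"
    and L: "0 \<le> L" "0 \<le> L'"
    and packing: "\<And>S n z. (\<And>z. tsum n (\<lambda>v. if S v then node_measure v else 0) z \<le> pack_const \<kappa> * node_measure z) \<Longrightarrow>
      tsum n (\<lambda>v. if S v then node_int \<sigma> v else 0) z \<le> L * node_int \<sigma> z"
      "\<And>S n z. (\<And>z. tsum n (\<lambda>v. if S v then node_measure v else 0) z \<le> pack_const \<kappa> * node_measure z) \<Longrightarrow>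
      tsum n (\<lambda>v. if S v then node_int \<omega> v else 0) z \<le> L' * node_int \<omega> z"
  shows "(\<integral>\<^sup>+x. ennreal (cmod (\<Sum>w\<in>W. haar_block \<mu> D s t \<alpha> f (N w) x) powr p) * ennreal (\<omega> x) \<partial>\<mu>)
    \<le> ennreal ((tree_const \<beta> p q \<kappa> * (A powr (1 / p) * (L powr (1 / p) + L' powr (1 / q)))) powr p) *
      (\<integral>\<^sup>+x. ennreal (cmod (f x) powr p) * ennreal (\<omega> x) \<partial>\<mu>)"
proof -
  define c where "c v = (LINT y|\<mu>. f y * of_real (haar \<mu> (N v) y))" for v
  define h where "h x = (\<Sum>w\<in>W. haar_block \<mu> D s t \<alpha> f (N w) x)" for x
  let ?a = "\<lambda>w u v. \<alpha> (N w) (N (u @ w)) (N (v @ w)) * c (u @ w)"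
  have h_eq: "h x = (\<Sum>w\<in>W. \<Sum>u | length u = s. \<Sum>v | length v = t. ?a w u v * of_real (haar \<mu> (N (v @ w)) x))" for x
    unfolding h_def haar_block_N c_def ..
  have h_meas [measurable]: "h \<in> borel_measurable \<mu>"
    unfolding h_eq[abs_def] by (intro borel_measurable_sum borel_measurable_times borel_measurable_const
        measurable_compose[OF haar_measurable borel_measurable_of_real])
  have h_out: "h x = 0" if "x \<notin> Q" for x unfolding h_eq using haar_outside[OF that] by simp
  define H where "H = (\<Sum>w\<in>W. \<Sum>u | length u = s. \<Sum>v | length v = t. cmod (?a w u v) *
    (sqrt (m_node node_measure (v @ w)) * (1 / node_measure (False # v @ w) + 1 / node_measure (True # v @ w))))"
  have h_bd: "cmod (h x) \<le> H" for x
    unfolding h_eq H_def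
    by (intro order_trans[OF norm_sum] sum_mono) (auto simp: norm_mult simp del: node_ivl.simps intro!: mult_left_mono haar_bounded)
  have H0: "0 \<le> H" using h_bd[of 0] norm_ge_zero[of "h 0"] by linarith
  define g where "g x = cnj (h x) * of_real (cmod (h x) powr (p - 2) * \<omega> x)" for x
  have g_meas [measurable]: "g \<in> borel_measurable \<mu>"
    unfolding g_def
  proof (rule borel_measurable_times)
    show "(\<lambda>x. cnj (h x)) \<in> borel_measurable \<mu>"
      by (rule measurable_compose[OF h_meas]) (intro borel_measurable_continuous_onI continuous_intros)
    show "(\<lambda>x. complex_of_real (cmod (h x) powr (p - 2) * \<omega> x)) \<in> borel_measurable \<mu>"
      by (rule measurable_compose[OF _ borel_measurable_of_real]) measurable
  qed
  have g_norm: "cmod (g x) = cmod (h x) powr (p - 1) * \<bar>\<omega> x\<bar>" for x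
  proof -
    have "cmod (h x) * cmod (h x) powr (p - 2) = cmod (h x) powr (p - 1)"
      using powr_mult_base[of "cmod (h x)" "p - 2"] by simp
    then show ?thesis by (simp add: g_def norm_mult abs_mult mult.assoc[symmetric])
  qed
  have hg: "h x * g x = of_real (cmod (h x) powr p * \<omega> x)" for x
  proof -
    have "h x * g x = (h x * cnj (h x)) * of_real (cmod (h x) powr (p - 2) * \<omega> x)" by (simp add: g_def)
    also have "\<dots> = of_real ((cmod (h x))\<^sup>2 * (cmod (h x) powr (p - 2) * \<omega> x))"
      by (simp add: complex_norm_square[symmetric])
    also have "(cmod (h x))\<^sup>2 * (cmod (h x) powr (p - 2) * \<omega> x) = cmod (h x) powr p * \<omega> x"
      using powr_mult_base[of "cmod (h x)" "p - 2"] powr_mult_base[of "cmod (h x)" "p - 1"]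
      by (simp add: power2_eq_square)
    finally show ?thesis .
  qed
  \<comment> \<open>As a finite sum, \<open>h\<close> is bounded, and bounded multiples of \<open>\<omega>\<close> are integrable on \<open>Q\<close>; this makes \<open>Y\<close> finite.\<close>
  have bdd_int: "set_integrable \<mu> Q (\<lambda>x. b x * \<omega> x)"
    if "b \<in> borel_measurable \<mu>" "\<And>x. \<bar>b x\<bar> \<le> M" for b :: "real \<Rightarrow> real" and M
    unfolding set_integrable_def
  proof (rule Bochner_Integration.integrable_bound)
    show "integrable \<mu> (\<lambda>x. M * (indicator Q x *\<^sub>R \<omega> x))"
      using om_int by (simp add: set_integrable_def)
    show "(\<lambda>x. indicator Q x *\<^sub>R (b x * \<omega> x)) \<in> borel_measurable \<mu>"
      using that(1) N_sets[of "[]"] by (intro borel_measurable_scaleR borel_measurable_indicator borel_measurable_times) auto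
    show "AE x in \<mu>. norm (indicator Q x *\<^sub>R (b x * \<omega> x)) \<le> norm (M * (indicator Q x *\<^sub>R \<omega> x))"
    proof (rule AE_I2)
      fix x
      have "\<bar>b x\<bar> \<le> \<bar>M\<bar>" using that(2)[of x] by linarith
      then show "norm (indicator Q x *\<^sub>R (b x * \<omega> x)) \<le> norm (M * (indicator Q x *\<^sub>R \<omega> x))"
        by (auto simp: indicator_def abs_mult intro: mult_right_mono)
    qed
  qed
  have f_int: "set_integrable \<mu> Q f"
    unfolding set_integrable_def
  proof (rule Bochner_Integration.integrable_bound)
    show "integrable \<mu> (\<lambda>x. B * (indicator Q x *\<^sub>R (1::real)))"
      using one_int by (simp add: set_integrable_def)
    show "(\<lambda>x. indicator Q x *\<^sub>R f x) \<in> borel_measurable \<mu>"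
      using f_meas N_sets[of "[]"] by (intro borel_measurable_scaleR borel_measurable_indicator) auto
    show "AE x in \<mu>. norm (indicator Q x *\<^sub>R f x) \<le> norm (B * (indicator Q x *\<^sub>R (1::real)))"
    proof (rule AE_I2)
      fix x show "norm (indicator Q x *\<^sub>R f x) \<le> norm (B * (indicator Q x *\<^sub>R (1::real)))"
        using f_bd[of x] by (auto simp: indicator_def)
    qed
  qed
  have fn_int: "set_integrable \<mu> Q (\<lambda>x. cmod (f x))" by (rule set_integrable_norm[OF f_int])
  have fp_int: "set_integrable \<mu> Q (\<lambda>x. cmod (f x) powr p * \<omega> x)"
    by (rule bdd_int[of _ "B powr p"]) (use f_meas f_bd p in \<open>auto intro!: powr_mono2\<close>)
  have hp_int: "set_integrable \<mu> Q (\<lambda>x. cmod (h x) powr p * \<omega> x)"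
    by (rule bdd_int[of _ "H powr p"]) (use h_bd p in \<open>auto intro!: powr_mono2\<close>)
  have h1_int: "set_integrable \<mu> Q (\<lambda>x. cmod (h x) powr (p - 1) * \<omega> x)"
    by (rule bdd_int[of _ "H powr (p - 1)"]) (use h_bd p in \<open>auto intro!: powr_mono2\<close>)
  have gn_int: "set_integrable \<mu> Q (\<lambda>x. cmod (g x))"
  proof -
    have "set_integrable \<mu> Q (\<lambda>x. norm (cmod (h x) powr (p - 1) * \<omega> x))" by (rule set_integrable_norm[OF h1_int])
    then show ?thesis by (simp add: g_norm abs_mult)
  qed
  have g_int: "set_integrable \<mu> Q g"
    unfolding set_integrable_def
  proof (rule Bochner_Integration.integrable_bound)
    show "integrable \<mu> (\<lambda>x. indicator Q x *\<^sub>R cmod (g x))" using gn_int by (simp add: set_integrable_def)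
    show "(\<lambda>x. indicator Q x *\<^sub>R g x) \<in> borel_measurable \<mu>"
      using N_sets[of "[]"] by (intro borel_measurable_scaleR borel_measurable_indicator g_meas) auto
  qed (auto simp: indicator_def)
  define F where "F = node_int (\<lambda>x. cmod (f x))"
  define G where "G = node_int (\<lambda>x. cmod (g x))"
  define X where "X = node_int (\<lambda>x. cmod (f x) powr p * \<omega> x)"
  define Y where "Y = node_int (\<lambda>x. cmod (h x) powr p * \<omega> x)"
  have wf: "weighted_avg p (node_int \<sigma>) F X"
    unfolding F_def X_def
  proof (rule weighted_avg_node_int[OF p sg_int fn_int fp_int sg_pos])
    show "AE x in \<mu>. cmod (f x) powr p * \<omega> x = (cmod (f x) / \<sigma> x) powr p * \<sigma> x"
      using om_pos
    proof eventually_elim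
      case (elim x)
      have "\<sigma> x powr (1 - p) = \<omega> x" using elim q1(5) by (simp add: sg_eq powr_powr)
      then show ?case using elim powr_quotient_mult[of "\<sigma> x" "cmod (f x)" p] by (simp add: sg_eq)
    qed
  qed simp
  have wg: "weighted_avg q (node_int \<omega>) G Y"
    unfolding G_def Y_def
  proof (rule weighted_avg_node_int[OF q1(1) om_int gn_int hp_int om_pos])
    show "AE x in \<mu>. cmod (h x) powr p * \<omega> x = (cmod (g x) / \<omega> x) powr q * \<omega> x"
      using om_pos by eventually_elim (simp add: g_norm powr_powr q1(3))
  qed simp
  have hf: "haar_form node_measure \<beta> F G (node_int f) (node_int g)"
  proof unfold_locales
    show "1 \<le> \<beta>" by (rule balanced_node(3)[OF balanced Q])
    show "m_node node_measure (b # w) \<le> \<beta> * m_node node_measure w" "m_node node_measure w \<le> \<beta> * m_node node_measure (b # w)" for b w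
      using balanced_node(1,2)[OF balanced Q, where b = b and w = w] by (simp_all only: m_meas_N)
  qed (auto simp: F_def G_def f_int g_int fn_int gn_int node_int_add node_int_nonneg node_int_le_norm)
  obtain n where n: "W \<subseteq> below n []"
  proof
    show "W \<subseteq> below (Max (insert 0 (length ` W))) []" using W by (auto simp: below_Nil)
  qed
  have Y_le: "Y [] \<le> (\<Sum>w\<in>W. (\<Sum>u | length u = s. haar_coeff node_measure (node_int f) (u @ w)) * (\<Sum>v | length v = t. haar_coeff node_measure (node_int g) (v @ w)))"
  proof -
    have hi: "integrable \<mu> (\<lambda>x. g x * of_real (haar \<mu> (N v) x))" for v by (rule haar_integral(1)[OF g_int])
    have "complex_of_real (Y []) = (LINT x|\<mu>. of_real (indicator Q x *\<^sub>R (cmod (h x) powr p * \<omega> x)))"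
      unfolding Y_def node_int_def set_lebesgue_integral_def by (simp only: node_ivl.simps integral_complex_of_real)
    also have "\<dots> = (LINT x|\<mu>. h x * g x)"
      unfolding hg by (intro Bochner_Integration.integral_cong) (auto simp: indicator_def h_out)
    also have "\<dots> = (LINT x|\<mu>. (\<Sum>w\<in>W. \<Sum>u | length u = s. \<Sum>v | length v = t. ?a w u v * (g x * of_real (haar \<mu> (N (v @ w)) x))))"
      unfolding h_eq sum_distrib_right
      by (intro Bochner_Integration.integral_cong sum.cong refl) (simp only: mult_ac)
    also have "\<dots> = (\<Sum>w\<in>W. \<Sum>u | length u = s. \<Sum>v | length v = t. ?a w u v * (LINT x|\<mu>. g x * of_real (haar \<mu> (N (v @ w)) x)))"
      using hi by (simp add: Bochner_Integration.integral_sum Bochner_Integration.integrable_sum)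
    finally have "cmod (complex_of_real (Y [])) \<le> (\<Sum>w\<in>W. \<Sum>u | length u = s. \<Sum>v | length v = t.
      cmod (?a w u v * (LINT x|\<mu>. g x * of_real (haar \<mu> (N (v @ w)) x))))"
      by (simp only:) (intro order_trans[OF norm_sum] sum_mono order_refl)
    also have "\<dots> \<le> (\<Sum>w\<in>W. \<Sum>u | length u = s. \<Sum>v | length v = t. haar_coeff node_measure (node_int f) (u @ w) * haar_coeff node_measure (node_int g) (v @ w))"
    proof (intro sum_mono)
      fix w u v :: node assume *: "u \<in> {u. length u = s}" "v \<in> {v. length v = t}"
      have "cmod (c (u @ w)) = haar_coeff node_measure (node_int f) (u @ w)" unfolding c_def by (rule haar_integral(2)[OF f_int])
      moreover have "cmod (\<alpha> (N w) (N (u @ w)) (N (v @ w))) \<le> 1" using coeff_N[OF \<alpha>] * by simp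
      moreover have "0 \<le> haar_coeff node_measure (node_int f) (u @ w) * haar_coeff node_measure (node_int g) (v @ w)"
        using m_node_pos by (simp add: haar_coeff_def)
      ultimately show "cmod (?a w u v * (LINT x|\<mu>. g x * of_real (haar \<mu> (N (v @ w)) x)))
        \<le> haar_coeff node_measure (node_int f) (u @ w) * haar_coeff node_measure (node_int g) (v @ w)"
        using mult_right_mono[of "cmod (\<alpha> (N w) (N (u @ w)) (N (v @ w)))" 1
            "haar_coeff node_measure (node_int f) (u @ w) * haar_coeff node_measure (node_int g) (v @ w)"]
        by (simp add: norm_mult haar_integral(2)[OF g_int] mult.assoc)
    qed
    also have "\<dots> = (\<Sum>w\<in>W. (\<Sum>u | length u = s. haar_coeff node_measure (node_int f) (u @ w)) * (\<Sum>v | length v = t. haar_coeff node_measure (node_int g) (v @ w)))"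
      by (simp only: sum_product)
    finally show ?thesis by simp
  qed
  define R where "R = tree_const \<beta> p q \<kappa> * (A powr (1 / p) * (L powr (1 / p) + L' powr (1 / q)))"
  have coeff_nonneg: "0 \<le> haar_coeff node_measure \<phi> v" for \<phi> v using m_node_pos by (simp add: haar_coeff_def)
  note Y_le
  also have "(\<Sum>w\<in>W. (\<Sum>u | length u = s. haar_coeff node_measure (node_int f) (u @ w)) * (\<Sum>v | length v = t. haar_coeff node_measure (node_int g) (v @ w)))
    \<le> (\<Sum>w\<in>below n []. (\<Sum>u | length u = s. haar_coeff node_measure (node_int f) (u @ w)) * (\<Sum>v | length v = t. haar_coeff node_measure (node_int g) (v @ w)))"
    by (rule sum_mono2[OF _ n]) (auto intro!: mult_nonneg_nonneg sum_nonneg coeff_nonneg)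
  also have "\<dots> \<le> tree_const \<beta> p q \<kappa> * (A powr (1 / p) * (L powr (1 / p) + L' powr (1 / q)) * (X [] powr (1 / p) * Y [] powr (1 / q)))"
    by (rule tree_bound[OF hf wf wg q_def A_nonneg L st Ap1 Ap2 packing])
  also have "\<dots> = R * X [] powr (1 / p) * Y [] powr (1 / q)" by (simp only: R_def mult.assoc)
  finally have YR: "Y [] \<le> R * X [] powr (1 / p) * Y [] powr (1 / q)" .
  interpret wX: weighted_avg p "node_int \<sigma>" F X by (rule wf)
  interpret wY: weighted_avg q "node_int \<omega>" G Y by (rule wg)
  have "Y [] \<le> R powr p * X []"
  proof (cases "Y [] = 0")
    case True then show ?thesis by simp
  next
    case False
    with wY.X_nonneg[of "[]"] have Y0: "0 < Y []" by (auto simp only: less_le)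
    have "Y [] = Y [] powr (1 / p) * Y [] powr (1 / q)" using Y0 by (simp add: powr_add[symmetric] q1(4))
    with YR have "Y [] powr (1 / p) * Y [] powr (1 / q) \<le> (R * X [] powr (1 / p)) * Y [] powr (1 / q)" by simp
    then have le: "Y [] powr (1 / p) \<le> R * X [] powr (1 / p)" using Y0 by simp
    then have "(Y [] powr (1 / p)) powr p \<le> (R * X [] powr (1 / p)) powr p" using p by (intro powr_mono2) auto
    then show ?thesis using p Y0 by (simp add: powr_mult powr_powr)
  qed
  then have le: "ennreal (Y []) \<le> ennreal (R powr p) * ennreal (X [])"
    by (simp add: ennreal_mult[symmetric] ennreal_leI)
  have nnp: "AE x in \<mu>. 0 \<le> cmod (\<phi> x) powr p * \<omega> x" for \<phi> :: "real \<Rightarrow> complex"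
    using om_pos by eventually_elim simp
  have "(\<integral>\<^sup>+x. ennreal (cmod (h x) powr p) * ennreal (\<omega> x) \<partial>\<mu>) = (\<integral>\<^sup>+x\<in>N []. ennreal (cmod (h x) powr p * \<omega> x) \<partial>\<mu>)"
    using p by (intro nn_integral_cong) (auto simp: indicator_def h_out ennreal_mult')
  also have "\<dots> = ennreal (Y [])" unfolding Y_def by (rule nn_node_int[OF hp_int nnp])
  also note le
  also have "ennreal (X []) = (\<integral>\<^sup>+x\<in>N []. ennreal (cmod (f x) powr p * \<omega> x) \<partial>\<mu>)"
    unfolding X_def by (rule nn_node_int[OF fp_int nnp, symmetric])
  also have "\<dots> \<le> (\<integral>\<^sup>+x. ennreal (cmod (f x) powr p) * ennreal (\<omega> x) \<partial>\<mu>)"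
    by (intro nn_integral_mono) (auto simp: indicator_def ennreal_mult')
  finally show ?thesis unfolding h_def R_def by (simp add: mult_left_mono)
qed

end

section \<open>Passing to the limit\<close>

lemma haar_borel: "sets \<mu> = sets borel \<Longrightarrow> (\<lambda>x. haar \<mu> I x) \<in> borel_measurable \<mu>"
  unfolding haar_def left_half_def right_half_def by (simp add: measurable_cong_sets[of \<mu> borel borel borel])

lemma haar_block_measurable:
  assumes "sets \<mu> = sets borel"
  shows "(\<lambda>x. haar_block \<mu> D s t \<alpha> f I x) \<in> borel_measurable \<mu>"
  unfolding haar_block_def
  by (intro borel_measurable_sum borel_measurable_times borel_measurable_const
      measurable_compose[OF haar_borel[OF assms] borel_measurable_of_real])

text \<open>Convergence in \<open>L\<^sup>2\<close> along the net of finite subsets yields a sequence, and a subsequence of it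
  converges almost everywhere.\<close>

lemma haar_shift_AE_limit:
  assumes sets: "sets \<mu> = sets borel" and T: "haar_shift \<mu> D s t \<alpha> T" and f: "in_Lp \<mu> 2 f"
  obtains \<F> :: "nat \<Rightarrow> real set set" where "\<And>n. finite (\<F> n)" "\<And>n. \<F> n \<subseteq> D"
    "AE x in \<mu>. (\<lambda>n. \<Sum>I\<in>\<F> n. haar_block \<mu> D s t \<alpha> f I x) \<longlonglongrightarrow> T f x"
proof -
  let ?S = "\<lambda>F x. \<Sum>I\<in>F. haar_block \<mu> D s t \<alpha> f I x"
  let ?N = "\<lambda>F. Lp_norm \<mu> 2 (\<lambda>x. T f x - ?S F x)"
  have Tm: "T f \<in> borel_measurable \<mu>" and lim: "(?N \<longlongrightarrow> 0) (finite_subsets_at_top D)"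
    using T f by (auto simp: haar_shift_def in_Lp_def)
  have Sm: "(\<lambda>x. ?S F x) \<in> borel_measurable \<mu>" for F
    by (intro borel_measurable_sum haar_block_measurable[OF sets])
  have "\<exists>F. finite F \<and> F \<subseteq> D \<and> ?N F < ennreal (1 / Suc n)" for n
  proof -
    have "eventually (\<lambda>F. ?N F < ennreal (1 / Suc n)) (finite_subsets_at_top D)"
      using lim by (rule order_tendstoD) simp
    moreover have "eventually (\<lambda>F. finite F \<and> F \<subseteq> D) (finite_subsets_at_top D)"
      by (rule eventually_finite_subsets_at_top_weakI) auto
    ultimately have "eventually (\<lambda>F. finite F \<and> F \<subseteq> D \<and> ?N F < ennreal (1 / Suc n)) (finite_subsets_at_top D)"
      by eventually_elim auto
    then show ?thesis by (rule eventually_happens'[OF finite_subsets_at_top_neq_bot])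
  qed
  then obtain \<F> where \<F>: "\<And>n. finite (\<F> n)" "\<And>n. \<F> n \<subseteq> D" "\<And>n. ?N (\<F> n) < ennreal (1 / Suc n)"
    by metis
  define u where "u n x = (cmod (T f x - ?S (\<F> n) x))\<^sup>2" for n x
  have um [measurable]: "u n \<in> borel_measurable \<mu>" for n
    unfolding u_def
    by (intro borel_measurable_power measurable_compose[OF borel_measurable_diff[OF Tm Sm] borel_measurable_norm])
  have nn: "(\<integral>\<^sup>+x. ennreal (u n x) \<partial>\<mu>) \<le> ennreal (1 / Suc n)" for n
  proof -
    let ?y = "\<integral>\<^sup>+x. ennreal (u n x) \<partial>\<mu>"
    have y: "?y = (\<integral>\<^sup>+x. ennreal (cmod (T f x - ?S (\<F> n) x) powr 2) \<partial>\<mu>)"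
      by (intro nn_integral_cong) (simp add: u_def)
    have lt: "epowr ?y (1 / 2) < ennreal (1 / Suc n)" using \<F>(3)[of n] unfolding Lp_norm_def y .
    then have "?y \<noteq> \<infinity>" by (auto simp: epowr_def)
    then obtain r where r: "?y = ennreal r" "0 \<le> r" by (cases ?y) auto
    have "r powr (1 / 2) < 1 / Suc n" using lt r by (simp add: epowr_ennreal ennreal_less_iff)
    then have "sqrt r < 1 / Suc n" using r by (simp add: powr_half_sqrt)
    then have "r \<le> (1 / Suc n)\<^sup>2" using r real_sqrt_le_iff[of r "(1 / Suc n)\<^sup>2"] by simp
    also have "\<dots> \<le> 1 / Suc n"
      using mult_left_mono[of "1 / real (Suc n)" 1 "1 / real (Suc n)"] by (simp add: power2_eq_square)
    finally show ?thesis using r by (simp add: ennreal_leI)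
  qed
  have int: "integrable \<mu> (u n)" for n
  proof (rule integrableI_bounded)
    have "(\<integral>\<^sup>+x. ennreal (norm (u n x)) \<partial>\<mu>) = (\<integral>\<^sup>+x. ennreal (u n x) \<partial>\<mu>)" by (simp add: u_def)
    also have "\<dots> < \<infinity>" using nn[of n] by (rule le_less_trans) simp
    finally show "(\<integral>\<^sup>+x. ennreal (norm (u n x)) \<partial>\<mu>) < \<infinity>" .
  qed (rule um)
  have "(\<integral>x. norm (u n x) \<partial>\<mu>) \<le> 1 / Suc n" for n
  proof -
    have "ennreal (\<integral>x. norm (u n x) \<partial>\<mu>) = (\<integral>\<^sup>+x. ennreal (norm (u n x)) \<partial>\<mu>)"
      using int[of n] by (intro nn_integral_eq_integral[symmetric]) auto
    also have "\<dots> \<le> ennreal (1 / Suc n)" using nn[of n] by (simp add: u_def)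
    finally show ?thesis by (simp add: ennreal_le_iff)
  qed
  then have "(\<lambda>n. \<integral>x. norm (u n x) \<partial>\<mu>) \<longlonglongrightarrow> 0"
    by (intro tendsto_sandwich[OF _ _ tendsto_const LIMSEQ_Suc[OF lim_1_over_n]]) (auto intro!: always_eventually)
  from tendsto_L1_AE_subseq[OF int this] obtain r where
    r: "AE x in \<mu>. (\<lambda>n. u (r n) x) \<longlonglongrightarrow> 0" by blast
  have "AE x in \<mu>. (\<lambda>n. ?S (\<F> (r n)) x) \<longlonglongrightarrow> T f x"
    using r
  proof eventually_elim
    case (elim x)
    then have "(\<lambda>n. sqrt (u (r n) x)) \<longlonglongrightarrow> sqrt 0" by (rule tendsto_real_sqrt)
    then have "(\<lambda>n. cmod (?S (\<F> (r n)) x - T f x)) \<longlonglongrightarrow> 0" by (simp add: u_def norm_minus_commute)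
    then show ?case by (simp add: tendsto_norm_zero_iff LIM_zero_iff)
  qed
  then show ?thesis using that[of "\<lambda>n. \<F> (r n)"] \<F> by blast
qed

text \<open>Fatou's lemma.\<close>

lemma nn_integral_limit_le:
  fixes g :: "nat \<Rightarrow> real \<Rightarrow> complex" and h :: "real \<Rightarrow> complex"
  assumes p: "0 < p" and om: "\<omega> \<in> borel_measurable \<mu>" and g: "\<And>n. g n \<in> borel_measurable \<mu>"
    and lim: "AE x in \<mu>. (\<lambda>n. g n x) \<longlonglongrightarrow> h x"
    and le: "\<And>n. (\<integral>\<^sup>+x. ennreal (cmod (g n x) powr p) * ennreal (\<omega> x) \<partial>\<mu>) \<le> C"
  shows "(\<integral>\<^sup>+x. ennreal (cmod (h x) powr p) * ennreal (\<omega> x) \<partial>\<mu>) \<le> C"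
proof -
  let ?u = "\<lambda>n x. ennreal (cmod (g n x) powr p * \<omega> x)"
  have meas: "(\<lambda>x. ?u n x) \<in> borel_measurable \<mu>" for n
    using om g[of n] by measurable
  have "(\<integral>\<^sup>+x. ennreal (cmod (h x) powr p) * ennreal (\<omega> x) \<partial>\<mu>) = (\<integral>\<^sup>+x. liminf (\<lambda>n. ?u n x) \<partial>\<mu>)"
  proof (rule nn_integral_cong_AE)
    show "AE x in \<mu>. ennreal (cmod (h x) powr p) * ennreal (\<omega> x) = liminf (\<lambda>n. ?u n x)"
      using lim
    proof eventually_elim
      case (elim x)
      have "(\<lambda>n. cmod (g n x)) \<longlonglongrightarrow> cmod (h x)" by (rule tendsto_norm[OF elim])
      then have "(\<lambda>n. cmod (g n x) powr p) \<longlonglongrightarrow> cmod (h x) powr p"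
        by (rule tendsto_powr2[OF _ tendsto_const]) (use p in auto)
      then have "(\<lambda>n. ?u n x) \<longlonglongrightarrow> ennreal (cmod (h x) powr p * \<omega> x)"
        by (intro tendsto_ennrealI tendsto_mult_right)
      then have "liminf (\<lambda>n. ?u n x) = ennreal (cmod (h x) powr p * \<omega> x)"
        by (rule lim_imp_Liminf[OF sequentially_bot])
      then show ?case by (simp add: ennreal_mult')
    qed
  qed
  also have "\<dots> \<le> liminf (\<lambda>n. \<integral>\<^sup>+x. ?u n x \<partial>\<mu>)" by (rule nn_integral_liminf[OF meas])
  also have "\<dots> \<le> liminf (\<lambda>n::nat. C)"
    using le by (intro Liminf_mono always_eventually allI) (simp add: ennreal_mult')
  also have "\<dots> = C" by (simp add: Liminf_const)
  finally show ?thesis .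
qed

lemma epowr_le:
  assumes "x \<le> ennreal (B powr p) * y" "epowr y (1 / p) < \<infinity>" "0 \<le> B" "0 < p"
  shows "epowr x (1 / p) \<le> ennreal B * epowr y (1 / p)"
proof -
  have "y \<noteq> \<infinity>" using assms(2) by (auto simp: epowr_def)
  then obtain r where r: "y = ennreal r" "0 \<le> r" by (cases y) auto
  have le: "x \<le> ennreal (B powr p * r)" using assms(1) r by (simp add: ennreal_mult)
  then have "x \<noteq> \<infinity>" by (auto simp: top_unique)
  then obtain z where z: "x = ennreal z" "0 \<le> z" by (cases x) auto
  have "z \<le> B powr p * r" using le z r by (simp add: ennreal_le_iff)
  then have "z powr (1 / p) \<le> (B powr p * r) powr (1 / p)" using z assms by (intro powr_mono2) auto
  also have "\<dots> = B * r powr (1 / p)" using assms by (simp add: powr_mult powr_powr)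
  finally show ?thesis using z r assms by (simp add: epowr_ennreal ennreal_mult[symmetric] ennreal_leI)
qed

text \<open>Fatou's lemma along partial sums that converge almost everywhere. The shift is only tested on bounded
  functions with compact support, and these belong to \<open>L\<^sup>2\<close>.\<close>

lemma weighted_op_norm_le:
  assumes lf: "locally_finite_borel \<mu>" and w: "is_weight \<mu> \<omega>" and p: "1 < p" and B: "0 \<le> B"
    and T: "haar_shift \<mu> D s t \<alpha> T"
    and fin: "\<And>f b \<F>. f \<in> borel_measurable \<mu> \<Longrightarrow> (\<And>x. cmod (f x) \<le> b) \<Longrightarrow> finite \<F> \<Longrightarrow> \<F> \<subseteq> D \<Longrightarrow>
      (\<integral>\<^sup>+x. ennreal (cmod (\<Sum>I\<in>\<F>. haar_block \<mu> D s t \<alpha> f I x) powr p) * ennreal (\<omega> x) \<partial>\<mu>)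
      \<le> ennreal (B powr p) * (\<integral>\<^sup>+x. ennreal (cmod (f x) powr p) * ennreal (\<omega> x) \<partial>\<mu>)"
  shows "weighted_op_norm \<mu> p \<omega> T \<le> ennreal B"
  unfolding weighted_op_norm_def
proof (rule Inf_lower, rule CollectI, intro allI impI)
  fix f :: "real \<Rightarrow> complex"
  assume f: "in_Lp (weighted \<mu> \<omega>) p f" "bounded (range f)" "\<exists>K. compact K \<and> (\<forall>x. x \<notin> K \<longrightarrow> f x = 0)"
  have sets: "sets \<mu> = sets borel" using lf by (simp add: locally_finite_borel_def)
  have om: "\<omega> \<in> borel_measurable \<mu>" by (rule weight_measurable[OF sets w])
  have fm: "f \<in> borel_measurable \<mu>"
    using f(1) by (simp add: in_Lp_def weighted_def measurable_cong_sets[OF sets_density refl])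
  obtain b where b: "\<And>x. cmod (f x) \<le> b" using f(2) by (auto simp: bounded_iff)
  obtain K where K: "compact K" "\<And>x. x \<notin> K \<Longrightarrow> f x = 0" using f(3) by blast
  have L2: "in_Lp \<mu> 2 f"
  proof -
    have "(\<integral>\<^sup>+x. ennreal (cmod (f x) powr 2) \<partial>\<mu>) \<le> (\<integral>\<^sup>+x. ennreal (b\<^sup>2) * indicator K x \<partial>\<mu>)"
    proof (rule nn_integral_mono)
      fix x show "ennreal (cmod (f x) powr 2) \<le> ennreal (b\<^sup>2) * indicator K x"
        using b[of x] K(2)[of x] by (cases "x \<in> K") (auto intro!: ennreal_leI power_mono)
    qed
    also have "\<dots> = ennreal (b\<^sup>2) * emeasure \<mu> K"
      using K(1) sets by (intro nn_integral_cmult_indicator) (simp add: borel_compact)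
    also have "\<dots> < \<infinity>" using locally_finite_compact[OF lf K(1)] by (simp add: ennreal_mult_less_top)
    finally have "(\<integral>\<^sup>+x. ennreal (cmod (f x) powr 2) \<partial>\<mu>) < \<infinity>" .
    then show ?thesis using fm by (simp add: in_Lp_def Lp_norm_def epowr_def)
  qed
  obtain \<F> where \<F>: "\<And>n. finite (\<F> n)" "\<And>n. \<F> n \<subseteq> D"
    "AE x in \<mu>. (\<lambda>n. \<Sum>I\<in>\<F> n. haar_block \<mu> D s t \<alpha> f I x) \<longlonglongrightarrow> T f x"
    using haar_shift_AE_limit[OF sets T L2] by blast
  have le: "(\<integral>\<^sup>+x. ennreal (cmod (T f x) powr p) * ennreal (\<omega> x) \<partial>\<mu>)
    \<le> ennreal (B powr p) * (\<integral>\<^sup>+x. ennreal (cmod (f x) powr p) * ennreal (\<omega> x) \<partial>\<mu>)"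
  proof (rule nn_integral_limit_le[OF _ om _ \<F>(3)])
    show "(\<lambda>x. \<Sum>I\<in>\<F> n. haar_block \<mu> D s t \<alpha> f I x) \<in> borel_measurable \<mu>" for n
      by (intro borel_measurable_sum haar_block_measurable[OF sets])
  qed (use p fin[OF fm b \<F>(1,2)] in auto)
  have dens: "Lp_norm (weighted \<mu> \<omega>) p g = epowr (\<integral>\<^sup>+x. ennreal (cmod (g x) powr p) * ennreal (\<omega> x) \<partial>\<mu>) (1 / p)"
    if "g \<in> borel_measurable \<mu>" for g :: "real \<Rightarrow> complex"
    unfolding Lp_norm_def weighted_def using that om
    by (subst nn_integral_density) (auto simp: mult.commute)
  have Tm: "T f \<in> borel_measurable \<mu>" using T L2 by (auto simp: haar_shift_def in_Lp_def)
  show "Lp_norm (weighted \<mu> \<omega>) p (T f) \<le> ennreal B * Lp_norm (weighted \<mu> \<omega>) p f"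
    using f(1) unfolding in_Lp_def dens[OF fm] dens[OF Tm]
    by (intro epowr_le[OF le]) (use B p in auto)
qed

section \<open>The constants\<close>

text \<open>The three powers of the packing constant belong to the two ways of packing families for the weights.
  The absolute value makes the constant positive for every \<open>\<beta>\<close>.\<close>

definition final_const :: "real \<Rightarrow> real \<Rightarrow> nat \<Rightarrow> real" where
  "final_const \<beta> p \<kappa> = 1 + \<bar>tree_const \<beta> p (p / (p - 1)) \<kappa>\<bar> *
    (pack_const \<kappa> + (2 * pack_const \<kappa>) powr (p / (p - 1)) + (2 * pack_const \<kappa>) powr p)"

lemma pack_const_ge_1: "1 \<le> pack_const \<kappa>"
proof -
  have "(1::real) \<le> 2 ^ \<kappa>" by simp
  then have "1 \<le> 4 * (2::real) ^ Suc \<kappa>" unfolding power_Suc by linarith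
  then have "1 * 1 \<le> 4 * 2 ^ Suc \<kappa> * real (Suc (Suc \<kappa>))" by (intro mult_mono) auto
  then show ?thesis by (simp add: pack_const_def)
qed

lemma final_const_pos: "0 < final_const \<beta> p \<kappa>"
proof -
  have "0 \<le> \<bar>tree_const \<beta> p (p / (p - 1)) \<kappa>\<bar> *
    (pack_const \<kappa> + (2 * pack_const \<kappa>) powr (p / (p - 1)) + (2 * pack_const \<kappa>) powr p)"
    using pack_const_ge_1[of \<kappa>] by (intro mult_nonneg_nonneg) auto
  then show ?thesis unfolding final_const_def by linarith
qed

lemma powr_le_abs: "\<bar>r\<bar> \<le> B \<Longrightarrow> 0 \<le> p \<Longrightarrow> r powr p \<le> B powr p" for r B p :: real
proof -
  assume "\<bar>r\<bar> \<le> B" "0 \<le> p"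
  then have "\<bar>r\<bar> powr p \<le> B powr p" by (intro powr_mono2) auto
  moreover have "\<bar>r\<bar> powr p = r powr p" by (cases "0 \<le> r") (auto simp: powr_def ln_minus)
  ultimately show ?thesis by simp
qed

context weighted_tree
begin

definition Bound :: "real \<Rightarrow> real \<Rightarrow> real" where
  "Bound L L' = tree_const \<beta> p q \<kappa> * (A powr (1 / p) * (L powr (1 / p) + L' powr (1 / q)))"

lemma final_const_eq: "final_const \<beta> p \<kappa> = 1 + \<bar>tree_const \<beta> p q \<kappa>\<bar> *
    (pack_const \<kappa> + (2 * pack_const \<kappa>) powr q + (2 * pack_const \<kappa>) powr p)"
  by (simp add: final_const_def q_def)

lemma Bound_le:
  assumes "A powr (1 / p) * (L powr (1 / p) + L' powr (1 / q)) \<le>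
    (pack_const \<kappa> + (2 * pack_const \<kappa>) powr q + (2 * pack_const \<kappa>) powr p) * M" "0 \<le> M"
  shows "\<bar>Bound L L'\<bar> \<le> final_const \<beta> p \<kappa> * M"
proof -
  have "\<bar>Bound L L'\<bar> = \<bar>tree_const \<beta> p q \<kappa>\<bar> * (A powr (1 / p) * (L powr (1 / p) + L' powr (1 / q)))"
    by (simp add: Bound_def abs_mult)
  also have "\<dots> \<le> \<bar>tree_const \<beta> p q \<kappa>\<bar> *
    ((pack_const \<kappa> + (2 * pack_const \<kappa>) powr q + (2 * pack_const \<kappa>) powr p) * M)"
    by (rule mult_left_mono[OF assms(1)]) simp
  also have "\<dots> \<le> final_const \<beta> p \<kappa> * M"
    using assms(2) by (simp add: final_const_eq distrib_right mult.assoc)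
  finally show ?thesis .
qed

text \<open>The powers \<open>1 / p\<close> and \<open>1 / q\<close> of the packing constant are at most the constant itself.\<close>

lemma Bound_Ainf:
  assumes "0 \<le> a" "0 \<le> b"
  shows "\<bar>Bound (pack_const \<kappa> * a) (pack_const \<kappa> * b)\<bar>
    \<le> final_const \<beta> p \<kappa> * (A powr (1 / p) * (a powr (1 / p) + b powr (1 / q)))"
proof (rule Bound_le)
  let ?P = "pack_const \<kappa>"
  have P: "?P powr (1 / p) \<le> ?P" "?P powr (1 / q) \<le> ?P"
    using powr_mono[of "1 / p" 1 ?P] powr_mono[of "1 / q" 1 ?P] p q1(1) pack_const_ge_1[of \<kappa>] by auto
  have "(?P * a) powr (1 / p) + (?P * b) powr (1 / q) \<le> ?P * (a powr (1 / p) + b powr (1 / q))"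
    unfolding powr_mult distrib_left using P by (intro add_mono mult_right_mono) auto
  then have "A powr (1 / p) * ((?P * a) powr (1 / p) + (?P * b) powr (1 / q))
    \<le> A powr (1 / p) * (?P * (a powr (1 / p) + b powr (1 / q)))" by (rule mult_left_mono) simp
  also have "\<dots> = ?P * (A powr (1 / p) * (a powr (1 / p) + b powr (1 / q)))" by (simp only: mult_ac)
  also have "\<dots> \<le> (?P + (2 * ?P) powr q + (2 * ?P) powr p) * (A powr (1 / p) * (a powr (1 / p) + b powr (1 / q)))"
    by (intro mult_right_mono) auto
  finally show "A powr (1 / p) * ((?P * a) powr (1 / p) + (?P * b) powr (1 / q))
    \<le> (?P + (2 * ?P) powr q + (2 * ?P) powr p) * (A powr (1 / p) * (a powr (1 / p) + b powr (1 / q)))" .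
qed simp

text \<open>The packing constants come from \<open>Ap_packing\<close>. The exponents combine to
  \<open>1 / p + (q - 1) / p = 1 / (p - 1)\<close> and \<open>1 / p + 1 / q = 1\<close>, and \<open>A \<ge> 1\<close> allows the larger
  one.\<close>

lemma Bound_Ap:
  "\<bar>Bound (A powr (q - 1) * (2 * pack_const \<kappa>) powr q) (A * (2 * pack_const \<kappa>) powr p)\<bar>
    \<le> final_const \<beta> p \<kappa> * A powr (max 1 (1 / (p - 1)))"
proof (rule Bound_le)
  let ?P = "2 * pack_const \<kappa>" and ?m = "max 1 (1 / (p - 1))"
  have P: "1 \<le> ?P" using pack_const_ge_1[of \<kappa>] by simp
  have one: "A powr (1 / p) * (A powr (q - 1) * ?P powr q) powr (1 / p) \<le> ?P powr q * A powr ?m"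
  proof -
    have e: "1 / p + (q - 1) / p = 1 / (p - 1)" using p by (simp add: q_def field_simps)
    have "A powr (1 / p) * (A powr (q - 1) * ?P powr q) powr (1 / p) = A powr (1 / p + (q - 1) / p) * ?P powr (q / p)"
      by (simp add: powr_mult powr_powr powr_add)
    also have "\<dots> \<le> A powr ?m * ?P powr q"
      unfolding e using A_ge_1 P p q1(1) by (intro mult_mono powr_mono) (auto simp: field_simps)
    finally show ?thesis by (simp only: mult.commute)
  qed
  have two: "A powr (1 / p) * (A * ?P powr p) powr (1 / q) \<le> ?P powr p * A powr ?m"
  proof -
    have "A powr (1 / p) * (A * ?P powr p) powr (1 / q) = A powr (1 / p + 1 / q) * ?P powr (p / q)"
      by (simp add: powr_mult powr_powr powr_add)
    also have "\<dots> \<le> A powr ?m * ?P powr p"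
      unfolding q1(4) using A_ge_1 P p q1(1) by (intro mult_mono powr_mono) (auto simp: field_simps)
    finally show ?thesis by (simp only: mult.commute)
  qed
  have "0 \<le> pack_const \<kappa> * A powr ?m" using pack_const_ge_1[of \<kappa>] by simp
  then show "A powr (1 / p) * ((A powr (q - 1) * ?P powr q) powr (1 / p) + (A * ?P powr p) powr (1 / q))
    \<le> (pack_const \<kappa> + ?P powr q + ?P powr p) * A powr ?m"
    using one two unfolding distrib_left distrib_right by linarith
qed simp

lemma finite_shift:
  fixes f :: "real \<Rightarrow> complex"
  assumes f: "f \<in> borel_measurable \<mu>" "\<And>x. cmod (f x) \<le> b"
    and \<F>: "finite \<F>" "\<And>I. I \<in> \<F> \<Longrightarrow> \<exists>w. I = N w" and st: "s + t \<le> \<kappa>" and \<alpha>: "coeffs_bounded_by_1 D s t \<alpha>"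
    and L: "0 \<le> L" "0 \<le> L'"
    and packing: "\<And>S n z. (\<And>z. tsum n (\<lambda>v. if S v then node_measure v else 0) z \<le> pack_const \<kappa> * node_measure z) \<Longrightarrow>
      tsum n (\<lambda>v. if S v then node_int \<sigma> v else 0) z \<le> L * node_int \<sigma> z"
      "\<And>S n z. (\<And>z. tsum n (\<lambda>v. if S v then node_measure v else 0) z \<le> pack_const \<kappa> * node_measure z) \<Longrightarrow>
      tsum n (\<lambda>v. if S v then node_int \<omega> v else 0) z \<le> L' * node_int \<omega> z"
    and B: "\<bar>Bound L L'\<bar> \<le> B"
  shows "(\<integral>\<^sup>+x. ennreal (cmod (\<Sum>I\<in>\<F>. haar_block \<mu> D s t \<alpha> f I x) powr p) * ennreal (\<omega> x) \<partial>\<mu>)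
    \<le> ennreal (B powr p) * (\<integral>\<^sup>+x. ennreal (cmod (f x) powr p) * ennreal (\<omega> x) \<partial>\<mu>)"
proof -
  have inj: "inj N" using inj_node_ivl_append[OF Q, of "[]"] by simp
  define W where "W = {w. N w \<in> \<F>}"
  have FW: "\<F> = N ` W" using \<F>(2) by (auto simp: W_def)
  have W: "finite W" using \<F>(1) unfolding FW by (rule finite_imageD) (use inj in \<open>auto intro: inj_on_subset\<close>)
  have "(\<Sum>I\<in>\<F>. haar_block \<mu> D s t \<alpha> f I x) = (\<Sum>w\<in>W. haar_block \<mu> D s t \<alpha> f (N w) x)" for x
    unfolding FW by (rule sum.reindex_cong[OF _ refl refl]) (use inj in \<open>auto intro: inj_on_subset\<close>)
  then have "(\<integral>\<^sup>+x. ennreal (cmod (\<Sum>I\<in>\<F>. haar_block \<mu> D s t \<alpha> f I x) powr p) * ennreal (\<omega> x) \<partial>\<mu>)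
    \<le> ennreal (Bound L L' powr p) * (\<integral>\<^sup>+x. ennreal (cmod (f x) powr p) * ennreal (\<omega> x) \<partial>\<mu>)"
    unfolding Bound_def using shift_on_tree[OF f W st \<alpha> L packing] by simp
  also have "\<dots> \<le> ennreal (B powr p) * (\<integral>\<^sup>+x. ennreal (cmod (f x) powr p) * ennreal (\<omega> x) \<partial>\<mu>)"
    by (intro mult_right_mono ennreal_leI powr_le_abs[OF B]) (use p in auto)
  finally show ?thesis .
qed

lemma packing_Ap:
  assumes "\<And>z. tsum n (\<lambda>v. if S v then node_measure v else 0) z \<le> pack_const \<kappa> * node_measure z"
  shows "tsum n (\<lambda>v. if S v then node_int \<omega> v else 0) z \<le> A * (2 * pack_const \<kappa>) powr p * node_int \<omega> z"
    and "tsum n (\<lambda>v. if S v then node_int \<sigma> v else 0) z \<le> A powr (q - 1) * (2 * pack_const \<kappa>) powr q * node_int \<sigma> z"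
proof -
  have pt: "positive_tree node_measure" by (rule positive_tree_axioms)
  show "tsum n (\<lambda>v. if S v then node_int \<omega> v else 0) z \<le> A * (2 * pack_const \<kappa>) powr p * node_int \<omega> z"
    by (rule Ap_packing[OF pt dual_om pack_const_ge_1 A_nonneg Ap1 assms])
  have "node_int \<sigma> w / node_measure w * (node_int \<omega> w / node_measure w) powr (q - 1) \<le> A powr (q - 1)" for w
  proof -
    have "(node_int \<omega> w / node_measure w * (node_int \<sigma> w / node_measure w) powr (p - 1)) powr (q - 1) \<le> A powr (q - 1)"
      using q1(1) by (intro powr_mono2 Ap1 mult_nonneg_nonneg node_int_avg_nonneg) auto
    then have "(node_int \<omega> w / node_measure w) powr (q - 1) * (node_int \<sigma> w / node_measure w) powr ((p - 1) * (q - 1)) \<le> A powr (q - 1)"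
      unfolding powr_mult powr_powr .
    moreover have "(p - 1) * (q - 1) = 1" using p by (simp add: q1(2))
    ultimately show ?thesis using node_int_nonneg[OF nonneg_AE(2), of w] by (simp add: mult.commute)
  qed
  from Ap_packing[OF pt dual_sg pack_const_ge_1 powr_ge_zero this assms]
  show "tsum n (\<lambda>v. if S v then node_int \<sigma> v else 0) z \<le> A powr (q - 1) * (2 * pack_const \<kappa>) powr q * node_int \<sigma> z" .
qed

end

context meas_tree
begin

text \<open>The maximal function on \<open>Q\<close> is at least the average over \<open>Q\<close>.\<close>

lemma Ainf_char_pos:
  fixes v :: "real \<Rightarrow> real"
  assumes int: "set_integrable \<mu> Q v" and v: "AE x in \<mu>. 0 < v x"
  shows "0 < Ainf_char \<mu> D v"
proof -
  let ?v = "\<lambda>y. v y * indicator Q y"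
  have Qpos: "Q \<in> positive_intervals D \<mu>"
    using Q node_measure_pos[of "[]"] emeasure_N[of "[]"] by (simp add: positive_intervals_def)
  have nn: "AE x in \<mu>. 0 \<le> v x" using v by eventually_elim simp
  have t: "0 < node_int v []" by (rule node_int_pos[OF int v])
  have I: "(\<integral>\<^sup>+y\<in>Q. ennreal (v y) \<partial>\<mu>) = ennreal (node_int v [])" using nn_node_int[OF int nn, of "[]"] by simp
  have "(\<integral>\<^sup>+y\<in>Q. ennreal \<bar>?v y\<bar> \<partial>\<mu>) = ennreal (node_int v [])"
    unfolding I[symmetric]
    by (rule nn_integral_cong_AE) (use nn in \<open>auto simp: indicator_def elim!: eventually_mono\<close>)
  then have avg: "avg \<mu> Q (\<lambda>y. \<bar>?v y\<bar>) = ennreal (node_int v [] / node_measure [])"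
    using t node_measure_pos[of "[]"] emeasure_N[of "[]"] by (simp add: avg_def divide_ennreal)
  have "ennreal (node_int v []) = ennreal (node_int v [] / node_measure []) * emeasure \<mu> Q"
    using node_measure_pos[of "[]"] t emeasure_N[of "[]"] by (simp add: ennreal_mult[symmetric])
  also have "\<dots> = (\<integral>\<^sup>+x. ennreal (node_int v [] / node_measure []) * indicator Q x \<partial>\<mu>)"
    using N_sets[of "[]"] by (simp add: nn_integral_cmult_indicator)
  also have "\<dots> \<le> (\<integral>\<^sup>+x\<in>Q. dyadic_maximal \<mu> D ?v x \<partial>\<mu>)"
  proof (rule nn_integral_mono)
    fix x
    have "avg \<mu> Q (\<lambda>y. \<bar>?v y\<bar>) * indicator Q x \<le> dyadic_maximal \<mu> D ?v x"
      unfolding dyadic_maximal_def by (rule SUP_upper[OF Qpos])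
    then show "ennreal (node_int v [] / node_measure []) * indicator Q x \<le> dyadic_maximal \<mu> D ?v x * indicator Q x"
      unfolding avg by (cases "x \<in> Q") auto
  qed
  finally have M: "ennreal (node_int v []) \<le> (\<integral>\<^sup>+x\<in>Q. dyadic_maximal \<mu> D ?v x \<partial>\<mu>)" .
  have "0 < ennreal (node_int v [])" using t by simp
  then have "0 < (\<integral>\<^sup>+x\<in>Q. dyadic_maximal \<mu> D ?v x \<partial>\<mu>)" using M by (rule less_le_trans)
  then have "0 < (\<integral>\<^sup>+x\<in>Q. dyadic_maximal \<mu> D ?v x \<partial>\<mu>) / (\<integral>\<^sup>+x\<in>Q. ennreal (v x) \<partial>\<mu>)"
    unfolding I by (simp add: ennreal_zero_less_divide)
  also have "\<dots> \<le> Ainf_char \<mu> D v"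
    unfolding Ainf_char_def by (rule SUP_upper[OF Qpos])
  finally show ?thesis .
qed

end

section \<open>Weighted bounds for Haar shifts\<close>

lemma weight_set_integrable:
  assumes "sets \<mu> = sets borel" "is_weight \<mu> \<omega>" "is_ivl I"
  shows "set_integrable \<mu> I \<omega>"
proof -
  obtain a b where I: "I = {a..<b}" using assms(3) by (auto simp: is_ivl_def)
  have "set_integrable \<mu> {a..b} \<omega>" using assms(2) by (auto simp: is_weight_def)
  then show ?thesis by (rule set_integrable_subset) (auto simp: I assms(1))
qed

lemma epowr_pos: "0 < x \<Longrightarrow> 0 < epowr x a"
  by (cases x) (auto simp: epowr_def)

theorem corollary7:
  fixes \<mu> :: "real measure" and p \<beta> :: real and N :: nat
  assumes "locally_finite_borel \<mu>" and "1 < p"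
  shows "\<exists>C::real. C > 0 \<and>
    (\<forall>D \<omega> s t \<alpha> T.
       dyadic_lattice D \<longrightarrow> balanced_with \<beta> D \<mu> \<longrightarrow> is_weight \<mu> \<omega> \<longrightarrow>
       s + t \<le> N \<longrightarrow> haar_shift \<mu> D s t \<alpha> T \<longrightarrow> coeffs_bounded_by_1 D s t \<alpha> \<longrightarrow>
       weighted_op_norm \<mu> p \<omega> T
         \<le> ennreal C * epowr (Ap_char \<mu> D N p \<omega>) (1 / p) *
           (epowr (Ainf_char \<mu> D (dual_weight p \<omega>)) (1 / p) +
            epowr (Ainf_char \<mu> D \<omega>) (1 / conj_exp p)) \<and>
       weighted_op_norm \<mu> p \<omega> T
         \<le> ennreal C * epowr (Ap_char \<mu> D N p \<omega>) (max 1 (1 / (p - 1))))"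
proof (intro exI[of _ "final_const \<beta> p N"] conjI allI impI)
  show "0 < final_const \<beta> p N" by (rule final_const_pos)
next
  fix D \<omega> s t \<alpha> T
  assume dl: "dyadic_lattice D" and bal: "balanced_with \<beta> D \<mu>" and w: "is_weight \<mu> \<omega>"
    and st: "s + t \<le> N" and T: "haar_shift \<mu> D s t \<alpha> T" and \<alpha>: "coeffs_bounded_by_1 D s t \<alpha>"
  let ?C = "final_const \<beta> p N" and ?A = "Ap_char \<mu> D N p \<omega>"
  let ?a = "Ainf_char \<mu> D (dual_weight p \<omega>)" and ?b = "Ainf_char \<mu> D \<omega>"
  have C: "0 < ?C" by (rule final_const_pos)
  have sets: "sets \<mu> = sets borel" using assms(1) by (simp add: locally_finite_borel_def)
  interpret lattice_tree D by unfold_locales (rule dl)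
  have "weighted_op_norm \<mu> p \<omega> T \<le> ennreal ?C * epowr ?A (1 / p) * (epowr ?a (1 / p) + epowr ?b (1 / conj_exp p))
    \<and> weighted_op_norm \<mu> p \<omega> T \<le> ennreal ?C * epowr ?A (max 1 (1 / (p - 1)))"
  \<comment> \<open>If \<open>m\<close> vanishes somewhere, it vanishes everywhere, and so do all Haar functions.\<close>
  proof (cases "\<exists>I\<in>D. m_meas \<mu> I = 0")
    case True
    then have m0: "m_meas \<mu> I = 0" if "I \<in> D" for I using m_meas_zero_iff[OF bal] that by blast
    have haar0: "haar \<mu> I x = 0" if "I \<in> D" for I x using m0[OF that] by (simp add: haar_def)
    have "haar_block \<mu> D s t \<alpha> f I x = 0" for f I x
      unfolding haar_block_def by (intro sum.neutral ballI) (auto simp: dyadic_descendants_def haar0)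
    then have "weighted_op_norm \<mu> p \<omega> T \<le> ennreal 0"
      using assms(2) by (intro weighted_op_norm_le[OF assms(1) w assms(2) _ T]) simp_all
    then show ?thesis by simp
  next
    case False
    have pos: "0 < measure \<mu> I" if "I \<in> D" for I
      using False that unfolding m_meas_def by (metis div_by_0 measure_le_0_iff not_le)
    obtain Q0 where Q0: "Q0 \<in> D" using D_nonempty by blast
    interpret q0: meas_tree D \<mu> Q0 by unfold_locales (use assms(1) Q0 pos in auto)
    have om_pos: "AE x in \<mu>. 0 < \<omega> x" using w by (simp add: is_weight_def)
    have b_pos: "0 < ?b"
      by (rule q0.Ainf_char_pos[OF weight_set_integrable[OF sets w q0.Q_ivl] om_pos])
    show ?thesis
    \<comment> \<open>The right-hand sides are infinite because the second factor of the first one is positive.\<close>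
    proof (cases "?A = \<infinity>")
      case True
      have e: "epowr ?A r = \<infinity>" for r using True by (simp add: epowr_def)
      have "epowr ?b (1 / conj_exp p) \<noteq> 0" using epowr_pos[OF b_pos, of "1 / conj_exp p"] by simp
      then show ?thesis unfolding e using C by (simp add: ennreal_mult_top ennreal_top_mult)
    next
      case fin: False
      have wt: "weighted_tree D \<mu> Q \<omega> p \<beta> N" if "Q \<in> D" for Q
        by unfold_locales (use assms that pos w bal fin in \<open>auto simp: less_top\<close>)
      define A where "A = enn2real ?A"
      have A: "?A = ennreal A" "0 \<le> A" using fin by (auto simp: A_def less_top)
      interpret w0: weighted_tree D \<mu> Q0 \<omega> p \<beta> N by (rule wt[OF Q0])
      have A0: "w0.A = A" by (simp add: w0.A_def A_def)
      have q: "conj_exp p = w0.q" by (simp add: conj_exp_def w0.q_def)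
      have second: "weighted_op_norm \<mu> p \<omega> T \<le> ennreal (?C * A powr (max 1 (1 / (p - 1))))"
      proof (rule weighted_op_norm_le[OF assms(1) w assms(2) _ T])
        fix f b \<F> assume f: "f \<in> borel_measurable \<mu>" "\<And>x. cmod (f x) \<le> b" and F: "finite \<F>" "\<F> \<subseteq> D"
        obtain Q where Q: "Q \<in> D" "\<forall>I\<in>\<F>. \<exists>w. I = node_ivl Q w" using common_root[OF F] by blast
        interpret wq: weighted_tree D \<mu> Q \<omega> p \<beta> N by (rule wt[OF Q(1)])
        show "(\<integral>\<^sup>+x. ennreal (cmod (\<Sum>I\<in>\<F>. haar_block \<mu> D s t \<alpha> f I x) powr p) * ennreal (\<omega> x) \<partial>\<mu>)
          \<le> ennreal ((?C * A powr (max 1 (1 / (p - 1)))) powr p) *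
            (\<integral>\<^sup>+x. ennreal (cmod (f x) powr p) * ennreal (\<omega> x) \<partial>\<mu>)"
        proof (rule wq.finite_shift[OF f F(1) Q(2)[rule_format] st \<alpha> _ _ wq.packing_Ap(2,1)])
          show "\<bar>wq.Bound (wq.A powr (wq.q - 1) * (2 * pack_const N) powr wq.q) (wq.A * (2 * pack_const N) powr p)\<bar>
            \<le> ?C * A powr (max 1 (1 / (p - 1)))"
            using wq.Bound_Ap by (simp only: wq.A_def A_def)
        qed (use wq.A_nonneg in auto)
      qed (use C in simp)
      have first: "weighted_op_norm \<mu> p \<omega> T
        \<le> ennreal ?C * epowr ?A (1 / p) * (epowr ?a (1 / p) + epowr ?b (1 / conj_exp p))"
      proof (cases "?a = \<infinity> \<or> ?b = \<infinity>")
        case True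
        then have e: "epowr ?a (1 / p) + epowr ?b (1 / conj_exp p) = \<infinity>" by (auto simp: epowr_def)
        have "ennreal ?C * epowr ?A (1 / p) \<noteq> 0"
          using C w0.A_ge_1 by (simp add: A(1) A0 epowr_ennreal A(2))
        then show ?thesis unfolding e by (simp add: ennreal_mult_top)
      next
        case ab: False
        define a b where "a = enn2real ?a" and "b = enn2real ?b"
        have a: "?a = ennreal a" "0 \<le> a" and b: "?b = ennreal b" "0 \<le> b" using ab by (auto simp: a_def b_def less_top)
        have "weighted_op_norm \<mu> p \<omega> T \<le> ennreal (?C * (A powr (1 / p) * (a powr (1 / p) + b powr (1 / w0.q))))"
        proof (rule weighted_op_norm_le[OF assms(1) w assms(2) _ T])
          fix f c \<F> assume f: "f \<in> borel_measurable \<mu>" "\<And>x. cmod (f x) \<le> c" and F: "finite \<F>" "\<F> \<subseteq> D"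
          obtain Q where Q: "Q \<in> D" "\<forall>I\<in>\<F>. \<exists>w. I = node_ivl Q w" using common_root[OF F] by blast
          interpret wq: weighted_tree D \<mu> Q \<omega> p \<beta> N by (rule wt[OF Q(1)])
          have P: "0 \<le> pack_const N" using pack_const_ge_1[of N] by simp
          have fin': "Ainf_char \<mu> D wq.\<sigma> < \<infinity>" "Ainf_char \<mu> D \<omega> < \<infinity>"
            using ab by (auto simp: wq.\<sigma>_def less_top)
          show "(\<integral>\<^sup>+x. ennreal (cmod (\<Sum>I\<in>\<F>. haar_block \<mu> D s t \<alpha> f I x) powr p) * ennreal (\<omega> x) \<partial>\<mu>)
            \<le> ennreal ((?C * (A powr (1 / p) * (a powr (1 / p) + b powr (1 / w0.q)))) powr p) *
              (\<integral>\<^sup>+x. ennreal (cmod (f x) powr p) * ennreal (\<omega> x) \<partial>\<mu>)"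
          proof (rule wq.finite_shift[OF f F(1) Q(2)[rule_format] st \<alpha> _ _
                wq.Ainf_packing[OF wq.sg_int wq.sg_pos fin'(1) P] wq.Ainf_packing[OF wq.om_int wq.om_pos fin'(2) P]])
            show "\<bar>wq.Bound (pack_const N * enn2real (Ainf_char \<mu> D wq.\<sigma>)) (pack_const N * enn2real (Ainf_char \<mu> D \<omega>))\<bar>
              \<le> ?C * (A powr (1 / p) * (a powr (1 / p) + b powr (1 / w0.q)))"
              using wq.Bound_Ainf[of "enn2real (Ainf_char \<mu> D wq.\<sigma>)" "enn2real (Ainf_char \<mu> D \<omega>)"]
              by (simp only: wq.A_def A_def a_def b_def wq.\<sigma>_def wq.q_def w0.q_def enn2real_nonneg simp_thms)
          qed (use P in auto)
        qed (use C in simp)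
        also have "\<dots> = ennreal ?C * epowr ?A (1 / p) * (epowr ?a (1 / p) + epowr ?b (1 / conj_exp p))"
          unfolding a(1) b(1) A(1) q using C a(2) b(2) A(2)
          by (simp add: epowr_ennreal ennreal_mult ennreal_plus[symmetric] mult.assoc del: ennreal_plus)
        finally show ?thesis .
      qed
      have "ennreal (?C * A powr (max 1 (1 / (p - 1)))) = ennreal ?C * epowr ?A (max 1 (1 / (p - 1)))"
        unfolding A(1) using C A(2) by (simp add: epowr_ennreal ennreal_mult)
      with first second show ?thesis by simp
    qed
  qed
  then show "weighted_op_norm \<mu> p \<omega> T \<le> ennreal ?C * epowr ?A (1 / p) * (epowr ?a (1 / p) + epowr ?b (1 / conj_exp p))"
    "weighted_op_norm \<mu> p \<omega> T \<le> ennreal ?C * epowr ?A (max 1 (1 / (p - 1)))" by blast+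
qed

end
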